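(* Let $\theta^\ast\in(\tfrac12,1)$ be the point at which the strictly decreasing continuous function $g:(0,1)\to\mathbb{R}$, $$g(\theta):=2(1+\theta)-\sum_{\ell=0}^{\infty}\frac{\theta^{2\ell}(1-\theta^2)}{2/(1+\theta)-\theta^{\ell}},$$ changes sign, and let $0<\theta\le1$. Then: (i) If $\theta\le\theta^\ast$, then $\overline\rho^{(2)}_{\Xi_\theta}$ is the only solution of the bivariate RDE in the space $\mathcal{M}^{(2)}_\theta$. (ii) If $\theta^\ast<\theta$, then there exists a measure $\hat\rho^{(2)}\in\mathcal{M}^{(2)}_\theta$ with $\hat\rho^{(2)}\neq\overline\rho^{(2)}_{\Xi_\theta}$ that solves the bivariate RDE.
   Context: Let $I:=[0,1]\cup\{\infty\}$ and define $\chi:[0,1]\times\{1,2\}\times I^2\to I$ by: $\chi[\tau,1](x,y)=x$ if $x>\tau$, $\chi[\tau,1](x,y)=\infty$ if $x\le\tau$, and $\chi[\tau,2](x,y)=x\wedge y$. A probability measure $\rho^{(2)}$ on $I^2$ solves the bivariate RDE if, when $(Y_1,Y_1')$ and $(Y_2,Y_2')$ are independent with law $\rho^{(2)}$ and $\omega$ is independent of them and uniformly distributed on $[0,1]\times\{1,2\}$, the pair $(\chi[\omega](Y_1,Y_2),\chi[\omega](Y_1',Y_2'))$ again has law $\rho^{(2)}$. Set $\Xi_\theta:=\{\theta^n:n=0,1,2,\ldots\}$ for $0<\theta<1$ and $\Xi_1:=(0,1]$. Define probability measures on $I$ by $$\rho_{\Xi_\theta}:=\frac{1-\theta}{1+\theta}\sum_{k=0}^\infty\theta^k\delta_{\theta^k}+\frac{\theta}{1+\theta}\delta_\infty\quad(0<\theta<1),\qquad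 \rho_{\Xi_1}(\mathrm{d}t):=\tfrac12\,\mathrm{d}t+\tfrac12\delta_\infty(\mathrm{d}t),$$ where $\mathrm{d}t$ is Lebesgue measure on $[0,1]$. Let $\overline\rho^{(2)}_{\Xi_\theta}$ denote the law of $(Y,Y)$ where $Y$ has law $\rho_{\Xi_\theta}$. A probability measure on $I^2$ is symmetric if it is invariant under $(y_1,y_2)\mapsto(y_2,y_1)$. Let $\mathcal{M}^{(2)}$ be the space of all symmetric probability measures $\rho^{(2)}$ on $I^2$ with $\rho^{(2)}\big([0,t]\times I\cup I\times[0,t]\big)\le t$ for all $0\le t\le1$. For $t>0$ let $\psi_t:I\to I$ be $\psi_t(y):=t^{-1}y$ if $y\le t$ and $\psi_t(y):=\infty$ otherwise, let $\psi^{(2)}_t(y,y'):=(\psi_t(y),\psi_t(y'))$, and for $\rho\in\mathcal{M}^{(2)}$ let $$\Gamma^{(2)}_t\rho:=t^{-1}\,\rho\circ(\psi^{(2)}_t)^{-1}+(1-t^{-1})\,\delta_{(\infty,\infty)}.$$ For $0<\theta\le1$, $\mathcal{M}^{(2)}_\theta$ denotes the space of probability measures $\rho^{(2)}$ on $I^2$ such that $\rho^{(2)}\in\mathcal{M}^{(2)}$, both marginals of $\rho^{(2)}$ are $\rho_{\Xi_\theta}$, and $\Gamma^{(2)}_t\rho^{(2)}=\rho^{(2)}$ for all $t\in\Xi_\theta$. *)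

theory Defs
  imports "HOL-Probability.Probability"
begin

definition I_set :: "ereal set" where
  "I_set = {0..1} \<union> {\<infinity>}"

definition I_borel :: "ereal measure" where
  "I_borel = restrict_space borel I_set"

definition I2_borel :: "(ereal \<times> ereal) measure" where
  "I2_borel = I_borel \<Otimes>\<^sub>M I_borel"

definition chi :: "real \<times> nat \<Rightarrow> ereal \<Rightarrow> ereal \<Rightarrow> ereal" where
  "chi \<omega> x y = (case \<omega> of (\<tau>, \<kappa>) \<Rightarrow>
     if \<kappa> = 1 then (if x > ereal \<tau> then x else \<infinity>) else min x y)"

definition omega_law :: "(real \<times> nat) measure" where
  "omega_law = uniform_measure lborel {0..1} \<Otimes>\<^sub>M uniform_count_measure {1, 2}"

text \<open>
  Independence of \<open>\<omega>\<close>, \<open>(Y\<^sub>1, Y\<^sub>1')\<close>, \<open>(Y\<^sub>2, Y\<^sub>2')\<close> is expressed by their joint law being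
  the product measure. The same \<open>\<omega>\<close> is used in both coordinates.
\<close>
definition solves_bivariate_RDE :: "(ereal \<times> ereal) measure \<Rightarrow> bool" where
  "solves_bivariate_RDE \<rho> \<longleftrightarrow>
     distr (omega_law \<Otimes>\<^sub>M (\<rho> \<Otimes>\<^sub>M \<rho>)) I2_borel
       (\<lambda>(\<omega>, ((y1, y1'), (y2, y2'))). (chi \<omega> y1 y2, chi \<omega> y1' y2')) = \<rho>"

definition Xi :: "real \<Rightarrow> real set" where
  "Xi \<theta> = (if \<theta> < 1 then range (\<lambda>n::nat. \<theta> ^ n) else {0<..1})"

definition rho_Xi :: "real \<Rightarrow> ereal measure" where
  "rho_Xi \<theta> = measure_of I_set (sets I_borel) (\<lambda>A.
     if \<theta> < 1
     then ennreal ((1 - \<theta>) / (1 + \<theta>)) * (\<Sum>k. ennreal (\<theta> ^ k) * indicator A (ereal (\<theta> ^ k)))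
            + ennreal (\<theta> / (1 + \<theta>)) * indicator A \<infinity>
     else ennreal (1/2) * emeasure lborel {t \<in> {0..1}. ereal t \<in> A}
            + ennreal (1/2) * indicator A \<infinity>)"

definition rho_bar :: "real \<Rightarrow> (ereal \<times> ereal) measure" where
  "rho_bar \<theta> = distr (rho_Xi \<theta>) I2_borel (\<lambda>y. (y, y))"

definition M2 :: "(ereal \<times> ereal) measure set" where
  "M2 = {\<rho>. prob_space \<rho> \<and> sets \<rho> = sets I2_borel
      \<and> distr \<rho> I2_borel (\<lambda>(y1, y2). (y2, y1)) = \<rho>
      \<and> (\<forall>t\<in>{0..1}. measure \<rho> ({0..ereal t} \<times> I_set \<union> I_set \<times> {0..ereal t}) \<le> t)}"

definition psi :: "real \<Rightarrow> ereal \<Rightarrow> ereal" where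
  "psi t y = (if y \<le> ereal t then ereal (inverse t) * y else \<infinity>)"

definition psi2 :: "real \<Rightarrow> ereal \<times> ereal \<Rightarrow> ereal \<times> ereal" where
  "psi2 t = (\<lambda>(y, y'). (psi t y, psi t y'))"

text \<open>
  For \<open>t < 1\<close> the coefficient \<open>1 - t\<^sup>-\<^sup>1\<close> is negative, so the combination is formed in the reals.
  It is nonnegative for \<open>\<rho> \<in> M2\<close>, by the bound on \<open>\<rho> ([0,t] \<times> I \<union> I \<times> [0,t])\<close>;
  see \<open>emeasure_Gamma2\<close> below.
\<close>
definition Gamma2 :: "real \<Rightarrow> (ereal \<times> ereal) measure \<Rightarrow> (ereal \<times> ereal) measure" where
  "Gamma2 t \<rho> = measure_of (I_set \<times> I_set) (sets I2_borel) (\<lambda>A.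
     ennreal (inverse t * measure (distr \<rho> I2_borel (psi2 t)) A
       + (1 - inverse t) * indicator A (\<infinity>, \<infinity>)))"

definition M2_theta :: "real \<Rightarrow> (ereal \<times> ereal) measure set" where
  "M2_theta \<theta> = {\<rho> \<in> M2. distr \<rho> I_borel fst = rho_Xi \<theta> \<and> distr \<rho> I_borel snd = rho_Xi \<theta>
      \<and> (\<forall>t\<in>Xi \<theta>. Gamma2 t \<rho> = \<rho>)}"

definition g :: "real \<Rightarrow> real" where
  "g \<theta> = 2 * (1 + \<theta>) - (\<Sum>l. \<theta> ^ (2 * l) * (1 - \<theta>\<^sup>2) / (2 / (1 + \<theta>) - \<theta> ^ l))"

definition g_changes_sign_at :: "real \<Rightarrow> bool" where
  "g_changes_sign_at s \<longleftrightarrow>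
     s \<in> {0<..<1} \<and> (\<forall>t\<in>{0<..<s}. g t > 0) \<and> (\<forall>t\<in>{s<..<1}. g t < 0)"

definition theta_star :: real where
  "theta_star = (THE s. g_changes_sign_at s)"

lemma space_I_borel [simp]: "space I_borel = I_set"
  by (simp add: I_borel_def space_restrict_space)

lemma space_I2_borel [simp]: "space I2_borel = I_set \<times> I_set"
  by (simp add: I2_borel_def space_pair_measure)

lemma sets_I_borel_iff: "A \<in> sets I_borel \<longleftrightarrow> A \<in> sets borel \<and> A \<subseteq> I_set"
  unfolding I_borel_def by (subst sets_restrict_space_iff) (auto simp: I_set_def)

lemma sets_I_borel_vimage:
  assumes "A \<in> sets I_borel"
  shows "{t \<in> {0..1}. ereal t \<in> A} \<in> sets lborel"
proof -
  have "ereal -` A \<inter> space borel \<in> sets borel"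
    by (rule measurable_sets[of ereal borel borel]) (use assms in \<open>auto simp: sets_I_borel_iff\<close>)
  then have "{0..1} \<inter> (ereal -` A) \<in> sets lborel" by auto
  also have "{0..1} \<inter> (ereal -` A) = {t \<in> {0..1}. ereal t \<in> A}" by auto
  finally show ?thesis .
qed

lemma suminf_swap_ennreal:
  fixes f :: "nat \<Rightarrow> nat \<Rightarrow> ennreal"
  shows "(\<Sum>i. \<Sum>k. f i k) = (\<Sum>k. \<Sum>i. f i k)"
  using nn_integral_suminf[of f "count_space UNIV"]
  by (simp add: nn_integral_count_space_nat)

text \<open>The set functions given to \<^const>\<open>measure_of\<close> above are indeed measures.\<close>

lemma emeasure_rho_Xi:
  assumes "A \<in> sets I_borel"
  shows "emeasure (rho_Xi \<theta>) A =
     (if \<theta> < 1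
      then ennreal ((1 - \<theta>) / (1 + \<theta>)) * (\<Sum>k. ennreal (\<theta> ^ k) * indicator A (ereal (\<theta> ^ k)))
            + ennreal (\<theta> / (1 + \<theta>)) * indicator A \<infinity>
      else ennreal (1/2) * emeasure lborel {t \<in> {0..1}. ereal t \<in> A}
            + ennreal (1/2) * indicator A \<infinity>)"
  unfolding rho_Xi_def
proof (rule emeasure_measure_of_sigma)
  show "sigma_algebra I_set (sets I_borel)"
    using sets.sigma_algebra_axioms[of I_borel] by simp
  show "countably_additive (sets I_borel) (\<lambda>A.
     if \<theta> < 1
      then ennreal ((1 - \<theta>) / (1 + \<theta>)) * (\<Sum>k. ennreal (\<theta> ^ k) * indicator A (ereal (\<theta> ^ k)))
            + ennreal (\<theta> / (1 + \<theta>)) * indicator A \<infinity>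
      else ennreal (1/2) * emeasure lborel {t \<in> {0..1}. ereal t \<in> A}
            + ennreal (1/2) * indicator A \<infinity>)" (is "countably_additive _ ?m")
  proof (rule countably_additiveI)
    fix B :: "nat \<Rightarrow> ereal set"
    assume B: "range B \<subseteq> sets I_borel" "disjoint_family B" "(\<Union>i. B i) \<in> sets I_borel"
    have ind: "(\<Sum>i. indicator (B i) x) = (indicator (\<Union>i. B i) x :: ennreal)" for x
      using B(2) by (rule suminf_indicator)
    have swap: "(\<Sum>i. \<Sum>k. ennreal (\<theta> ^ k) * indicator (B i) (ereal (\<theta> ^ k))) =
        (\<Sum>k. ennreal (\<theta> ^ k) * indicator (\<Union>i. B i) (ereal (\<theta> ^ k)))"
      by (subst suminf_swap_ennreal) (simp only: ennreal_suminf_cmult ind)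
    have un: "{t \<in> {0..1}. ereal t \<in> (\<Union>i. B i)} = (\<Union>i. {t \<in> {0..1}. ereal t \<in> B i})"
      by auto
    have leb: "(\<Sum>i. emeasure lborel {t \<in> {0..1}. ereal t \<in> B i})
        = emeasure lborel {t \<in> {0..1}. ereal t \<in> (\<Union>i. B i)}"
      unfolding un
    proof (rule suminf_emeasure)
      show "range (\<lambda>i. {t \<in> {0..1}. ereal t \<in> B i}) \<subseteq> sets lborel"
        using B(1) sets_I_borel_vimage by blast
      show "disjoint_family (\<lambda>i. {t \<in> {0..1}. ereal t \<in> B i})"
        using B(2) unfolding disjoint_family_on_def by blast
    qed
    have add: "(\<Sum>i. f i + h i) = (\<Sum>i. f i) + (\<Sum>i. h i)" for f h :: "nat \<Rightarrow> ennreal"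
      by (intro suminf_add[symmetric]) auto
    show "(\<Sum>i. ?m (B i)) = ?m (\<Union>i. B i)"
    proof (cases "\<theta> < 1")
      case True
      then show ?thesis by (simp only: if_True add ennreal_suminf_cmult swap ind)
    next
      case False
      then show ?thesis by (simp only: if_False add ennreal_suminf_cmult leb ind)
    qed
  qed
qed (use assms in \<open>auto simp: positive_def\<close>)

lemma psi_in_I: "0 < t \<Longrightarrow> y \<in> I_set \<Longrightarrow> psi t y \<in> I_set"
  by (cases y) (auto simp: psi_def I_set_def field_simps)

lemma measurable_psi2:
  assumes "0 < t"
  shows "psi2 t \<in> measurable I2_borel I2_borel"
proof -
  have "psi t \<in> measurable I_borel borel"
    unfolding psi_def I_borel_def by (rule measurable_restrict_space1) measurable
  then have [measurable]: "psi t \<in> measurable I_borel I_borel"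
    unfolding I_borel_def
    by (intro measurable_restrict_space2)
       (use psi_in_I[OF assms] in \<open>auto simp: I_borel_def[symmetric]\<close>)
  show ?thesis unfolding psi2_def I2_borel_def by measurable
qed

lemma Gamma2_nonneg:
  assumes "\<rho> \<in> M2" "0 < t" "A \<in> sets I2_borel"
  shows "0 \<le> inverse t * measure (distr \<rho> I2_borel (psi2 t)) A
       + (1 - inverse t) * indicator A (\<infinity>, \<infinity>)"
proof (cases "t \<le> 1 \<and> (\<infinity>, \<infinity>) \<in> A")
  case False
  with assms(2) have "0 \<le> (1 - inverse t) * indicator A (\<infinity>, \<infinity>)"
    by (auto simp: indicator_def field_simps)
  with assms(2) show ?thesis by (simp add: add_nonneg_nonneg)
next
  case True
  interpret prob_space \<rho> using assms(1) by (simp add: M2_def)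
  have sets: "sets \<rho> = sets I2_borel" using assms(1) by (simp add: M2_def)
  have space: "space \<rho> = I_set \<times> I_set" using sets_eq_imp_space_eq[OF sets] by simp
  have meas: "psi2 t \<in> measurable \<rho> I2_borel"
    using measurable_psi2[OF assms(2)] sets by (simp cong: measurable_cong_sets)
  let ?S = "{0..ereal t} \<times> I_set \<union> I_set \<times> {0..ereal t}"
  have sub: "{0..ereal t} \<subseteq> I_set" using True order_trans[of _ "ereal t" 1] by (auto simp: I_set_def)
  have S: "?S \<in> sets \<rho>" unfolding sets I2_borel_def
    using sub by (intro sets.Un pair_measureI) (auto simp: sets_I_borel_iff I_set_def)
  have "1 - t \<le> 1 - measure \<rho> ?S"
    using assms(1,2) True by (auto simp: M2_def)
  also have "\<dots> = measure \<rho> (space \<rho> - ?S)" using prob_compl[OF S] by simp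
  also have "\<dots> \<le> measure \<rho> (psi2 t -` A \<inter> space \<rho>)"
  proof (rule finite_measure_mono)
    show "space \<rho> - ?S \<subseteq> psi2 t -` A \<inter> space \<rho>"
      using True by (auto simp: space psi2_def psi_def I_set_def)
    show "psi2 t -` A \<inter> space \<rho> \<in> events"
      using meas assms(3) by (rule measurable_sets)
  qed
  also have "\<dots> = measure (distr \<rho> I2_borel (psi2 t)) A"
    using meas assms(3) by (simp add: measure_distr)
  finally have "inverse t * (1 - t) \<le> inverse t * measure (distr \<rho> I2_borel (psi2 t)) A"
    using assms(2) by (intro mult_left_mono) auto
  with True assms(2) show ?thesis by (simp add: field_simps)
qed

lemma emeasure_Gamma2:
  assumes "\<rho> \<in> M2" "0 < t" "A \<in> sets I2_borel"
  shows "emeasure (Gamma2 t \<rho>) A =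
     ennreal (inverse t * measure (distr \<rho> I2_borel (psi2 t)) A
       + (1 - inverse t) * indicator A (\<infinity>, \<infinity>))"
  unfolding Gamma2_def
proof (rule emeasure_measure_of_sigma)
  show "sigma_algebra (I_set \<times> I_set) (sets I2_borel)"
    using sets.sigma_algebra_axioms[of I2_borel] by simp
  let ?f = "\<lambda>A. inverse t * measure (distr \<rho> I2_borel (psi2 t)) A
       + (1 - inverse t) * indicator A (\<infinity>, \<infinity>)"
  interpret prob_space \<rho> using assms(1) by (simp add: M2_def)
  have "sets \<rho> = sets I2_borel" using assms(1) by (simp add: M2_def)
  then have "psi2 t \<in> measurable \<rho> I2_borel"
    using measurable_psi2[OF assms(2)] by (simp cong: measurable_cong_sets)
  then interpret D: prob_space "distr \<rho> I2_borel (psi2 t)" by (rule prob_space_distr)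
  show "countably_additive (sets I2_borel) (\<lambda>A. ennreal (?f A))"
  proof (rule countably_additiveI)
    fix B :: "nat \<Rightarrow> (ereal \<times> ereal) set"
    assume B: "range B \<subseteq> sets I2_borel" "disjoint_family B" "(\<Union>i. B i) \<in> sets I2_borel"
    have 1: "(\<lambda>i. measure (distr \<rho> I2_borel (psi2 t)) (B i)) sums
        measure (distr \<rho> I2_borel (psi2 t)) (\<Union>i. B i)"
      using B by (intro D.finite_measure_UNION) auto
    have 2: "(\<lambda>i. indicator (B i) x :: real) sums indicator (\<Union>i. B i) x" for x
    proof (cases "x \<in> (\<Union>i. B i)")
      case True
      then obtain j where j: "x \<in> B j" by auto
      then have "indicator (B i) x = (if i = j then 1 else 0 :: real)" for i
        using B(2) by (auto simp: disjoint_family_on_def indicator_def)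
      moreover have "indicator (\<Union>i. B i) x = (1::real)" using True by simp
      ultimately show ?thesis using sums_single[of j "\<lambda>_. 1::real"] by simp
    qed (simp add: indicator_def)
    have sums: "(\<lambda>i. ?f (B i)) sums ?f (\<Union>i. B i)"
      by (intro sums_add sums_mult 1 2)
    have "0 \<le> ?f (B i)" for i
      using B(1) by (intro Gamma2_nonneg assms) auto
    then show "(\<Sum>i. ennreal (?f (B i))) = ennreal (?f (\<Union>i. B i))"
      using sums by (subst suminf_ennreal2) (auto simp: sums_iff)
  qed
qed (use assms in \<open>auto simp: positive_def\<close>)

end

theory Submission
  imports Defs
begin

text \<open>
  Let \<open>H s t = P (Y \<le> s \<or> Y' \<le> t)\<close>. The RDE is equivalent to
  \<open>(H s t)\<^sup>2 = E (max (Y 1{Y \<le> s}) (Y' 1{Y' \<le> t}))\<close> for all real \<open>s\<close>, \<open>t\<close>, and scale invariance reduces \<open>H\<close>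
  to the one-parameter function \<open>f t = H 1 t\<close> on \<open>Xi \<theta>\<close>. For \<open>\<theta> < 1\<close> the RDE becomes a recursion for
  \<open>f j = H 1 (\<theta> ^ j)\<close>: with \<open>c = 1 / (1 + \<theta>)\<close>,
  \<open>(f j - f (j + 1)) * (f j + f (j + 1) - \<theta> ^ j) = \<theta> ^ (2 * j) * (1 - \<theta>\<^sup>2) * f 0 * (f 0 - c) / 2\<close>, together
  with \<open>f j \<longlonglongrightarrow> c\<close>. The constant sequence \<open>c\<close> is the diagonal solution, and linearizing around it gives
  the series in \<open>g\<close>. If \<open>g \<theta> \<ge> 0\<close>, Chebyshev's sum inequality excludes every other solution;
  if \<open>g \<theta> < 0\<close>, a shooting argument in \<open>f 0\<close> produces one, and its second differences are the
  nonnegative masses of a joint law. For \<open>\<theta> = 1\<close> the recursion turns into the differential equation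
  \<open>f' * (2 * f - y) = k * y\<close>, which is solved explicitly, and \<open>f''\<close> gives the density of the joint law.
\<close>

section \<open>The function \<open>g\<close>\<close>

text \<open>Conditioning on the second component of \<open>\<omega>\<close> turns the RDE into
  \<open>1 - H = (1 - E) / 2 + (1 - H)\<^sup>2 / 2\<close>, where \<open>E\<close> is the expected
  truncated maximum; the linear terms cancel, whence \<open>H\<^sup>2 = E\<close>. The constant
  \<open>c\<close> is the marginal mass of \<open>[0,1]\<close>; \<open>f j\<close> tends to it
  because the second event shrinks to a null set. To first order in \<open>e j = f j - c\<close> the
  recursion reads \<open>(e j - e (j + 1)) * (2 * c - \<theta> ^ j) = (1 - \<theta>\<^sup>2) * c * e
  0 / 2 * \<theta> ^ (2 * j)\<close>; dividing by the bracket and summing gives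
  \<open>e 0 = e 0 * A / (2 * (1 + \<theta>))\<close>, where \<open>A\<close> is the series in
  \<open>g\<close>, so \<open>g \<theta> = 0\<close> marks the bifurcation. Linearization decides
  neither the critical point nor large excesses, hence uniqueness rests on exact summed identities.
  The obstacle for existence is that \<open>f 0\<close> is both the start of the recursion and part
  of its source term, so monotone dependence on it is not evident; the smallest unbroken start above
  a failing one is taken instead. That the resulting numbers are masses of a measure is a separate
  matter, settled by inserting trial values into the quadratic.\<close>

definition g_term :: "nat \<Rightarrow> real \<Rightarrow> real" where
  "g_term l \<theta> = \<theta> ^ (2 * l) * (1 - \<theta>\<^sup>2) / (2 / (1 + \<theta>) - \<theta> ^ l)"

lemma g_eq_g_term: "g \<theta> = 2 * (1 + \<theta>) - (\<Sum>l. g_term l \<theta>)"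
  by (simp add: g_def g_term_def)

lemma g_denominator_pos:
  fixes \<theta> :: real
  assumes "0 < \<theta>" "\<theta> < 1"
  shows "0 < 2 / (1 + \<theta>) - 1" "2 / (1 + \<theta>) - 1 \<le> 2 / (1 + \<theta>) - \<theta> ^ l"
    "0 < 2 / (1 + \<theta>) - \<theta> ^ l"
proof -
  show 1: "0 < 2 / (1 + \<theta>) - 1" using assms by (simp add: field_simps)
  show 2: "2 / (1 + \<theta>) - 1 \<le> 2 / (1 + \<theta>) - \<theta> ^ l" using assms by (simp add: power_le_one)
  show "0 < 2 / (1 + \<theta>) - \<theta> ^ l" using 1 2 by linarith
qed

lemma g_term_nonneg:
  assumes "0 < \<theta>" "\<theta> < 1"
  shows "0 \<le> g_term l \<theta>"
  using g_denominator_pos(3)[OF assms, of l] assms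
  by (auto simp: g_term_def power2_eq_square mult_le_one intro!: divide_nonneg_pos mult_nonneg_nonneg)

text \<open>The denominator is smallest at \<open>l = 0\<close>, and there
  \<open>1 - \<theta>\<^sup>2\<close> cancels against it, leaving
  \<open>(1 + \<theta>)\<^sup>2\<close>, which is below 4. Nothing in the constant blows up as
  \<theta> tends to 1, so the bound also yields a locally uniform majorant.\<close>

lemma g_term_le:
  assumes "0 < \<theta>" "\<theta> < 1"
  shows "g_term l \<theta> \<le> 4 * (\<theta>\<^sup>2) ^ l"
proof -
  have sq: "0 \<le> 1 - \<theta>\<^sup>2" using assms by (simp add: power2_eq_square mult_le_one)
  have "g_term l \<theta> \<le> \<theta> ^ (2 * l) * (1 - \<theta>\<^sup>2) / (2 / (1 + \<theta>) - 1)"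
    unfolding g_term_def using g_denominator_pos[OF assms] assms sq
    by (intro divide_left_mono mult_nonneg_nonneg mult_pos_pos) auto
  also have "\<dots> = (1 + \<theta>)\<^sup>2 * (\<theta>\<^sup>2) ^ l"
  proof -
    have "(1 - \<theta>\<^sup>2) / (2 / (1 + \<theta>) - 1) = (1 + \<theta>)\<^sup>2"
      using assms by (simp add: field_simps power2_eq_square)
    then show ?thesis by (simp add: power_mult[symmetric] mult.commute)
      (metis mult.commute times_divide_eq_right)
  qed
  also have "\<dots> \<le> 4 * (\<theta>\<^sup>2) ^ l"
  proof (rule mult_right_mono)
    have "(1 + \<theta>)\<^sup>2 \<le> 2\<^sup>2" using assms by (intro power_mono) auto
    then show "(1 + \<theta>)\<^sup>2 \<le> 4" by simp
  qed auto
  finally show ?thesis .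
qed

lemma summable_g_term:
  assumes "0 < \<theta>" "\<theta> < 1"
  shows "summable (\<lambda>l. g_term l \<theta>)"
proof (rule summable_comparison_test')
  show "summable (\<lambda>l. 4 * (\<theta>\<^sup>2) ^ l)"
    using assms by (intro summable_mult summable_geometric) (simp add: power_less_one_iff)
  show "norm (g_term l \<theta>) \<le> 4 * (\<theta>\<^sup>2) ^ l" for l
    using g_term_le[OF assms, of l] g_term_nonneg[OF assms, of l] by simp
qed

text \<open>Cancelling \<open>1 - \<theta>\<close> gives a form in which each summand is visibly increasing.\<close>
lemma g_term_eq:
  assumes "0 < \<theta>" "\<theta> < 1"
  shows "g_term l \<theta> = (1 + \<theta>)\<^sup>2 * \<theta> ^ l / (1 + 2 * (\<Sum>i<l. (1 / \<theta>) ^ Suc i))"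
proof -
  \<comment> \<open>\<open>Q\<close> rewrites \<open>1 - \<theta> ^ l\<close> as
    \<open>(1 - \<theta>) * \<theta> ^ l * Q\<close>, so that the degenerate factor
    \<open>1 - \<theta>\<close> can be cancelled; powers of \<open>1 / \<theta>\<close> make the new
    denominator decrease in \<theta>.\<close>
  define Q where "Q = (\<Sum>i<l. (1 / \<theta>) ^ Suc i)"
  have Q0: "0 \<le> Q" unfolding Q_def using assms by (intro sum_nonneg) auto
  have Q: "(1 - \<theta>) * \<theta> ^ l * Q = 1 - \<theta> ^ l"
    unfolding Q_def
  proof (induction l)
    case (Suc n)
    have "(1 - \<theta>) * \<theta> ^ Suc n * (\<Sum>i<Suc n. (1 / \<theta>) ^ Suc i)
      = \<theta> * ((1 - \<theta>) * \<theta> ^ n * (\<Sum>i<n. (1 / \<theta>) ^ Suc i)) + (1 - \<theta>) * (\<theta> ^ Suc n * (1 / \<theta>) ^ Suc n)"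
      by (simp add: algebra_simps)
    also have "\<theta> ^ Suc n * (1 / \<theta>) ^ Suc n = 1"
      using assms by (metis divide_eq_eq less_irrefl mult.commute power_mult_distrib power_one)
    finally have e: "(1 - \<theta>) * \<theta> ^ Suc n * (\<Sum>i<Suc n. (1 / \<theta>) ^ Suc i)
      = \<theta> * (1 - \<theta> ^ n) + (1 - \<theta>) * 1" unfolding Suc.IH .
    show ?case unfolding e by (simp add: algebra_simps)
  qed simp
  have "(2 / (1 + \<theta>) - \<theta> ^ l) * (1 + \<theta>) = 2 * (1 - \<theta> ^ l) + \<theta> ^ l * (1 - \<theta>)"
    using assms by (simp add: field_simps)
  also have "\<dots> = (1 - \<theta>) * \<theta> ^ l * (1 + 2 * Q)"
    unfolding Q[symmetric] by (simp add: algebra_simps)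
  finally have d: "2 / (1 + \<theta>) - \<theta> ^ l = (1 - \<theta>) * \<theta> ^ l * (1 + 2 * Q) / (1 + \<theta>)"
    using assms by (intro eq_divide_imp) auto
  have "\<theta> ^ (2 * l) = \<theta> ^ l * \<theta> ^ l" by (simp add: mult_2 power_add)
  moreover have "1 - \<theta>\<^sup>2 = (1 - \<theta>) * (1 + \<theta>)" by (simp add: power2_eq_square algebra_simps)
  moreover have "t * t * (u * v) / (u * t * P / v) = v\<^sup>2 * t / P"
    if "t \<noteq> 0" "u \<noteq> 0" "v \<noteq> 0" "P \<noteq> 0" for t u v P :: real
    using that by (simp add: field_simps power2_eq_square)
  ultimately show ?thesis unfolding g_term_def d Q_def[symmetric] using assms Q0
    by (simp add: power2_eq_square)
qed

lemma g_term_0: "0 < \<theta> \<Longrightarrow> \<theta> < 1 \<Longrightarrow> g_term 0 \<theta> = (1 + \<theta>)\<^sup>2"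
  by (simp add: g_term_eq)

lemma g_term_mono:
  assumes "0 < x" "x \<le> y" "y < 1"
  shows "g_term l x \<le> g_term l y"
proof -
  have "(\<Sum>i<l. (1 / y) ^ Suc i) \<le> (\<Sum>i<l. (1 / x) ^ Suc i)"
    using assms by (intro sum_mono power_mono) (auto simp: frac_le)
  moreover have "0 \<le> (\<Sum>i<l. (1 / y) ^ Suc i)"
    using assms by (intro sum_nonneg) auto
  ultimately show ?thesis using assms
    by (subst (1 2) g_term_eq) (auto intro!: frac_le mult_mono power_mono)
qed

text \<open>The increasing term \<open>2 * (1 + \<theta>)\<close> would spoil monotonicity; merged
  with the summand at \<open>l = 0\<close> it becomes \<open>1 - \<theta>\<^sup>2\<close>, which
  decreases strictly, so weak monotonicity of the tail is enough.\<close>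

lemma g_eq_tail:
  assumes "0 < \<theta>" "\<theta> < 1"
  shows "g \<theta> = 1 - \<theta>\<^sup>2 - (\<Sum>l. g_term (Suc l) \<theta>)"
  using suminf_split_head[OF summable_g_term[OF assms]] g_term_0[OF assms]
  by (simp add: g_eq_g_term power2_eq_square algebra_simps)

lemma g_strict_antimono:
  assumes "0 < x" "x < y" "y < 1"
  shows "g y < g x"
proof -
  have "(\<Sum>l. g_term (Suc l) x) \<le> (\<Sum>l. g_term (Suc l) y)"
    using assms by (intro suminf_le g_term_mono summable_Suc_iff[THEN iffD2] summable_g_term) auto
  moreover have "x\<^sup>2 < y\<^sup>2" using assms by (intro power_strict_mono) auto
  ultimately show ?thesis using assms by (subst (1 2) g_eq_tail) auto
qed

lemma continuous_on_g: "continuous_on {0<..<1} g"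
proof (rule continuous_at_imp_continuous_on, safe)
  fix x :: real assume x: "x \<in> {0<..<1}"
  \<comment> \<open>The majorant \<open>4 * (\<theta>\<^sup>2) ^ l\<close> is uniformly summable
    only away from 1, so the uniform limit is taken to the left of a point between \<open>x\<close>
    and 1.\<close>
  define b where "b = (1 + x) / 2"
  have b: "x < b" "b < 1" "0 < b" using x by (auto simp: b_def)
  have "continuous_on {0<..<b} (\<lambda>\<theta>. \<Sum>l. g_term l \<theta>)"
  proof (rule uniform_limit_theorem)
    show "\<forall>\<^sub>F n in sequentially. continuous_on {0<..<b} (\<lambda>\<theta>. \<Sum>l<n. g_term l \<theta>)"
      unfolding g_term_def using b g_denominator_pos(3)
      by (intro always_eventually allI continuous_intros) force+
    show "uniform_limit {0<..<b} (\<lambda>n \<theta>. \<Sum>l<n. g_term l \<theta>) (\<lambda>\<theta>. \<Sum>l. g_term l \<theta>) sequentially"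
    proof (rule Weierstrass_m_test)
      show "summable (\<lambda>l. 4 * (b\<^sup>2) ^ l)"
        using b by (intro summable_mult summable_geometric) (simp add: power_less_one_iff)
      fix l \<theta> assume \<theta>: "\<theta> \<in> {0<..<b}"
      have "norm (g_term l \<theta>) \<le> 4 * (\<theta>\<^sup>2) ^ l"
        using \<theta> b g_term_le[of \<theta> l] g_term_nonneg[of \<theta> l] by simp
      also have "\<dots> \<le> 4 * (b\<^sup>2) ^ l"
        using \<theta> by (intro mult_left_mono power_mono) auto
      finally show "norm (g_term l \<theta>) \<le> 4 * (b\<^sup>2) ^ l" .
    qed
  qed simp
  then have "continuous_on {0<..<b} g"
    unfolding g_eq_g_term[abs_def] by (intro continuous_intros)
  then show "isCont g x" using x b by (simp add: continuous_on_eq_continuous_at)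
qed

lemma g_half_pos: "0 < g (1/2)"
proof -
  \<comment> \<open>For indices from 1 on, the denominators are at least
    \<open>4/3 - 1/2 = 5/6\<close>, and \<open>9/40 = (1/4) * (3/4) / (5/6)\<close>. The geometric
    sum is \<open>3/10\<close>, below \<open>1 - (1/2)\<^sup>2 = 3/4\<close>.\<close>
  have "(\<Sum>l. g_term (Suc l) (1/2)) \<le> (\<Sum>l. (9/40) * (1/4::real) ^ l)"
  proof (rule suminf_le)
    show "g_term (Suc l) (1/2) \<le> (9/40) * (1/4) ^ l" for l
    proof -
      have "5/4 \<le> (2 / (1 + 1/2) - (1/2::real) ^ Suc l) * 3/2"
        using power_le_one[of "1/2::real" l] by simp
      then have "5/6 \<le> 2 / (1 + 1/2) - (1/2::real) ^ Suc l" by simp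
      then have "g_term (Suc l) (1/2) \<le> (1/2) ^ (2 * Suc l) * (1 - (1/2)\<^sup>2) / (5/6)"
        unfolding g_term_def by (intro divide_left_mono) (auto simp: power2_eq_square)
      also have "\<dots> = (9/40) * (1/4) ^ l"
        by (simp add: power_mult power2_eq_square power_divide)
      finally show ?thesis .
    qed
    show "summable (\<lambda>l. g_term (Suc l) (1/2))"
      by (intro summable_Suc_iff[THEN iffD2] summable_g_term) auto
    show "summable (\<lambda>l. (9/40) * (1/4::real) ^ l)" by (intro summable_mult summable_geometric) auto
  qed
  also have "\<dots> = 3/10" by (subst suminf_mult) (auto simp: suminf_geometric summable_geometric)
  finally show ?thesis by (subst g_eq_tail) (auto simp: power2_eq_square)
qed

text \<open>The first tail term is about 1 and alone outweighs
  \<open>1 - (9/10)\<^sup>2 = 19/100\<close>.\<close>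

lemma g_nine_tenths_neg: "g (9/10) < 0"
proof -
  have "g_term (Suc 0) (9/10) \<le> (\<Sum>l. g_term (Suc l) (9/10))"
    using sum_le_suminf[of "\<lambda>l. g_term (Suc l) (9/10)" "{0}"]
      summable_Suc_iff[THEN iffD2, OF summable_g_term[of "9/10"]]
    by (simp add: g_term_nonneg)
  moreover have "1/2 < g_term (Suc 0) (9/10)" by (simp add: g_term_def power2_eq_square)
  ultimately show ?thesis by (subst g_eq_tail) (auto simp: power2_eq_square)
qed

lemma g_changes_sign_at_theta_star:
  "g_changes_sign_at theta_star" "theta_star \<in> {1/2<..<1}" "g theta_star = 0"
proof -
  have "\<exists>s\<ge>1/2. s \<le> 9/10 \<and> g s = 0"
    using g_half_pos g_nine_tenths_neg
    by (intro IVT2' continuous_on_subset[OF continuous_on_g]) auto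
  then obtain s where s: "1/2 \<le> s" "s \<le> 9/10" "g s = 0" by auto
  then have "s \<noteq> 1/2" using g_half_pos by (metis less_irrefl)
  with s have s1: "1/2 < s" "s < 1" by auto
  have sc: "g_changes_sign_at s"
    using s1 s(3) g_strict_antimono[of _ s] g_strict_antimono[of s]
    by (force simp: g_changes_sign_at_def)
  have uniq: "s' = s" if s': "g_changes_sign_at s'" for s'
  proof (rule ccontr)
    assume "s' \<noteq> s"
    then consider "s' < s" | "s < s'" by linarith
    then show False
    proof cases
      case 1
      then have "(s' + s)/2 \<in> {s'<..<1}" "(s' + s)/2 \<in> {0<..<s}"
        using s' sc by (auto simp: g_changes_sign_at_def)
      then show False using s' sc unfolding g_changes_sign_at_def by (metis less_asym)
    next
      case 2
      then have "(s' + s)/2 \<in> {s<..<1}" "(s' + s)/2 \<in> {0<..<s'}"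
        using s' sc by (auto simp: g_changes_sign_at_def)
      then show False using s' sc unfolding g_changes_sign_at_def by (metis less_asym)
    qed
  qed
  have "theta_star = s" unfolding theta_star_def using sc uniq by (rule the_equality)
  with sc s1 s(3) show "g_changes_sign_at theta_star" "theta_star \<in> {1/2<..<1}" "g theta_star = 0"
    by auto
qed

section \<open>The recursion for the joint distribution function\<close>

text \<open>For \<open>m\<close> the mean of \<open>r\<close> and any constant \<open>a'\<close>,
  the \<open>v\<close>-average of \<open>(a j - a') * (r j - m)\<close> is the covariance of
  \<open>a\<close> and \<open>r\<close>, so it suffices to find one \<open>a'\<close> that makes
  every product nonnegative.\<close>

lemma chebyshev_sum_decseq:
  fixes v a r :: "nat \<Rightarrow> real"
  assumes v: "\<And>j. 0 \<le> v j" "v sums 1" and a: "decseq a" "\<And>j. 0 \<le> a j"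
    and r: "decseq r" "\<And>j. 0 \<le> r j"
  shows "summable (\<lambda>j. v j * a j)" "summable (\<lambda>j. v j * r j)" "summable (\<lambda>j. v j * (a j * r j))"
    "(\<Sum>j. v j * a j) * (\<Sum>j. v j * r j) \<le> (\<Sum>j. v j * (a j * r j))"
proof -
  have bounded: "summable (\<lambda>j. v j * u j)" if "\<And>j. 0 \<le> u j" "\<And>j. u j \<le> u 0" for u :: "nat \<Rightarrow> real"
  proof (rule summable_comparison_test')
    show "summable (\<lambda>j. v j * u 0)" using v(2) by (intro summable_mult2) (auto simp: sums_iff)
    show "norm (v j * u j) \<le> v j * u 0" for j
      using that v(1) by (auto simp: abs_mult intro!: mult_left_mono)
  qed
  show va: "summable (\<lambda>j. v j * a j)" and vr: "summable (\<lambda>j. v j * r j)"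
    and var: "summable (\<lambda>j. v j * (a j * r j))"
    using a r by (auto intro!: bounded mult_mono simp: decseq_def)
  define m where "m = (\<Sum>j. v j * r j)"
  \<comment> \<open>\<open>a'\<close> is the value of \<open>a\<close> at the first index where
    \<open>r\<close> has dropped to its mean, so both factors change sign together. If
    \<open>r\<close> never drops that far, \<open>a' = 0\<close> does, since \<open>a\<close> is
    nonnegative.\<close>
  obtain a' where a': "\<And>j. 0 \<le> (a j - a') * (r j - m)"
  proof (cases "\<exists>J. r J \<le> m")
    case True
    define J where "J = (LEAST J. r J \<le> m)"
    have J: "r J \<le> m" "\<And>j. j < J \<Longrightarrow> m < r j"
      unfolding J_def using True by (auto intro: LeastI_ex dest: not_less_Least)
    show ?thesis
    proof (rule that)
      fix j show "0 \<le> (a j - a J) * (r j - m)"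
      proof (cases "j < J")
        case True
        then show ?thesis using J(2)[of j] decseqD[OF a(1), of j J] by simp
      next
        case False
        then have "a j \<le> a J" "r j \<le> m"
          using J(1) decseqD[OF a(1), of J j] decseqD[OF r(1), of J j] by auto
        then show ?thesis by (intro mult_nonpos_nonpos) auto
      qed
    qed
  next
    case False
    then show ?thesis using a(2) by (intro that[of 0]) (auto simp: not_le less_imp_le)
  qed
  have "0 \<le> (\<Sum>j. v j * (a j * r j) - m * (v j * a j) - a' * (v j * r j) + a' * m * v j)"
  proof (rule suminf_nonneg)
    show "summable (\<lambda>j. v j * (a j * r j) - m * (v j * a j) - a' * (v j * r j) + a' * m * v j)"
      using va vr var v(2) by (intro summable_add summable_diff summable_mult) (auto simp: sums_iff)
    fix j
    have "0 \<le> v j * ((a j - a') * (r j - m))" using v(1) a' by simp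
    then show "0 \<le> v j * (a j * r j) - m * (v j * a j) - a' * (v j * r j) + a' * m * v j"
      by (simp add: algebra_simps)
  qed
  also have "\<dots> = (\<Sum>j. v j * (a j * r j)) - m * (\<Sum>j. v j * a j)"
  proof (rule sums_unique[symmetric])
    have "(\<lambda>j. v j * (a j * r j) - m * (v j * a j) - a' * (v j * r j) + a' * m * v j) sums
      ((\<Sum>j. v j * (a j * r j)) - m * (\<Sum>j. v j * a j) - a' * m + a' * m * 1)"
      using v(2) summable_sums[OF va] summable_sums[OF vr] summable_sums[OF var]
      unfolding m_def[symmetric]
      by (intro sums_add sums_diff sums_mult)
    then show "(\<lambda>j. v j * (a j * r j) - m * (v j * a j) - a' * (v j * r j) + a' * m * v j) sums
      ((\<Sum>j. v j * (a j * r j)) - m * (\<Sum>j. v j * a j))" by simp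
  qed
  finally show "(\<Sum>j. v j * a j) * (\<Sum>j. v j * r j) \<le> (\<Sum>j. v j * (a j * r j))"
    unfolding m_def by (simp add: mult.commute)
qed

lemma geometric_weight_sums:
  fixes \<theta> :: real
  assumes "0 < \<theta>" "\<theta> < 1"
  shows "(\<lambda>j. (1 - \<theta>\<^sup>2) * (\<theta>\<^sup>2) ^ j) sums 1"
proof -
  have "\<bar>\<theta>\<^sup>2\<bar> < 1" using assms by (simp add: power_less_one_iff)
  then have "(\<lambda>j. (1 - \<theta>\<^sup>2) * (\<theta>\<^sup>2) ^ j) sums ((1 - \<theta>\<^sup>2) * (1 / (1 - \<theta>\<^sup>2)))"
    by (intro sums_mult geometric_sums) auto
  with \<open>\<bar>\<theta>\<^sup>2\<bar> < 1\<close> show ?thesis by simp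
qed

text \<open>
  The recursion for the excess \<open>e j = P (Y \<le> 1 \<or> Y' \<le> \<theta> ^ j) - 1 / (1 + \<theta>)\<close> of a solution. Dividing it
  by \<open>b j = 2 / (1 + \<theta>) - \<theta> ^ j\<close> and summing over \<open>j\<close>, the quadratic terms become an average
  of \<open>1 / b\<close> whose weights are the geometric ones tilted towards small \<open>j\<close>.
\<close>
lemma g_neg_if_nontrivial_recursion:
  fixes e :: "nat \<Rightarrow> real"
  assumes \<theta>: "0 < \<theta>" "\<theta> < 1"
    and e: "\<And>j. 0 \<le> e j" "decseq e" "e \<longlonglongrightarrow> 0" "0 < e 0"
    and rec: "\<And>j. (e j - e (Suc j)) * (2 / (1 + \<theta>) - \<theta> ^ j + e j + e (Suc j))
      = (1 - \<theta>\<^sup>2) * (1 / (1 + \<theta>) + e 0) * e 0 / 2 * (\<theta>\<^sup>2) ^ j"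
  shows "g \<theta> < 0"
proof -
  define b where "b j = 2 / (1 + \<theta>) - \<theta> ^ j" for j
  define v where "v j = (1 - \<theta>\<^sup>2) * (\<theta>\<^sup>2) ^ j" for j
  define x where "x j = e j + e (Suc j)" for j
  define \<kappa> where "\<kappa> = (1 / (1 + \<theta>) + e 0) * e 0 / 2"
  define A where "A = (\<Sum>j. v j * (1 / b j))"
  have b: "0 < b j" for j unfolding b_def using g_denominator_pos(3)[OF \<theta>] .
  have bmono: "b j \<le> b (Suc j)" for j
    using \<theta> mult_left_le_one_le[of "\<theta> ^ j" \<theta>] by (simp add: b_def)
  have x0: "0 \<le> x j" for j unfolding x_def using e(1) by (simp add: add_nonneg_nonneg)
  have xmono: "x (Suc j) \<le> x j" for j
    unfolding x_def using decseq_SucD[OF e(2)] by (simp add: add_mono)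
  have v: "0 \<le> v j" "v sums 1" for j
    using geometric_weight_sums[OF \<theta>] \<theta> unfolding v_def[abs_def]
    by (auto simp: power2_eq_square mult_le_one intro!: mult_nonneg_nonneg)
  have \<kappa>: "0 < \<kappa>" unfolding \<kappa>_def using e(4) \<theta> by (simp add: add_pos_pos)
  have rec': "(e j - e (Suc j)) * (b j + x j) = \<kappa> * v j" for j
  proof -
    have "b j + x j = 2 / (1 + \<theta>) - \<theta> ^ j + e j + e (Suc j)" by (simp add: b_def x_def)
    then show ?thesis using rec[of j] by (simp add: \<kappa>_def v_def mult_ac)
  qed
  have d: "e j - e (Suc j) = \<kappa> * v j / (b j + x j)" for j
    using rec'[of j] b[of j] x0[of j] by (simp add: field_simps)
  have ab: "decseq (\<lambda>j. 1 / b j)" "0 \<le> 1 / b j" for j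
    using b bmono less_imp_le[OF b] by (auto simp: decseq_Suc_iff intro!: frac_le)
  have r: "decseq (\<lambda>j. x j / (b j + x j))" "0 \<le> x j / (b j + x j)" for j
  proof -
    show "decseq (\<lambda>j. x j / (b j + x j))"
      unfolding decseq_Suc_iff
    proof
      fix j
      have "x (Suc j) * b j \<le> x j * b (Suc j)"
        using x0 xmono[of j] bmono[of j] b[of j] by (intro mult_mono) auto
      then show "x (Suc j) / (b (Suc j) + x (Suc j)) \<le> x j / (b j + x j)"
        using b[of j] b[of "Suc j"] x0[of j] x0[of "Suc j"] by (simp add: field_simps)
    qed
    show "0 \<le> x j / (b j + x j)" using b[of j] x0[of j] by simp
  qed
  note cheb = chebyshev_sum_decseq[OF v ab r]
  \<comment> \<open>First summation: \<open>\<kappa> * A\<close> is the linear answer, and the share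
    \<open>x j / (b j + x j)\<close> is what the quadratic terms take away from it, weighted with
    \<open>v j / b j\<close>.\<close>
  have "(\<lambda>j. e j - e (Suc j)) sums (e 0 - 0)" by (rule telescope_sums'[OF e(3)])
  moreover have "e j - e (Suc j) = \<kappa> * (v j * (1 / b j) - v j * (1 / b j * (x j / (b j + x j))))" for j
  proof -
    have "x j / (b j + x j) = 1 - b j / (b j + x j)" using b[of j] x0[of j] by (simp add: field_simps)
    then show ?thesis unfolding d using b[of j] by (simp add: right_diff_distrib)
  qed
  ultimately have "(\<lambda>j. \<kappa> * (v j * (1 / b j) - v j * (1 / b j * (x j / (b j + x j))))) sums e 0" by simp
  moreover have "(\<lambda>j. \<kappa> * (v j * (1 / b j) - v j * (1 / b j * (x j / (b j + x j)))))
      sums (\<kappa> * (A - (\<Sum>j. v j * (1 / b j * (x j / (b j + x j))))))"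
    unfolding A_def using cheb(1,3) by (intro sums_mult sums_diff summable_sums)
  ultimately have e0: "e 0 = \<kappa> * (A - (\<Sum>j. v j * (1 / b j * (x j / (b j + x j)))))"
    by (rule sums_unique2)
  \<comment> \<open>Second summation: the squares telescope to the plain \<open>v\<close>-average of
    the same share, which is what makes the two sums comparable.\<close>
  have "(\<lambda>n. (e n)\<^sup>2) \<longlonglongrightarrow> 0\<^sup>2" using e(3) by (rule tendsto_power)
  then have "(\<lambda>j. (e j)\<^sup>2 - (e (Suc j))\<^sup>2) sums ((e 0)\<^sup>2 - 0\<^sup>2)" by (rule telescope_sums')
  moreover have "(e j)\<^sup>2 - (e (Suc j))\<^sup>2 = \<kappa> * (v j * (x j / (b j + x j)))" for j
  proof -
    have "(e j)\<^sup>2 - (e (Suc j))\<^sup>2 = (e j - e (Suc j)) * x j"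
      by (simp add: x_def power2_eq_square algebra_simps)
    then show ?thesis unfolding d by simp
  qed
  ultimately have "(\<lambda>j. \<kappa> * (v j * (x j / (b j + x j)))) sums (e 0)\<^sup>2" by simp
  moreover have "(\<lambda>j. \<kappa> * (v j * (x j / (b j + x j)))) sums (\<kappa> * (\<Sum>j. v j * (x j / (b j + x j))))"
    using cheb(2) by (intro sums_mult summable_sums)
  ultimately have e0sq: "(e 0)\<^sup>2 = \<kappa> * (\<Sum>j. v j * (x j / (b j + x j)))" by (rule sums_unique2)
  \<comment> \<open>Since \<open>1 / b\<close> and the share both decrease, the loss is at least
    \<open>A\<close> times its plain average. As \<open>\<kappa> - (e 0)\<^sup>2\<close> equals
    \<open>e 0 * (1 / (1 + \<theta>) - e 0) / 2\<close>, a factor \<open>e 0\<close> cancels, and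
    the remaining \<open>- e 0\<close> makes the conclusion strict; this strictness excludes
    \<open>g \<theta> = 0\<close> as well.\<close>
  have "\<kappa> * (A * (\<Sum>j. v j * (x j / (b j + x j)))) \<le> \<kappa> * (\<Sum>j. v j * (1 / b j * (x j / (b j + x j))))"
    using cheb(4) \<kappa> unfolding A_def by (intro mult_left_mono) auto
  then have "e 0 \<le> A * (\<kappa> - (e 0)\<^sup>2)" unfolding e0sq using e0 by (simp add: algebra_simps)
  also have "\<dots> = e 0 * (A * (1 / (1 + \<theta>) - e 0) / 2)"
    by (simp add: \<kappa>_def power2_eq_square algebra_simps)
  finally have 1: "1 \<le> A * (1 / (1 + \<theta>) - e 0) / 2" using e(4) by (simp add: mult_le_cancel_left1)
  have "v j * (1 / b j) = g_term j \<theta>" for j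
    unfolding v_def b_def g_term_def power_mult[of \<theta> 2 j] by simp
  then have g: "g \<theta> = 2 * (1 + \<theta>) - A" by (simp add: g_eq_g_term A_def)
  have "0 < v 0 * (1 / b 0)" using b[of 0] \<theta> by (simp add: v_def power_less_one_iff)
  then have "0 < A" unfolding A_def using ab v cheb(1) by (intro suminf_pos2[of _ 0]) auto
  then have "A * (1 / (1 + \<theta>) - e 0) < A * (1 / (1 + \<theta>))"
    using e(4) by (intro mult_strict_left_mono) auto
  with 1 have "2 < A / (1 + \<theta>)" by simp
  then have "2 * (1 + \<theta>) < A" using \<theta> by (simp add: field_simps)
  then show ?thesis using g by simp
qed

section \<open>The shooting argument in the starting excess\<close>

text \<open>
  The same recursion started from an arbitrary excess \<open>\<epsilon>\<close> and truncated at 0 when the quadratic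
  equation for the next term has no nonnegative root.
\<close>

definition quadratic_root :: "real \<Rightarrow> real \<Rightarrow> real" where
  "quadratic_root b r = (sqrt (b\<^sup>2 + 4 * max 0 r) - b) / 2"

lemma quadratic_root:
  assumes "0 < b"
  shows "0 \<le> quadratic_root b r" "(quadratic_root b r)\<^sup>2 + b * quadratic_root b r = max 0 r"
proof -
  have "sqrt (b\<^sup>2) \<le> sqrt (b\<^sup>2 + 4 * max 0 r)" by (intro real_sqrt_le_mono) auto
  then show "0 \<le> quadratic_root b r" using assms by (simp add: quadratic_root_def)
  have "0 \<le> b\<^sup>2 + 4 * max 0 r" by simp
  then have "(sqrt (b\<^sup>2 + 4 * max 0 r))\<^sup>2 = b\<^sup>2 + 4 * max 0 r" by simp
  then show "(quadratic_root b r)\<^sup>2 + b * quadratic_root b r = max 0 r"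
    unfolding quadratic_root_def by (simp add: power2_eq_square field_simps)
qed

lemma quadratic_le_imp_le:
  fixes b y z :: real
  assumes "0 < b" "0 \<le> y" "0 \<le> z" "z\<^sup>2 + b * z \<le> y\<^sup>2 + b * y"
  shows "z \<le> y"
proof (rule ccontr)
  assume "\<not> z \<le> y"
  then have "0 < (z - y) * (z + y + b)" using assms by (intro mult_pos_pos) auto
  then show False using assms(4) by (simp add: power2_eq_square algebra_simps)
qed

text \<open>The source constant of the recursion for
  \<open>f 0 = 1 / (1 + \<theta>) + \<epsilon>\<close>. It moves with the start, so a larger start
  also means larger decrements.\<close>

definition shoot_coeff :: "real \<Rightarrow> real \<Rightarrow> real" where
  "shoot_coeff \<theta> \<epsilon> = (1 - \<theta>\<^sup>2) * (1 / (1 + \<theta>) + \<epsilon>) * \<epsilon> / 2"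

primrec shoot :: "real \<Rightarrow> real \<Rightarrow> nat \<Rightarrow> real" where
  "shoot \<theta> \<epsilon> 0 = \<epsilon>"
| "shoot \<theta> \<epsilon> (Suc j) = quadratic_root (2 / (1 + \<theta>) - \<theta> ^ j)
     ((shoot \<theta> \<epsilon> j)\<^sup>2 + (2 / (1 + \<theta>) - \<theta> ^ j) * shoot \<theta> \<epsilon> j - shoot_coeff \<theta> \<epsilon> * (\<theta>\<^sup>2) ^ j)"

text \<open>Nonnegative exactly when the truncation in the step from \<open>j\<close> to
  \<open>Suc j\<close> is idle, so that this step of the recursion holds without change.\<close>

definition shoot_rhs :: "real \<Rightarrow> real \<Rightarrow> nat \<Rightarrow> real" where
  "shoot_rhs \<theta> \<epsilon> j = (shoot \<theta> \<epsilon> j)\<^sup>2 + (2 / (1 + \<theta>) - \<theta> ^ j) * shoot \<theta> \<epsilon> j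
     - shoot_coeff \<theta> \<epsilon> * (\<theta>\<^sup>2) ^ j"

lemma continuous_on_shoot: "continuous_on A (\<lambda>\<epsilon>. shoot \<theta> \<epsilon> j)"
proof (induction j)
  case (Suc j)
  show ?case
    unfolding shoot.simps quadratic_root_def shoot_coeff_def by (intro continuous_intros Suc) simp_all
qed simp

lemma continuous_on_shoot_rhs: "continuous_on A (\<lambda>\<epsilon>. shoot_rhs \<theta> \<epsilon> j)"
  unfolding shoot_rhs_def shoot_coeff_def by (intro continuous_intros continuous_on_shoot) simp

context
  fixes \<theta> :: real
  assumes \<theta>: "0 < \<theta>" "\<theta> < 1"
begin

lemma one_minus_square_pos: "0 < 1 - \<theta>\<^sup>2"
  using \<theta> by (simp add: power_less_one_iff)

lemma shoot_coeff_nonneg: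
  assumes "0 \<le> \<epsilon>"
  shows "0 \<le> shoot_coeff \<theta> \<epsilon>"
proof -
  have "0 \<le> (1 - \<theta>\<^sup>2) * (1 / (1 + \<theta>) + \<epsilon>)"
    using one_minus_square_pos \<theta> assms by (intro mult_nonneg_nonneg) auto
  then show ?thesis unfolding shoot_coeff_def using assms by simp
qed

lemma shoot_coeff_mono:
  assumes "0 \<le> \<epsilon>" "\<epsilon> \<le> \<epsilon>'"
  shows "shoot_coeff \<theta> \<epsilon> \<le> shoot_coeff \<theta> \<epsilon>'"
proof -
  have "0 \<le> 1 - \<theta>\<^sup>2" "0 \<le> 1 / (1 + \<theta>)" using one_minus_square_pos \<theta> by auto
  then show ?thesis unfolding shoot_coeff_def using assms
    by (intro divide_right_mono mult_mono mult_nonneg_nonneg add_nonneg_nonneg) linarith+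
qed

lemma shoot_nonneg: "0 \<le> \<epsilon> \<Longrightarrow> 0 \<le> shoot \<theta> \<epsilon> j"
  using quadratic_root(1)[OF g_denominator_pos(3)[OF \<theta>]] by (cases j) simp_all

lemma shoot_Suc_eq:
  "(shoot \<theta> \<epsilon> (Suc j))\<^sup>2 + (2 / (1 + \<theta>) - \<theta> ^ j) * shoot \<theta> \<epsilon> (Suc j) = max 0 (shoot_rhs \<theta> \<epsilon> j)"
  using quadratic_root(2)[OF g_denominator_pos(3)[OF \<theta>]] by (simp add: shoot_rhs_def)

lemma shoot_Suc_le: "0 \<le> \<epsilon> \<Longrightarrow> shoot \<theta> \<epsilon> (Suc j) \<le> shoot \<theta> \<epsilon> j"
proof (rule quadratic_le_imp_le[OF g_denominator_pos(3)[OF \<theta>, of j]])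
  assume \<epsilon>: "0 \<le> \<epsilon>"
  note nonneg = shoot_nonneg[OF \<epsilon>] shoot_coeff_nonneg[OF \<epsilon>]
  show "0 \<le> shoot \<theta> \<epsilon> j" "0 \<le> shoot \<theta> \<epsilon> (Suc j)" using nonneg by blast+
  have "shoot_rhs \<theta> \<epsilon> j \<le> (shoot \<theta> \<epsilon> j)\<^sup>2 + (2 / (1 + \<theta>) - \<theta> ^ j) * shoot \<theta> \<epsilon> j"
    using nonneg(2) by (simp add: shoot_rhs_def)
  moreover have "0 \<le> (shoot \<theta> \<epsilon> j)\<^sup>2 + (2 / (1 + \<theta>) - \<theta> ^ j) * shoot \<theta> \<epsilon> j"
    using nonneg(1)[of j] g_denominator_pos(3)[OF \<theta>, of j] by (intro add_nonneg_nonneg mult_nonneg_nonneg) simp_all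
  ultimately show "(shoot \<theta> \<epsilon> (Suc j))\<^sup>2 + (2 / (1 + \<theta>) - \<theta> ^ j) * shoot \<theta> \<epsilon> (Suc j)
      \<le> (shoot \<theta> \<epsilon> j)\<^sup>2 + (2 / (1 + \<theta>) - \<theta> ^ j) * shoot \<theta> \<epsilon> j"
    unfolding shoot_Suc_eq by simp
qed

lemma shoot_step:
  assumes "0 \<le> shoot_rhs \<theta> \<epsilon> j"
  shows "(shoot \<theta> \<epsilon> j - shoot \<theta> \<epsilon> (Suc j)) *
      (2 / (1 + \<theta>) - \<theta> ^ j + shoot \<theta> \<epsilon> j + shoot \<theta> \<epsilon> (Suc j)) = shoot_coeff \<theta> \<epsilon> * (\<theta>\<^sup>2) ^ j"
  using shoot_Suc_eq[of \<epsilon> j] assms unfolding shoot_rhs_def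
  by (simp add: power2_eq_square algebra_simps del: shoot.simps)

text \<open>The smallest denominator \<open>2 / (1 + \<theta>) - 1\<close> gives a geometric bound
  on the decrements. The factor \<open>1 - \<theta>\<^sup>2\<close> normalizes the constant so that
  \<open>shoot_bound \<epsilon> * (\<theta>\<^sup>2) ^ j\<close> itself loses exactly this bound in
  each step.\<close>

definition shoot_bound :: "real \<Rightarrow> real" where
  "shoot_bound \<epsilon> = shoot_coeff \<theta> \<epsilon> / ((2 / (1 + \<theta>) - 1) * (1 - \<theta>\<^sup>2))"

lemma shoot_decrement:
  assumes "0 \<le> \<epsilon>"
  shows "shoot \<theta> \<epsilon> j - shoot \<theta> \<epsilon> (Suc j) \<le> shoot_bound \<epsilon> * (1 - \<theta>\<^sup>2) * (\<theta>\<^sup>2) ^ j"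
proof -
  let ?y = "shoot \<theta> \<epsilon> j" and ?z = "shoot \<theta> \<epsilon> (Suc j)" and ?b = "2 / (1 + \<theta>) - \<theta> ^ j"
  have sq: "0 < 1 - \<theta>\<^sup>2" using \<theta> by (simp add: power_less_one_iff)
  have yz: "0 \<le> ?y" "0 \<le> ?z" "?z \<le> ?y"
    using shoot_nonneg[OF assms] shoot_Suc_le[OF assms] by (auto simp del: shoot.simps)
  have "(?y - ?z) * (2 / (1 + \<theta>) - 1) \<le> (?y - ?z) * (?b + ?y + ?z)"
    using yz g_denominator_pos(2)[OF \<theta>, of j] by (intro mult_left_mono) (auto simp del: shoot.simps)
  also have "\<dots> = ?y\<^sup>2 + ?b * ?y - (?z\<^sup>2 + ?b * ?z)" by (simp add: power2_eq_square algebra_simps)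
  also have "\<dots> \<le> shoot_coeff \<theta> \<epsilon> * (\<theta>\<^sup>2) ^ j"
    unfolding shoot_Suc_eq by (simp add: shoot_rhs_def)
  finally have "?y - ?z \<le> shoot_coeff \<theta> \<epsilon> * (\<theta>\<^sup>2) ^ j / (2 / (1 + \<theta>) - 1)"
    using g_denominator_pos(1)[OF \<theta>] by (simp add: pos_le_divide_eq del: shoot.simps)
  also have "\<dots> = shoot_bound \<epsilon> * (1 - \<theta>\<^sup>2) * (\<theta>\<^sup>2) ^ j"
    using sq by (simp add: shoot_bound_def)
  finally show ?thesis .
qed

text \<open>Truncation at \<open>n\<close> forces the value 0 at \<open>Suc n\<close>, and adding up
  decrements backwards from there gives the bound. The constant does not depend on \<open>n\<close>,
  so the bound survives limits of truncated starts.\<close>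

lemma shoot_bound_truncated:
  assumes "0 \<le> \<epsilon>" "shoot_rhs \<theta> \<epsilon> n < 0"
  shows "shoot \<theta> \<epsilon> j \<le> shoot_bound \<epsilon> * (\<theta>\<^sup>2) ^ j"
proof -
  have bound: "0 \<le> shoot_bound \<epsilon>"
    unfolding shoot_bound_def using \<theta> shoot_coeff_nonneg[OF assms(1)] g_denominator_pos(1)[OF \<theta>]
    by (intro divide_nonneg_nonneg mult_nonneg_nonneg) (auto simp: power2_eq_square mult_le_one)
  have "quadratic_root b r = 0" if "0 < b" "r < 0" for b r
    using that by (simp add: quadratic_root_def)
  then have 0: "shoot \<theta> \<epsilon> (Suc n) = 0"
    using assms(2) g_denominator_pos(3)[OF \<theta>] by (simp add: shoot_rhs_def)
  show ?thesis
  proof (cases "j \<le> Suc n")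
    case True
    then show ?thesis
    proof (induction j rule: inc_induct)
      case base
      then show ?case using 0 bound by (simp del: shoot.simps)
    next
      case (step j)
      then show ?case using shoot_decrement[OF assms(1), of j]
        by (simp add: algebra_simps del: shoot.simps)
    qed
  next
    case False
    have "decseq (shoot \<theta> \<epsilon>)" using shoot_Suc_le[OF assms(1)] by (simp add: decseq_Suc_iff)
    then have "shoot \<theta> \<epsilon> j \<le> 0" using False 0 decseqD[of "shoot \<theta> \<epsilon>" "Suc n" j] by simp
    also have "0 \<le> shoot_bound \<epsilon> * (\<theta>\<^sup>2) ^ j" using bound by simp
    finally show ?thesis .
  qed
qed

text \<open>For the largest admissible start \<open>\<epsilon> = \<theta> / (1 + \<theta>)\<close>, the sequence \<open>\<theta> ^ (j + 1) / (1 + \<theta>)\<close> is a subsolution.\<close>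
lemma shoot_rhs_max_nonneg: "0 \<le> shoot_rhs \<theta> (\<theta> / (1 + \<theta>)) j"
proof -
  define c where "c = 1 / (1 + \<theta>)"
  define l where "l j = c * \<theta> ^ Suc j" for j
  define \<epsilon> where "\<epsilon> = \<theta> / (1 + \<theta>)"
  have c: "0 < c" "c * (1 + \<theta>) = 1" "2 / (1 + \<theta>) = 2 * c" using \<theta> by (auto simp: c_def)
  have \<epsilon>0: "0 \<le> \<epsilon>" using \<theta> by (simp add: \<epsilon>_def)
  have l0: "0 \<le> l j" for j using c \<theta> by (simp add: l_def)
  have K: "shoot_coeff \<theta> \<epsilon> = \<theta> * (1 - \<theta>) / 2"
    using \<theta> unfolding shoot_coeff_def \<epsilon>_def by (simp add: field_simps power2_eq_square)
  have sub: "\<theta> * (1 - \<theta>) / 2 * (\<theta>\<^sup>2) ^ j \<le> (l j - l (Suc j)) * (2 * c - \<theta> ^ j + l j + l (Suc j))" for j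
  proof -
    have t: "\<theta> ^ j \<le> 1" "0 < \<theta> ^ j" using \<theta> by (auto simp: power_le_one)
    \<comment> \<open>The start is \<open>f 0 = 1\<close> here. After cancelling common factors the
      worst case is \<open>\<theta> ^ j = 1\<close>, where the claim is
      \<open>(1 + \<theta>)\<^sup>2 \<le> 2 * (1 + \<theta>\<^sup>2)\<close>.\<close>
    have "0 \<le> (1 - \<theta>)\<^sup>2" by simp
    then have "(1 + \<theta>)\<^sup>2 * 1 \<le> 2 * (1 + \<theta>\<^sup>2)" by (simp add: power2_eq_square algebra_simps)
    then have "1 / 2 \<le> c * (2 * c - (1 - \<theta>))"
      using \<theta> by (simp add: c_def field_simps power2_eq_square)
    also have "\<dots> \<le> c * (2 * c - \<theta> ^ j * (1 - \<theta>))"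
    proof -
      have "\<theta> ^ j * (1 - \<theta>) \<le> 1 - \<theta>" using t \<theta> by (intro mult_left_le_one_le) auto
      then show ?thesis using c(1) by (intro mult_left_mono) auto
    qed
    finally have main: "\<theta> ^ j / 2 \<le> c * (2 * c - \<theta> ^ j * (1 - \<theta>))" using t by linarith
    have "l j + l (Suc j) = (c * (1 + \<theta>)) * \<theta> ^ Suc j" by (simp add: l_def algebra_simps)
    then have s: "2 * c - \<theta> ^ j + l j + l (Suc j) = 2 * c - \<theta> ^ j * (1 - \<theta>)"
      unfolding c(2) by (simp add: algebra_simps)
    have dl: "l j - l (Suc j) = c * \<theta> ^ Suc j * (1 - \<theta>)" by (simp add: l_def algebra_simps)
    have "\<theta> * (1 - \<theta>) / 2 * (\<theta>\<^sup>2) ^ j = (\<theta> ^ Suc j * (1 - \<theta>)) * (\<theta> ^ j / 2)"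
      by (simp add: power_mult[symmetric] mult_2 power_add)
    also have "\<dots> \<le> (\<theta> ^ Suc j * (1 - \<theta>)) * (c * (2 * c - \<theta> ^ j * (1 - \<theta>)))"
      using \<theta> by (intro mult_left_mono main) auto
    finally show ?thesis unfolding s dl by (simp add: mult_ac)
  qed
  have step: "(l (Suc j))\<^sup>2 + (2 * c - \<theta> ^ j) * l (Suc j) \<le> shoot_rhs \<theta> \<epsilon> j"
    if "l j \<le> shoot \<theta> \<epsilon> j" for j
  proof -
    have "(l (Suc j))\<^sup>2 + (2 * c - \<theta> ^ j) * l (Suc j)
        \<le> (l j)\<^sup>2 + (2 * c - \<theta> ^ j) * l j - \<theta> * (1 - \<theta>) / 2 * (\<theta>\<^sup>2) ^ j"
      using sub[of j] by (simp add: power2_eq_square algebra_simps)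
    also have "\<dots> \<le> shoot_rhs \<theta> \<epsilon> j"
    proof -
      have "(l j)\<^sup>2 \<le> (shoot \<theta> \<epsilon> j)\<^sup>2" by (rule power_mono[OF that l0])
      moreover have "(2 * c - \<theta> ^ j) * l j \<le> (2 * c - \<theta> ^ j) * shoot \<theta> \<epsilon> j"
        using that g_denominator_pos(3)[OF \<theta>, of j] by (intro mult_left_mono) (auto simp: c(3))
      ultimately show ?thesis unfolding shoot_rhs_def K c(3) by (intro diff_mono add_mono order_refl)
    qed
    finally show ?thesis .
  qed
  have "l j \<le> shoot \<theta> \<epsilon> j" for j
  proof (induction j)
    case 0
    show ?case by (simp add: l_def \<epsilon>_def c_def)
  next
    case (Suc j)
    have b: "0 < 2 * c - \<theta> ^ j" using g_denominator_pos(3)[OF \<theta>, of j] by (simp only: c(3))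
    have "(l (Suc j))\<^sup>2 + (2 * c - \<theta> ^ j) * l (Suc j) \<le> max 0 (shoot_rhs \<theta> \<epsilon> j)"
      using step[OF Suc.IH] by (rule max.coboundedI2)
    then show ?case
      using quadratic_le_imp_le[OF b shoot_nonneg[OF \<epsilon>0] l0, of "Suc j" "Suc j"]
      unfolding shoot_Suc_eq[of \<epsilon> j, unfolded c(3)] by blast
  qed
  from step[OF this[of j]] have "(l (Suc j))\<^sup>2 + (2 * c - \<theta> ^ j) * l (Suc j) \<le> shoot_rhs \<theta> \<epsilon> j" .
  moreover have "0 \<le> (l (Suc j))\<^sup>2 + (2 * c - \<theta> ^ j) * l (Suc j)"
    using l0[of "Suc j"] g_denominator_pos(3)[OF \<theta>, of j]
    by (simp add: c(3))
  ultimately show ?thesis unfolding \<epsilon>_def by linarith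
qed

text \<open>Without truncation the decrements add up to at most \<open>\<epsilon>\<close>. For small
  \<open>\<epsilon>\<close> they are close to those of the linearized recursion, whose total is
  \<open>\<epsilon>\<close> times the series in \<open>g\<close> divided by
  \<open>2 * (1 + \<theta>)\<close>; for negative \<open>g \<theta>\<close> that exceeds
  \<open>\<epsilon>\<close>.\<close>

lemma exists_truncated_shoot:
  assumes "g \<theta> < 0"
  shows "\<exists>\<epsilon> n. 0 < \<epsilon> \<and> \<epsilon> < \<theta> / (1 + \<theta>) \<and> shoot_rhs \<theta> \<epsilon> n < 0"
proof -
  define c where "c = 1 / (1 + \<theta>)"
  have c: "0 < c" "2 / (1 + \<theta>) = 2 * c" using \<theta> by (auto simp: c_def)
  define v where "v j = (1 - \<theta>\<^sup>2) * (\<theta>\<^sup>2) ^ j" for j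
  have v0: "0 \<le> v j" for j
    using geometric_weight_sums[OF \<theta>] \<theta> unfolding v_def
    by (auto simp: power2_eq_square mult_le_one intro!: mult_nonneg_nonneg)
  have b: "0 < 2 * c - \<theta> ^ j" for j using g_denominator_pos(3)[OF \<theta>, of j] c by simp
  have "2 * (1 + \<theta>) < (\<Sum>l. g_term l \<theta>)" using assms by (simp add: g_eq_g_term)
  then have "\<forall>\<^sub>F N in sequentially. 2 * (1 + \<theta>) < (\<Sum>l<N. g_term l \<theta>)"
    using summable_LIMSEQ[OF summable_g_term[OF \<theta>]] order_tendstoD(1) by blast
  then obtain N where N: "2 * (1 + \<theta>) < (\<Sum>l<N. g_term l \<theta>)"
    by (auto simp: eventually_sequentially)
  have gt: "g_term l \<theta> = v l / (2 * c - \<theta> ^ l)" for l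
    unfolding v_def c(2)[symmetric] g_term_def power_mult[of \<theta> 2 l] by simp
  \<comment> \<open>\<open>\<epsilon> * F \<epsilon>\<close> bounds the first \<open>N\<close>
    decrements from below: each denominator is enlarged by replacing both values of
    \<open>shoot\<close> with their upper bound \<open>\<epsilon>\<close>. At 0 only the partial sum
    of the series in \<open>g\<close> remains.\<close>
  define F where "F \<epsilon> = (c + \<epsilon>) / 2 * (\<Sum>j<N. v j / (2 * c - \<theta> ^ j + 2 * \<epsilon>))" for \<epsilon>
  have nz: "2 * c - \<theta> ^ j + 2 * 0 \<noteq> 0" for j using b[of j] by simp
  have "(F \<longlongrightarrow> (c + 0) / 2 * (\<Sum>j<N. v j / (2 * c - \<theta> ^ j + 2 * 0))) (at_right 0)"
    unfolding F_def by (intro tendsto_intros nz) simp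
  moreover have "1 < (c + 0) / 2 * (\<Sum>j<N. v j / (2 * c - \<theta> ^ j + 2 * 0))"
  proof -
    have "1 = c / 2 * (2 * (1 + \<theta>))" using \<theta> by (simp add: c_def)
    also have "\<dots> < c / 2 * (\<Sum>l<N. g_term l \<theta>)" using N c(1) by (intro mult_strict_left_mono) auto
    finally show ?thesis unfolding gt by (simp only: add_0_right mult_zero_right)
  qed
  ultimately have "\<forall>\<^sub>F \<epsilon> in at_right 0. 1 < F \<epsilon>" by (rule order_tendstoD)
  moreover have "\<forall>\<^sub>F \<epsilon> in at_right 0. \<epsilon> \<in> {0<..<\<theta> / (1 + \<theta>)}"
    using \<theta> by (intro eventually_at_right_real) auto
  ultimately have "\<forall>\<^sub>F \<epsilon> in at_right 0. 1 < F \<epsilon> \<and> \<epsilon> \<in> {0<..<\<theta> / (1 + \<theta>)}" by (rule eventually_conj)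
  then obtain \<epsilon> where \<epsilon>: "1 < F \<epsilon>" "0 < \<epsilon>" "\<epsilon> < \<theta> / (1 + \<theta>)"
    using eventually_happens[of _ "at_right (0::real)"] by auto
  have "\<exists>n. shoot_rhs \<theta> \<epsilon> n < 0"
  proof (rule ccontr)
    assume "\<nexists>n. shoot_rhs \<theta> \<epsilon> n < 0"
    then have good: "0 \<le> shoot_rhs \<theta> \<epsilon> n" for n by (auto simp: not_less)
    have dec: "decseq (shoot \<theta> \<epsilon>)" using shoot_Suc_le[of \<epsilon>] \<epsilon>(2) by (simp add: decseq_Suc_iff)
    have le: "shoot \<theta> \<epsilon> j \<le> \<epsilon>" for j using decseqD[OF dec, of 0 j] by simp
    have "\<epsilon> * ((c + \<epsilon>) / 2) * (v j / (2 * c - \<theta> ^ j + 2 * \<epsilon>)) \<le> shoot \<theta> \<epsilon> j - shoot \<theta> \<epsilon> (Suc j)" for j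
    proof -
      let ?x = "2 * c - \<theta> ^ j + shoot \<theta> \<epsilon> j + shoot \<theta> \<epsilon> (Suc j)"
      have x: "0 < ?x" "?x \<le> 2 * c - \<theta> ^ j + 2 * \<epsilon>"
        using b[of j] le[of j] le[of "Suc j"] shoot_nonneg[of \<epsilon> j] shoot_nonneg[of \<epsilon> "Suc j"] \<epsilon>(2)
        by (auto simp del: shoot.simps)
      have "\<epsilon> * ((c + \<epsilon>) / 2) * (v j / (2 * c - \<theta> ^ j + 2 * \<epsilon>)) = \<epsilon> * ((c + \<epsilon>) / 2) * v j / (2 * c - \<theta> ^ j + 2 * \<epsilon>)"
        by simp
      also have "\<dots> \<le> \<epsilon> * ((c + \<epsilon>) / 2) * v j / ?x"
        using x \<epsilon>(2) c(1) v0[of j] by (intro divide_left_mono) (auto intro!: mult_nonneg_nonneg)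
      also have "\<dots> = shoot \<theta> \<epsilon> j - shoot \<theta> \<epsilon> (Suc j)"
      proof -
        have "\<epsilon> * ((c + \<epsilon>) / 2) * v j = shoot_coeff \<theta> \<epsilon> * (\<theta>\<^sup>2) ^ j"
          by (simp add: shoot_coeff_def v_def c_def)
        then show ?thesis using x(1) unfolding shoot_step[OF good, of j, unfolded c(2), symmetric] by simp
      qed
      finally show ?thesis .
    qed
    then have "(\<Sum>j<N. \<epsilon> * ((c + \<epsilon>) / 2) * (v j / (2 * c - \<theta> ^ j + 2 * \<epsilon>)))
        \<le> (\<Sum>j<N. shoot \<theta> \<epsilon> j - shoot \<theta> \<epsilon> (Suc j))" by (rule sum_mono)
    also have "\<dots> = shoot \<theta> \<epsilon> 0 - shoot \<theta> \<epsilon> N" by (rule sum_lessThan_telescope')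
    also have "\<dots> \<le> \<epsilon>" using shoot_nonneg[of \<epsilon> N] \<epsilon>(2) by simp
    finally have "\<epsilon> * F \<epsilon> \<le> \<epsilon>" unfolding F_def by (simp add: sum_distrib_left mult_ac)
    with \<epsilon>(1,2) show False by simp
  qed
  with \<epsilon> show ?thesis by auto
qed

text \<open>Never being truncated is a closed condition on the start, so there is a smallest such
  start above a truncated one. Starts slightly below it are truncated and obey the geometric bound;
  continuity of each single term carries the bound over to the smallest start, and the bound forces
  the limit 0.\<close>

lemma exists_shoot_to_0:
  assumes "g \<theta> < 0"
  obtains \<epsilon> where "0 < \<epsilon>" "\<epsilon> \<le> \<theta> / (1 + \<theta>)" "\<And>j. 0 \<le> shoot_rhs \<theta> \<epsilon> j" "shoot \<theta> \<epsilon> \<longlonglongrightarrow> 0"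
proof -
  obtain \<epsilon>1 n where \<epsilon>1: "0 < \<epsilon>1" "\<epsilon>1 < \<theta> / (1 + \<theta>)" "shoot_rhs \<theta> \<epsilon>1 n < 0"
    using exists_truncated_shoot[OF assms] by blast
  define S where "S = {\<epsilon>1..\<theta> / (1 + \<theta>)} \<inter> (\<Inter>j. {\<epsilon>. 0 \<le> shoot_rhs \<theta> \<epsilon> j})"
  have "compact S"
    unfolding S_def
    by (intro compact_Int_closed compact_Icc closed_INT ballI closed_Collect_le
        continuous_on_shoot_rhs continuous_on_const)
  moreover have "\<theta> / (1 + \<theta>) \<in> S" using \<epsilon>1 shoot_rhs_max_nonneg by (simp add: S_def)
  ultimately obtain \<epsilon> where \<epsilon>: "\<epsilon> \<in> S" "\<And>x. x \<in> S \<Longrightarrow> \<epsilon> \<le> x"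
    using compact_attains_inf[of S] by blast
  have good: "0 \<le> shoot_rhs \<theta> \<epsilon> j" for j using \<epsilon>(1) by (auto simp: S_def)
  \<comment> \<open>This leaves room to approach \<open>\<epsilon>\<close> from the left within the
    interval, where minimality excludes membership in \<open>S\<close>.\<close>
  have "\<epsilon> \<noteq> \<epsilon>1" using good[of n] \<epsilon>1(3) by auto
  with \<epsilon>(1) have lt: "\<epsilon>1 < \<epsilon>" "\<epsilon> \<le> \<theta> / (1 + \<theta>)" by (auto simp: S_def)
  have bound: "shoot \<theta> \<epsilon> j \<le> shoot_bound \<epsilon> * (\<theta>\<^sup>2) ^ j" for j
  proof (rule tendsto_upperbound)
    have "isCont (\<lambda>\<epsilon>. shoot \<theta> \<epsilon> j) \<epsilon>"
      using continuous_on_shoot[of UNIV \<theta> j] by (simp add: continuous_on_eq_continuous_at)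
    then show "((\<lambda>\<epsilon>. shoot \<theta> \<epsilon> j) \<longlongrightarrow> shoot \<theta> \<epsilon> j) (at_left \<epsilon>)"
      by (simp add: isCont_def filterlim_at_split)
    have "\<forall>\<^sub>F x in at_left \<epsilon>. x \<in> {\<epsilon>1<..<\<epsilon>}" using lt by (intro eventually_at_left_real)
    then show "\<forall>\<^sub>F x in at_left \<epsilon>. shoot \<theta> x j \<le> shoot_bound \<epsilon> * (\<theta>\<^sup>2) ^ j"
    proof eventually_elim
      case (elim x)
      then have "x \<notin> S" using \<epsilon>(2)[of x] by auto
      then obtain m where "shoot_rhs \<theta> x m < 0" using elim lt by (auto simp: S_def not_le)
      then have "shoot \<theta> x j \<le> shoot_bound x * (\<theta>\<^sup>2) ^ j"
        using elim \<epsilon>1(1) by (intro shoot_bound_truncated) auto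
      also have "\<dots> \<le> shoot_bound \<epsilon> * (\<theta>\<^sup>2) ^ j"
        unfolding shoot_bound_def
        using elim \<epsilon>1(1) \<theta> g_denominator_pos(1)[OF \<theta>]
        by (intro mult_right_mono divide_right_mono shoot_coeff_mono)
          (auto simp: power2_eq_square mult_le_one intro!: mult_nonneg_nonneg)
      finally show ?case .
    qed
  qed simp
  have "(\<lambda>j. shoot_bound \<epsilon> * (\<theta>\<^sup>2) ^ j) \<longlonglongrightarrow> shoot_bound \<epsilon> * 0"
    using \<theta> by (intro tendsto_mult tendsto_const LIMSEQ_power_zero) (simp add: power_less_one_iff)
  then have "shoot \<theta> \<epsilon> \<longlonglongrightarrow> 0"
    using bound shoot_nonneg[of \<epsilon>] lt \<epsilon>1(1) tendsto_sandwich[of "\<lambda>_. 0" "shoot \<theta> \<epsilon>" sequentially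
      "\<lambda>j. shoot_bound \<epsilon> * (\<theta>\<^sup>2) ^ j" 0] by simp
  moreover have "0 < \<epsilon>" using lt \<epsilon>1(1) by simp
  ultimately show ?thesis using that good lt by blast
qed

end

lemma exists_nontrivial_sequence:
  assumes \<theta>: "0 < \<theta>" "\<theta> < 1" and "g \<theta> < 0"
  obtains f :: "nat \<Rightarrow> real" where "1 / (1 + \<theta>) < f 0" "f 0 \<le> 1" "decseq f" "f \<longlonglongrightarrow> 1 / (1 + \<theta>)"
    "\<And>j. (f j - f (Suc j)) * (f j + f (Suc j) - \<theta> ^ j)
      = (1 - \<theta>\<^sup>2) * f 0 * (f 0 - 1 / (1 + \<theta>)) / 2 * (\<theta>\<^sup>2) ^ j"
proof -
  obtain \<epsilon> where \<epsilon>: "0 < \<epsilon>" "\<epsilon> \<le> \<theta> / (1 + \<theta>)" "\<And>j. 0 \<le> shoot_rhs \<theta> \<epsilon> j" "shoot \<theta> \<epsilon> \<longlonglongrightarrow> 0"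
    using exists_shoot_to_0[OF assms] by blast
  define f where "f j = 1 / (1 + \<theta>) + shoot \<theta> \<epsilon> j" for j
  have "1 / (1 + \<theta>) + \<theta> / (1 + \<theta>) = 1" using \<theta> by (simp add: add_divide_distrib[symmetric])
  then have "f 0 \<le> 1" using \<epsilon>(2) by (simp add: f_def)
  moreover have "1 / (1 + \<theta>) < f 0" using \<epsilon>(1) by (simp add: f_def)
  moreover have "decseq f"
    using shoot_Suc_le[OF \<theta>, of \<epsilon>] \<epsilon>(1) by (simp add: decseq_Suc_iff f_def del: shoot.simps)
  moreover have "f \<longlonglongrightarrow> 1 / (1 + \<theta>) + 0"
    unfolding f_def using \<epsilon>(4) by (intro tendsto_add tendsto_const)
  moreover have "(f j - f (Suc j)) * (f j + f (Suc j) - \<theta> ^ j)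
      = (1 - \<theta>\<^sup>2) * f 0 * (f 0 - 1 / (1 + \<theta>)) / 2 * (\<theta>\<^sup>2) ^ j" for j
  proof -
    have "f j - f (Suc j) = shoot \<theta> \<epsilon> j - shoot \<theta> \<epsilon> (Suc j)" by (simp add: f_def)
    moreover have "f j + f (Suc j) - \<theta> ^ j
        = 2 / (1 + \<theta>) - \<theta> ^ j + shoot \<theta> \<epsilon> j + shoot \<theta> \<epsilon> (Suc j)"
      by (simp add: f_def del: shoot.simps)
    ultimately show ?thesis
      using shoot_step[OF \<theta> \<epsilon>(3), of j]
      by (simp only:) (simp add: f_def shoot_coeff_def)
  qed
  ultimately show ?thesis using that by simp
qed

text \<open>Nonnegativity of the masses that the sequence assigns to pairs of atoms.\<close>
lemma sequence_second_differences:
  fixes f :: "nat \<Rightarrow> real"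
  assumes \<theta>: "0 < \<theta>" "\<theta> < 1"
    and f: "1 / (1 + \<theta>) < f 0" "decseq f" "f \<longlonglongrightarrow> 1 / (1 + \<theta>)"
    and rec: "\<And>j. (f j - f (Suc j)) * (f j + f (Suc j) - \<theta> ^ j)
      = (1 - \<theta>\<^sup>2) * f 0 * (f 0 - 1 / (1 + \<theta>)) / 2 * (\<theta>\<^sup>2) ^ j"
  shows "(1 + \<theta>) * f 0 \<le> 2 * f 1" "f (Suc j) - f (Suc (Suc j)) \<le> \<theta> * (f j - f (Suc j))"
proof -
  define c where "c = 1 / (1 + \<theta>)"
  define K where "K = (1 - \<theta>\<^sup>2) * f 0 * (f 0 - c) / 2"
  have c: "1 / 2 < c" "(1 - \<theta>\<^sup>2) * c = 1 - \<theta>"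
    using \<theta> by (auto simp: c_def field_simps power2_eq_square)
  have fc: "c \<le> f j" for j using decseq_ge[OF f(2,3)] by (simp add: c_def)
  note rec = rec[folded c_def, folded K_def]
  \<comment> \<open>The product \<open>(f j - x) * (f j + x - \<theta> ^ j)\<close> falls as the
    trial value \<open>x\<close> rises above \<open>f (Suc j)\<close>, because
    \<open>f (Suc j) \<ge> c > 1/2\<close> keeps the relevant sum above \<open>\<theta> ^ j\<close>.
    So a lower bound for \<open>f (Suc j)\<close> is tested by inserting it into the
    recursion.\<close>
  have test: "x \<le> f (Suc j)"
    if "K * (\<theta>\<^sup>2) ^ j \<le> (f j - x) * (f j + x - \<theta> ^ j)" for x j
  proof (rule ccontr)
    assume "\<not> x \<le> f (Suc j)"
    moreover have "\<theta> ^ j \<le> 1" using \<theta> by (simp add: power_le_one)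
    ultimately have "0 < (x - f (Suc j)) * (x + f (Suc j) - \<theta> ^ j)"
      using c(1) fc[of "Suc j"] by (intro mult_pos_pos) auto
    then have "(f j - x) * (f j + x - \<theta> ^ j) < (f j - f (Suc j)) * (f j + f (Suc j) - \<theta> ^ j)"
      by (simp add: algebra_simps)
    with that rec[of j] show False by simp
  qed
  have f0: "0 < f 0" using c fc[of 0] by linarith
  have "(1 + \<theta>) * f 0 / 2 \<le> f (Suc 0)"
  proof (rule test)
    have "K = f 0 * (1 - \<theta>) / 2 * ((1 + \<theta>) * f 0 - 1)"
      unfolding K_def using \<theta> by (simp add: c_def field_simps power2_eq_square)
    also have "\<dots> \<le> f 0 * (1 - \<theta>) / 2 * ((3 + \<theta>) * f 0 / 2 - 1)"
    proof (rule mult_left_mono)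
      have "(1 + \<theta>) * f 0 \<le> (3 + \<theta>) / 2 * f 0" using \<theta> f0 by (intro mult_right_mono) auto
      then show "(1 + \<theta>) * f 0 - 1 \<le> (3 + \<theta>) * f 0 / 2 - 1" by simp
    qed (use \<theta> f0 in auto)
    also have "\<dots> = (f 0 - (1 + \<theta>) * f 0 / 2) * (f 0 + (1 + \<theta>) * f 0 / 2 - 1)"
      by (simp add: field_simps)
    finally show "K * (\<theta>\<^sup>2) ^ 0 \<le> (f 0 - (1 + \<theta>) * f 0 / 2) * (f 0 + (1 + \<theta>) * f 0 / 2 - \<theta> ^ 0)"
      by simp
  qed
  then show p0: "(1 + \<theta>) * f 0 \<le> 2 * f 1" by simp
  \<comment> \<open>The two inequalities feed each other: \<open>P\<close> at \<open>j\<close> gives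
    the second-difference bound at \<open>j\<close>, and that bound gives \<open>P\<close> at
    \<open>Suc j\<close>. The induction starts from the bound on \<open>f 1\<close>.\<close>
  have Q: "f (Suc j) - f (Suc (Suc j)) \<le> \<theta> * (f j - f (Suc j))" if P: "\<theta> * f j \<le> f (Suc j)" for j
  proof -
    have "f (Suc j) - \<theta> * (f j - f (Suc j)) \<le> f (Suc (Suc j))"
    proof (rule test)
      have d: "0 \<le> f j - f (Suc j)" using decseq_SucD[OF f(2), of j] by simp
      have "K * (\<theta>\<^sup>2) ^ Suc j = \<theta>\<^sup>2 * ((f j - f (Suc j)) * (f j + f (Suc j) - \<theta> ^ j))"
        unfolding rec by simp
      also have "\<dots> = \<theta> * (f j - f (Suc j)) * (\<theta> * (f j + f (Suc j)) - \<theta> ^ Suc j)"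
        by (simp add: power2_eq_square algebra_simps)
      also have "\<dots> \<le> \<theta> * (f j - f (Suc j)) * (2 * f (Suc j) - \<theta> * (f j - f (Suc j)) - \<theta> ^ Suc j)"
        using P d \<theta> by (intro mult_left_mono) (auto simp: algebra_simps)
      finally show "K * (\<theta>\<^sup>2) ^ Suc j \<le> (f (Suc j) - (f (Suc j) - \<theta> * (f j - f (Suc j)))) *
          (f (Suc j) + (f (Suc j) - \<theta> * (f j - f (Suc j))) - \<theta> ^ Suc j)"
        by (simp add: algebra_simps)
    qed
    then show ?thesis by simp
  qed
  have "\<theta> * f j \<le> f (Suc j)" for j
  proof (induction j)
    case 0
    have "\<theta> * f 0 * 2 \<le> (1 + \<theta>) * f 0" using \<theta> f0 by (simp add: algebra_simps)
    then show ?case using p0 by simp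
  next
    case (Suc j)
    then show ?case using Q[OF Suc] by (simp add: algebra_simps)
  qed
  then show "f (Suc j) - f (Suc (Suc j)) \<le> \<theta> * (f j - f (Suc j))" using Q by blast
qed

section \<open>The bivariate RDE in terms of joint distribution functions\<close>

lemma I_set_cases:
  assumes "y \<in> I_set"
  obtains r where "y = ereal r" "0 \<le> r" "r \<le> 1" | "y = \<infinity>"
  using assms by (cases y) (auto simp: I_set_def)

lemma sets_I_borel_eq_sigma_sets:
  "sets I_borel = sigma_sets I_set ((\<inter>) I_set ` range (\<lambda>a::ereal. {a<..}))"
proof -
  have "sets (borel :: ereal measure) = sigma_sets UNIV (range (\<lambda>a. {a<..}))"
    by (subst borel_Ioi) simp
  then have "sets I_borel = (\<inter>) I_set ` sigma_sets UNIV (range (\<lambda>a. {a<..}))"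
    by (simp add: I_borel_def sets_restrict_space)
  also have "\<dots> = sigma_sets I_set ((\<inter>) I_set ` range (\<lambda>a. {a<..}))"
  proof (rule sigma_sets_Int)
    have "I_set \<in> sets borel" unfolding I_set_def by (intro sets.Un) auto
    then show "I_set \<in> sigma_sets UNIV (range (\<lambda>a. {a<..}))"
      by (subst (asm) borel_Ioi) simp
  qed simp
  finally show ?thesis .
qed

locale I2_prob = prob_space \<rho> for \<rho> :: "(ereal \<times> ereal) measure" +
  assumes sets_eq [measurable_cong]: "sets \<rho> = sets I2_borel"
begin

lemma space_eq: "space \<rho> = I_set \<times> I_set"
  using sets_eq_imp_space_eq[OF sets_eq] by simp

end

lemma measurable_I_borel_borel: "(\<lambda>x. x) \<in> borel_measurable I_borel"
  unfolding I_borel_def by (rule measurable_restrict_space1) simp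

lemma measurable_I_borel_D: "f \<in> measurable M I_borel \<Longrightarrow> f \<in> borel_measurable M"
  using measurable_comp[OF _ measurable_I_borel_borel, of f M] by (simp add: comp_def)

lemma measurable_I2_fst [measurable]: "fst \<in> borel_measurable I2_borel"
  unfolding I2_borel_def by (intro measurable_I_borel_D measurable_fst)

lemma measurable_I2_snd [measurable]: "snd \<in> borel_measurable I2_borel"
  unfolding I2_borel_def by (intro measurable_I_borel_D measurable_snd)

text \<open>The union and not the intersection: its complement is the joint survival event, which
  turns into a product under a minimum of independent pairs, and a negative argument leaves a
  marginal.\<close>

definition joint_cdf :: "(ereal \<times> ereal) measure \<Rightarrow> real \<Rightarrow> real \<Rightarrow> real" where
  "joint_cdf \<rho> s t = measure \<rho> {p \<in> space \<rho>. fst p \<le> ereal s \<or> snd p \<le> ereal t}"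

text \<open>The level that \<open>\<tau>\<close> has to reach for both coordinates of
  \<open>chi (\<tau>, 1)\<close> to exceed \<open>s\<close> and \<open>t\<close>. Infinite
  coordinates fail the comparison with a real threshold, so they count as 0.\<close>

definition truncated_max :: "real \<Rightarrow> real \<Rightarrow> ereal \<times> ereal \<Rightarrow> real" where
  "truncated_max s t p = max (if fst p \<le> ereal s then real_of_ereal (fst p) else 0)
     (if snd p \<le> ereal t then real_of_ereal (snd p) else 0)"

lemma measurable_truncated_max [measurable]: "truncated_max s t \<in> borel_measurable I2_borel"
  unfolding truncated_max_def by measurable

lemma truncated_max_bounds:
  assumes "p \<in> I_set \<times> I_set"
  shows "0 \<le> truncated_max s t p" "truncated_max s t p \<le> 1"
  using assms by (auto simp: truncated_max_def le_max_iff_disj elim!: I_set_cases)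

context I2_prob
begin

lemma borel_sets [measurable]:
  "fst \<in> borel_measurable \<rho>" "snd \<in> borel_measurable \<rho>" "truncated_max s t \<in> borel_measurable \<rho>"
  by measurable

lemma prob_greater_eq: "prob {p \<in> space \<rho>. ereal s < fst p \<and> ereal t < snd p} = 1 - joint_cdf \<rho> s t"
proof -
  have "{p \<in> space \<rho>. ereal s < fst p \<and> ereal t < snd p}
      = space \<rho> - {p \<in> space \<rho>. fst p \<le> ereal s \<or> snd p \<le> ereal t}" by auto
  then show ?thesis unfolding joint_cdf_def by (simp add: prob_compl)
qed

lemma integrable_truncated_max: "integrable \<rho> (truncated_max s t)"
  using truncated_max_bounds
  by (intro integrable_const_bound[of _ 1] AE_I2) (auto simp: space_eq)

end

lemma I2_prob_eqI:
  assumes "I2_prob \<rho>" "I2_prob \<rho>'" and eq: "\<And>s t. joint_cdf \<rho> s t = joint_cdf \<rho>' s t"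
  shows "\<rho> = \<rho>'"
proof -
  interpret \<rho>: I2_prob \<rho> by fact
  interpret \<rho>': I2_prob \<rho>' by fact
  define G where "G = (\<inter>) I_set ` range (\<lambda>a::ereal. {a<..})"
  define E where "E = {a \<times> b |a b. a \<in> G \<and> b \<in> G}"
  have I: "I_set \<in> G" unfolding G_def by (rule image_eqI[of _ _ "{-\<infinity><..}"]) (auto simp: I_set_def)
  have sG: "sets I_borel = sigma_sets I_set G" using sets_I_borel_eq_sigma_sets by (simp add: G_def)
  have "sets I2_borel = sets (sigma (space I_borel \<times> space I_borel) E)"
    unfolding I2_borel_def E_def using I
    by (intro sets_pair_eq[of _ _ "{I_set}" _ _ "{I_set}"]) (auto simp: sG G_def)
  also have "\<dots> = sigma_sets (I_set \<times> I_set) E"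
    by (subst sets_measure_of) (auto simp: E_def G_def)
  finally have sE: "sets I2_borel = sigma_sets (I_set \<times> I_set) E" .
  have Gint: "a \<inter> b \<in> G" if ab: "a \<in> G" "b \<in> G" for a b
  proof -
    obtain x y where "a = I_set \<inter> {x<..}" "b = I_set \<inter> {y<..}" using ab by (auto simp: G_def)
    then have "a \<inter> b = I_set \<inter> {max x y<..}" by auto
    then show ?thesis by (auto simp: G_def)
  qed
  show ?thesis
  proof (rule measure_eqI_generator_eq[of E "I_set \<times> I_set" _ _ "\<lambda>_. I_set \<times> I_set"])
    show "Int_stable E"
      unfolding E_def by (rule Int_stableI) (use Gint in \<open>auto simp: Times_Int_Times\<close>, blast)
    show "E \<subseteq> Pow (I_set \<times> I_set)" by (auto simp: E_def G_def)
    show "sets \<rho> = sigma_sets (I_set \<times> I_set) E" "sets \<rho>' = sigma_sets (I_set \<times> I_set) E"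
      using \<rho>.sets_eq \<rho>'.sets_eq sE by auto
    show "range (\<lambda>_. I_set \<times> I_set) \<subseteq> E" using I by (auto simp: E_def)
    show "emeasure \<rho> (I_set \<times> I_set) \<noteq> \<infinity>" by simp
    fix X assume "X \<in> E"
    then obtain a b :: ereal where X: "X = (I_set \<inter> {a<..}) \<times> (I_set \<inter> {b<..})"
      by (auto simp: E_def G_def)
    show "emeasure \<rho> X = emeasure \<rho>' X"
    proof (cases "a = \<infinity> \<or> b = \<infinity>")
      case True
      moreover have "{\<infinity><..} = ({} :: ereal set)" by auto
      ultimately have "X = {}" unfolding X by auto
      then show ?thesis by simp
    next
      case False
      \<comment> \<open>\<open>joint_cdf\<close> takes real thresholds only. The ray from minus
        infinity is replaced by the one from -1, which cuts nothing off
        \<open>I_set\<close>.\<close>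
      have "\<exists>s::real. I_set \<inter> {a<..} = I_set \<inter> {ereal s<..}" if "a \<noteq> \<infinity>" for a :: ereal
      proof (cases a)
        case MInf
        then have "I_set \<inter> {a<..} = I_set \<inter> {ereal (-1)<..}"
          using less_le_trans[of "ereal (-1)" 0] by (auto simp: I_set_def)
        then show ?thesis by blast
      qed (use that in auto)
      then obtain s t where "X = (I_set \<inter> {ereal s<..}) \<times> (I_set \<inter> {ereal t<..})"
        using X False by metis
      then have "X = {p \<in> space \<rho>. ereal s < fst p \<and> ereal t < snd p}"
        "X = {p \<in> space \<rho>'. ereal s < fst p \<and> ereal t < snd p}"
        by (auto simp: \<rho>.space_eq \<rho>'.space_eq)
      then show ?thesis
        using \<rho>.prob_greater_eq[of s t] \<rho>'.prob_greater_eq[of s t] eq[of s t]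
        by (simp add: \<rho>.emeasure_eq_measure \<rho>'.emeasure_eq_measure)
    qed
  qed auto
qed

section \<open>The right-hand side of the RDE in terms of distribution functions\<close>

lemma prob_space_omega_law: "prob_space omega_law"
proof -
  interpret U: prob_space "uniform_measure lborel {0..1::real}"
    by (rule prob_space_uniform_measure) auto
  interpret C: prob_space "uniform_count_measure {1, 2::nat}"
    by (rule prob_space_uniform_count_measure) auto
  interpret P: pair_prob_space "uniform_measure lborel {0..1::real}" "uniform_count_measure {1, 2::nat}" ..
  show ?thesis unfolding omega_law_def by (rule P.P.prob_space_axioms)
qed

lemma sets_omega_law [measurable_cong]: "sets omega_law = sets (borel \<Otimes>\<^sub>M count_space {1, 2})"
  unfolding omega_law_def by (intro sets_pair_measure_cong) (auto simp: sets_uniform_count_measure)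

lemma emeasure_omega_law:
  assumes "A \<in> sets omega_law"
  shows "emeasure omega_law A = ennreal (1/2) * emeasure lborel ({0..1} \<inter> {\<tau>. (\<tau>, 1) \<in> A})
    + ennreal (1/2) * emeasure lborel ({0..1} \<inter> {\<tau>. (\<tau>, 2) \<in> A})"
proof -
  interpret U: prob_space "uniform_measure lborel {0..1::real}"
    by (rule prob_space_uniform_measure) auto
  interpret C: prob_space "uniform_count_measure {1, 2::nat}"
    by (rule prob_space_uniform_count_measure) auto
  interpret pair_prob_space "uniform_measure lborel {0..1::real}" "uniform_count_measure {1, 2::nat}" ..
  have sec: "{\<tau>. (\<tau>, \<kappa>) \<in> A} \<in> sets borel" for \<kappa>
    using sets_Pair2[OF assms[unfolded omega_law_def], of \<kappa>] by (simp add: vimage_def)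
  have half: "ennreal (1/2) = inverse 2"
    by (metis divide_ennreal_def ennreal_divide_numeral ennreal_1 ennreal_numeral mult_1 zero_le_one)
  have "emeasure omega_law A = (\<integral>\<^sup>+\<kappa>. emeasure (uniform_measure lborel {0..1})
      ((\<lambda>\<tau>. (\<tau>, \<kappa>)) -` A) \<partial>uniform_count_measure {1, 2})"
    unfolding omega_law_def by (rule emeasure_pair_measure_alt2) (use assms in \<open>simp only: omega_law_def\<close>)
  also have "\<dots> = (\<integral>\<^sup>+\<kappa>. emeasure lborel ({0..1} \<inter> {\<tau>. (\<tau>, \<kappa>) \<in> A}) \<partial>uniform_count_measure {1, 2})"
    using sec by (intro nn_integral_cong) (simp add: vimage_def divide_ennreal_def)
  also have "\<dots> = ennreal (1/2) * emeasure lborel ({0..1} \<inter> {\<tau>. (\<tau>, 1) \<in> A})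
    + ennreal (1/2) * emeasure lborel ({0..1} \<inter> {\<tau>. (\<tau>, 2) \<in> A})"
    unfolding uniform_count_measure_def by (subst nn_integral_point_measure_finite) auto
  finally show ?thesis .
qed

text \<open>A value above \<open>s\<close> stays above \<open>s\<close>, whether it is kept or sent
  to infinity; a value up to \<open>s\<close> gets above \<open>s\<close> only by being sent to
  infinity, that is for \<open>y \<le> \<tau>\<close>. The threshold 0 encodes the first case, as
  \<open>\<tau>\<close> is nonnegative.\<close>

lemma less_chi_1_iff:
  assumes "y \<in> I_set" "0 \<le> \<tau>"
  shows "ereal s < chi (\<tau>, 1) y z \<longleftrightarrow> (if y \<le> ereal s then real_of_ereal y else 0) \<le> \<tau>"
  using assms by (auto simp: chi_def elim!: I_set_cases)

lemma measurable_chi: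
  assumes f: "f \<in> measurable M omega_law" and a: "a \<in> borel_measurable M" and b: "b \<in> borel_measurable M"
    and ab: "\<And>x. x \<in> space M \<Longrightarrow> a x \<in> I_set" "\<And>x. x \<in> space M \<Longrightarrow> b x \<in> I_set"
  shows "(\<lambda>x. chi (f x) (a x) (b x)) \<in> measurable M I_borel"
proof -
  note [measurable] = a b
  have f': "f \<in> measurable M (borel \<Otimes>\<^sub>M count_space {1, 2})"
    using f by (simp cong: measurable_cong_sets add: sets_omega_law)
  have [measurable]: "(\<lambda>x. fst (f x)) \<in> borel_measurable M"
    "(\<lambda>x. snd (f x)) \<in> measurable M (count_space {1, 2})"
    by (fact measurable_compose[OF f' measurable_fst], fact measurable_compose[OF f' measurable_snd])
  have "(\<lambda>x. snd (f x) = 1) \<in> measurable M (count_space UNIV)"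
    by (rule measurable_compose[OF measurable_compose[OF f' measurable_snd]]) simp
  then have [measurable]: "Measurable.pred M (\<lambda>x. snd (f x) = 1)" by simp
  have "(\<lambda>x. if snd (f x) = 1 then (if ereal (fst (f x)) < a x then a x else \<infinity>) else min (a x) (b x))
      \<in> borel_measurable M"
    by measurable
  then have "(\<lambda>x. chi (f x) (a x) (b x)) \<in> borel_measurable M"
    by (simp add: chi_def case_prod_beta)
  moreover have "chi (f x) (a x) (b x) \<in> I_set" if "x \<in> space M" for x
    using ab[OF that] by (auto simp: chi_def case_prod_beta min_def I_set_def)
  ultimately show ?thesis
    unfolding I_borel_def by (intro measurable_restrict_space2) auto
qed

context I2_prob
begin

definition T :: "(ereal \<times> ereal) measure" where
  "T = distr (omega_law \<Otimes>\<^sub>M (\<rho> \<Otimes>\<^sub>M \<rho>)) I2_borel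
     (\<lambda>(\<omega>, ((y1, y1'), (y2, y2'))). (chi \<omega> y1 y2, chi \<omega> y1' y2'))"

lemma measurable_T:
  "(\<lambda>(\<omega>, ((y1, y1'), (y2, y2'))). (chi \<omega> y1 y2, chi \<omega> y1' y2'))
    \<in> measurable (omega_law \<Otimes>\<^sub>M (\<rho> \<Otimes>\<^sub>M \<rho>)) I2_borel"
proof -
  have "(\<lambda>w. (chi (fst w) (fst (fst (snd w))) (fst (snd (snd w))),
      chi (fst w) (snd (fst (snd w))) (snd (snd (snd w)))))
    \<in> measurable (omega_law \<Otimes>\<^sub>M (\<rho> \<Otimes>\<^sub>M \<rho>)) I2_borel"
    unfolding I2_borel_def
    by (intro measurable_Pair measurable_chi)
      (auto simp: space_pair_measure space_eq intro!: measurable_compose[OF _ borel_sets(1)]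
        measurable_compose[OF _ borel_sets(2)])
  also have "(\<lambda>w. (chi (fst w) (fst (fst (snd w))) (fst (snd (snd w))),
      chi (fst w) (snd (fst (snd w))) (snd (snd (snd w)))))
    = (\<lambda>(\<omega>, ((y1, y1'), (y2, y2'))). (chi \<omega> y1 y2, chi \<omega> y1' y2'))"
    by (auto simp: fun_eq_iff)
  finally show ?thesis .
qed

lemma I2_prob_T: "I2_prob T"
proof -
  interpret R: pair_prob_space \<rho> \<rho> ..
  interpret \<Omega>: prob_space omega_law by (rule prob_space_omega_law)
  interpret W: pair_prob_space omega_law "\<rho> \<Otimes>\<^sub>M \<rho>" ..
  show ?thesis
    unfolding T_def I2_prob_def I2_prob_axioms_def
    using W.P.prob_space_distr[OF measurable_T] by simp
qed

text \<open>For \<open>\<kappa> = 1\<close> the joint survival event is that the uniform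
  \<open>\<tau>\<close> reaches the truncated maximum of the first pair; for
  \<open>\<kappa> = 2\<close> it is that two independent pairs both survive.\<close>

lemma joint_cdf_T:
  "1 - joint_cdf T s t = (1 - (\<integral>p. truncated_max s t p \<partial>\<rho>)) / 2 + (1 - joint_cdf \<rho> s t)\<^sup>2 / 2"
proof -
  interpret R: pair_prob_space \<rho> \<rho> ..
  interpret \<Omega>: prob_space omega_law by (rule prob_space_omega_law)
  interpret W: pair_prob_space omega_law "\<rho> \<Otimes>\<^sub>M \<rho>" ..
  interpret T: I2_prob T by (rule I2_prob_T)
  let ?W = "omega_law \<Otimes>\<^sub>M (\<rho> \<Otimes>\<^sub>M \<rho>)"
  define B where "B = {p \<in> space \<rho>. ereal s < fst p \<and> ereal t < snd p}"
  have B [measurable]: "B \<in> sets \<rho>" unfolding B_def by measurable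
  have B': "B \<in> sets I2_borel" using B sets_eq by simp
  have "{p \<in> space T. ereal s < fst p \<and> ereal t < snd p} = B"
    by (simp add: B_def T.space_eq space_eq)
  then have "ennreal (1 - joint_cdf T s t) = emeasure T B"
    using T.prob_greater_eq[of s t] by (simp add: T.emeasure_eq_measure)
  define A where "A = (\<lambda>(\<omega>, ((y1, y1'), (y2, y2'))). (chi \<omega> y1 y2, chi \<omega> y1' y2')) -` B \<inter> space ?W"
  have A: "A \<in> sets ?W" unfolding A_def by (rule measurable_sets[OF measurable_T B'])
  have "emeasure T B = emeasure ?W A"
    unfolding T_def A_def by (rule emeasure_distr[OF measurable_T B'])
  also have "\<dots> = (\<integral>\<^sup>+q. emeasure omega_law ((\<lambda>\<omega>. (\<omega>, q)) -` A) \<partial>(\<rho> \<Otimes>\<^sub>M \<rho>))"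
    by (rule W.emeasure_pair_measure_alt2[OF A])
  also have "\<dots> = (\<integral>\<^sup>+q. ennreal (1/2) * ennreal (1 - truncated_max s t (fst q))
      + ennreal (1/2) * indicator (B \<times> B) q \<partial>(\<rho> \<Otimes>\<^sub>M \<rho>))"
  proof (rule nn_integral_cong)
    fix q assume "q \<in> space (\<rho> \<Otimes>\<^sub>M \<rho>)"
    then obtain y1 y1' y2 y2' where q: "q = ((y1, y1'), (y2, y2'))"
      "y1 \<in> I_set" "y1' \<in> I_set" "y2 \<in> I_set" "y2' \<in> I_set"
      by (auto simp: space_pair_measure space_eq)
    have sA: "(\<lambda>\<omega>. (\<omega>, q)) -` A \<in> sets omega_law" by (rule sets_Pair2[OF A])
    have sp: "((\<tau>, \<kappa>), (y1, y1'), (y2, y2')) \<in> space ?W \<longleftrightarrow> \<kappa> \<in> {1, 2}" for \<tau> \<kappa>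
      using q sets_eq_imp_space_eq[OF sets_omega_law] by (auto simp: space_pair_measure space_eq)
    have chiI: "chi (\<tau>, \<kappa>) y z \<in> I_set" if "y \<in> I_set" "z \<in> I_set" for \<tau> \<kappa> y z
      using that by (auto simp: chi_def min_def I_set_def)
    define m where "m = truncated_max s t (y1, y1')"
    have m: "0 \<le> m" "m \<le> 1" using truncated_max_bounds[of "(y1, y1')" s t] q by (auto simp: m_def)
    have "{0..1} \<inter> {\<tau>. (\<tau>, 1) \<in> (\<lambda>\<omega>. (\<omega>, q)) -` A} = {m..1}"
    proof -
      have "(\<tau>, 1) \<in> (\<lambda>\<omega>. (\<omega>, q)) -` A \<longleftrightarrow> m \<le> \<tau>" if "\<tau> \<in> {0..1}" for \<tau>
        using that q chiI less_chi_1_iff[of y1 \<tau> s y2] less_chi_1_iff[of y1' \<tau> t y2']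
        by (simp add: A_def sp B_def m_def truncated_max_def space_eq)
      then show ?thesis using m by auto
    qed
    moreover have "{0..1} \<inter> {\<tau>. (\<tau>, 2) \<in> (\<lambda>\<omega>. (\<omega>, q)) -` A} = (if q \<in> B \<times> B then {0..1} else {})"
    proof -
      have "(\<tau>, 2) \<in> (\<lambda>\<omega>. (\<omega>, q)) -` A \<longleftrightarrow> q \<in> B \<times> B" for \<tau>
        using q chiI by (auto simp: A_def sp B_def space_eq chi_def min_def)
      then show ?thesis by auto
    qed
    ultimately show "emeasure omega_law ((\<lambda>\<omega>. (\<omega>, q)) -` A) =
      ennreal (1/2) * ennreal (1 - truncated_max s t (fst q)) + ennreal (1/2) * indicator (B \<times> B) q"
      unfolding emeasure_omega_law[OF sA] using m by (simp add: q(1) m_def)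
  qed
  also have "\<dots> = ennreal (1/2) * (\<integral>\<^sup>+q. ennreal (1 - truncated_max s t (fst q)) \<partial>(\<rho> \<Otimes>\<^sub>M \<rho>))
      + ennreal (1/2) * emeasure (\<rho> \<Otimes>\<^sub>M \<rho>) (B \<times> B)"
    by (simp add: nn_integral_add nn_integral_cmult)
  also have "(\<integral>\<^sup>+q. ennreal (1 - truncated_max s t (fst q)) \<partial>(\<rho> \<Otimes>\<^sub>M \<rho>))
      = (\<integral>\<^sup>+p. ennreal (1 - truncated_max s t p) \<partial>\<rho>)"
    by (subst nn_integral_fst[symmetric]) (auto simp: emeasure_space_1)
  also have "\<dots> = ennreal (\<integral>p. 1 - truncated_max s t p \<partial>\<rho>)"
    using truncated_max_bounds integrable_truncated_max
    by (intro nn_integral_eq_integral AE_I2) (auto simp: space_eq)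
  also have "(\<integral>p. 1 - truncated_max s t p \<partial>\<rho>) = 1 - (\<integral>p. truncated_max s t p \<partial>\<rho>)"
    using integrable_truncated_max by (simp add: prob_space)
  also have "emeasure (\<rho> \<Otimes>\<^sub>M \<rho>) (B \<times> B) = ennreal ((1 - joint_cdf \<rho> s t)\<^sup>2)"
    using prob_greater_eq[of s t]
    by (simp add: emeasure_pair_measure_Times emeasure_eq_measure B_def[symmetric] power2_eq_square
        ennreal_mult'' joint_cdf_def)
  also have "ennreal (1/2) * ennreal (1 - (\<integral>p. truncated_max s t p \<partial>\<rho>))
      + ennreal (1/2) * ennreal ((1 - joint_cdf \<rho> s t)\<^sup>2)
    = ennreal ((1 - (\<integral>p. truncated_max s t p \<partial>\<rho>)) / 2 + (1 - joint_cdf \<rho> s t)\<^sup>2 / 2)"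
  proof -
    have "(\<integral>p. truncated_max s t p \<partial>\<rho>) \<le> 1"
      using truncated_max_bounds integrable_truncated_max
      by (intro integral_le_const AE_I2) (auto simp: space_eq)
    moreover have "ennreal (1/2) * ennreal x + ennreal (1/2) * ennreal y = ennreal (x / 2 + y / 2)"
      if "0 \<le> x" "0 \<le> y" for x y
    proof -
      have "ennreal (x / 2 + y / 2) = ennreal (1/2 * x) + ennreal (1/2 * y)"
        using that by (subst ennreal_plus[symmetric]) auto
      also have "\<dots> = ennreal (1/2) * ennreal x + ennreal (1/2) * ennreal y"
        using that by (subst (1 2) ennreal_mult) auto
      finally show ?thesis by simp
    qed
    ultimately show ?thesis by simp
  qed
  finally have "emeasure T B = ennreal ((1 - (\<integral>p. truncated_max s t p \<partial>\<rho>)) / 2 + (1 - joint_cdf \<rho> s t)\<^sup>2 / 2)" .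
  with \<open>ennreal (1 - joint_cdf T s t) = emeasure T B\<close>
  have eq: "ennreal (1 - joint_cdf T s t) = ennreal ((1 - (\<integral>p. truncated_max s t p \<partial>\<rho>)) / 2 + (1 - joint_cdf \<rho> s t)\<^sup>2 / 2)"
    by simp
  have "(\<integral>p. truncated_max s t p \<partial>\<rho>) \<le> 1"
    using truncated_max_bounds integrable_truncated_max
    by (intro integral_le_const AE_I2) (auto simp: space_eq)
  moreover have "0 \<le> 1 - joint_cdf T s t" by (simp add: joint_cdf_def)
  ultimately show ?thesis using eq by (subst (asm) ennreal_inj) auto
qed

text \<open>If \<open>T\<close> and \<open>\<rho>\<close> have the same distribution function, the
  linear terms in \<open>joint_cdf_T\<close> cancel. Conversely \<open>I2_prob_eqI\<close> recovers
  the law from its distribution function.\<close>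

lemma solves_bivariate_RDE_iff:
  "solves_bivariate_RDE \<rho> \<longleftrightarrow> (\<forall>s t. (joint_cdf \<rho> s t)\<^sup>2 = (\<integral>p. truncated_max s t p \<partial>\<rho>))"
proof -
  have "(joint_cdf \<rho> s t)\<^sup>2 = (\<integral>p. truncated_max s t p \<partial>\<rho>) \<longleftrightarrow> joint_cdf T s t = joint_cdf \<rho> s t" for s t
    using joint_cdf_T[of s t] by (auto simp: power2_eq_square field_simps)
  then show ?thesis
    using I2_prob_eqI[OF I2_prob_T I2_prob_axioms] unfolding solves_bivariate_RDE_def T_def[symmetric]
    by metis
qed

end

section \<open>The marginal law\<close>

lemma I_singleton_sets [measurable]: "y \<in> I_set \<Longrightarrow> {y} \<in> sets I_borel"
  by (simp add: sets_I_borel_iff)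

lemma infinity_in_I [simp]: "\<infinity> \<in> I_set"
  by (simp add: I_set_def)

lemma ereal_in_I_iff [simp]: "ereal r \<in> I_set \<longleftrightarrow> 0 \<le> r \<and> r \<le> 1"
  by (auto simp: I_set_def)

lemma sets_rho_Xi [simp, measurable_cong]: "sets (rho_Xi \<theta>) = sets I_borel"
  unfolding rho_Xi_def using sets.sigma_sets_eq[of I_borel] sets.space_closed[of I_borel]
  by (subst sets_measure_of) auto

lemma space_rho_Xi [simp]: "space (rho_Xi \<theta>) = I_set"
  using sets_eq_imp_space_eq[OF sets_rho_Xi, of \<theta>] by simp

lemma nn_integral_rho_Xi_lt_1:
  assumes \<theta>: "0 < \<theta>" "\<theta> < 1" and h: "h \<in> borel_measurable I_borel"
  shows "(\<integral>\<^sup>+y. h y \<partial>rho_Xi \<theta>) = (\<Sum>k. ennreal ((1 - \<theta>) / (1 + \<theta>) * \<theta> ^ k) * h (ereal (\<theta> ^ k)))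
    + ennreal (\<theta> / (1 + \<theta>)) * h \<infinity>"
proof -
  \<comment> \<open>index \<open>0\<close> stands for the atom at \<open>\<infinity>\<close>\<close>
  define W where "W n = (case n of 0 \<Rightarrow> ennreal (\<theta> / (1 + \<theta>))
    | Suc k \<Rightarrow> ennreal ((1 - \<theta>) / (1 + \<theta>) * \<theta> ^ k))" for n
  define z where "z n = (case n of 0 \<Rightarrow> \<infinity> | Suc k \<Rightarrow> ereal (\<theta> ^ k))" for n
  have z: "z \<in> measurable (density (count_space UNIV) W) I_borel"
    using \<theta> by (auto simp: z_def power_le_one split: nat.split)
  have split: "(\<Sum>n. u n) = (\<Sum>n. u (Suc n)) + u 0" for u :: "nat \<Rightarrow> ennreal"
    using suminf_offset[of u 1] by (simp add: add.commute)
  have int: "(\<integral>\<^sup>+y. h y \<partial>distr (density (count_space UNIV) W) I_borel z)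
    = (\<Sum>k. ennreal ((1 - \<theta>) / (1 + \<theta>) * \<theta> ^ k) * h (ereal (\<theta> ^ k))) + ennreal (\<theta> / (1 + \<theta>)) * h \<infinity>"
    if h: "h \<in> borel_measurable I_borel" for h
  proof -
    have "(\<integral>\<^sup>+y. h y \<partial>distr (density (count_space UNIV) W) I_borel z) = (\<Sum>n. W n * h (z n))"
      using h z by (simp add: nn_integral_distr nn_integral_density nn_integral_count_space_nat)
    also have "\<dots> = (\<Sum>n. W (Suc n) * h (z (Suc n))) + W 0 * h (z 0)" by (rule split)
    finally show ?thesis by (simp add: W_def z_def)
  qed
  have "rho_Xi \<theta> = distr (density (count_space UNIV) W) I_borel z"
  proof (rule measure_eqI)
    fix A assume A: "A \<in> sets (rho_Xi \<theta>)"
    then have A': "A \<in> sets I_borel" by simp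
    have "emeasure (distr (density (count_space UNIV) W) I_borel z) A
      = (\<integral>\<^sup>+y. indicator A y \<partial>distr (density (count_space UNIV) W) I_borel z)"
      using A' by simp
    also have "\<dots> = (\<Sum>k. ennreal ((1 - \<theta>) / (1 + \<theta>) * \<theta> ^ k) * indicator A (ereal (\<theta> ^ k)))
        + ennreal (\<theta> / (1 + \<theta>)) * indicator A \<infinity>"
      using A' by (intro int) auto
    also have "(\<Sum>k. ennreal ((1 - \<theta>) / (1 + \<theta>) * \<theta> ^ k) * indicator A (ereal (\<theta> ^ k)))
        = ennreal ((1 - \<theta>) / (1 + \<theta>)) * (\<Sum>k. ennreal (\<theta> ^ k) * indicator A (ereal (\<theta> ^ k)))"
    proof -
      have "ennreal (a * \<theta> ^ k) * x = ennreal a * (ennreal (\<theta> ^ k) * x)" if "0 \<le> a" for a k x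
        using that \<theta> by (simp add: ennreal_mult mult.assoc)
      moreover have "0 \<le> (1 - \<theta>) / (1 + \<theta>)" using \<theta> by simp
      ultimately show ?thesis by (simp only: ennreal_suminf_cmult)
    qed
    finally show "emeasure (rho_Xi \<theta>) A = emeasure (distr (density (count_space UNIV) W) I_borel z) A"
      using emeasure_rho_Xi[OF A', of \<theta>] \<theta> by simp
  qed simp
  then show ?thesis using int[OF h] by simp
qed

lemma nn_integral_rho_Xi_1:
  assumes h: "h \<in> borel_measurable I_borel"
  shows "(\<integral>\<^sup>+y. h y \<partial>rho_Xi 1) = ennreal (1/2) * (\<integral>\<^sup>+u. h (ereal u) * indicator {0..1} u \<partial>lborel)
    + ennreal (1/2) * h \<infinity>"
proof -
  \<comment> \<open>The atom at infinity is spread over \<open>(1,2]\<close>, which makes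
    \<open>rho_Xi 1\<close> the image of the uniform law on \<open>[0,2]\<close>.\<close>
  define z where "z u = (if u \<le> 1 then ereal u else \<infinity>)" for u :: real
  define w where "w u = ennreal (1/2) * indicator {0..2} u" for u :: real
  define M where "M = restrict_space (density lborel w) {0..2}"
  have w [measurable]: "w \<in> borel_measurable borel" unfolding w_def by measurable
  have "z \<in> borel_measurable borel" unfolding z_def by measurable
  then have z: "z \<in> measurable M I_borel"
    unfolding I_borel_def M_def
    by (intro measurable_restrict_space2 measurable_restrict_space1)
      (auto simp: z_def space_restrict_space)
  have int: "(\<integral>\<^sup>+y. h y \<partial>distr M I_borel z)
    = ennreal (1/2) * (\<integral>\<^sup>+u. h (ereal u) * indicator {0..1} u \<partial>lborel) + ennreal (1/2) * h \<infinity>"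
    if h: "h \<in> borel_measurable I_borel" for h
  proof -
    have m1: "(\<lambda>u. h (ereal u) * indicator {0..1} u) \<in> borel_measurable borel"
    proof -
      have "(\<lambda>u. h (ereal u)) \<in> borel_measurable (restrict_space borel {0..1})"
      proof (rule measurable_compose[OF _ h])
        show "ereal \<in> measurable (restrict_space borel {0..1}) I_borel"
          unfolding I_borel_def
          by (intro measurable_restrict_space2 measurable_restrict_space1)
            (auto simp: space_restrict_space)
      qed
      then show ?thesis by (subst (asm) borel_measurable_restrict_space_iff_ennreal) auto
    qed
    have m2: "(\<lambda>u. h (z u) * indicator {0..2} u) \<in> borel_measurable borel"
    proof -
      have "(\<lambda>u. h (z u)) \<in> borel_measurable M" by (rule measurable_compose[OF z h])
      then show ?thesis
        unfolding M_def by (subst (asm) borel_measurable_restrict_space_iff_ennreal) (auto cong: measurable_cong_sets)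
    qed
    have "(\<integral>\<^sup>+y. h y \<partial>distr M I_borel z) = (\<integral>\<^sup>+u. h (z u) \<partial>M)" by (rule nn_integral_distr) (use z h in simp_all)
    also have "\<dots> = (\<integral>\<^sup>+u. h (z u) * indicator {0..2} u \<partial>density lborel w)"
      unfolding M_def by (rule nn_integral_restrict_space) simp
    also have "\<dots> = (\<integral>\<^sup>+u. w u * (h (z u) * indicator {0..2} u) \<partial>lborel)"
      using m2 by (subst nn_integral_density) auto
    also have "\<dots> = (\<integral>\<^sup>+u. ennreal (1/2) * (h (ereal u) * indicator {0..1} u)
        + ennreal (1/2) * h \<infinity> * indicator {1<..2} u \<partial>lborel)"
      by (intro nn_integral_cong) (auto simp: w_def z_def split: split_indicator)
    also have "\<dots> = ennreal (1/2) * (\<integral>\<^sup>+u. h (ereal u) * indicator {0..1} u \<partial>lborel) + ennreal (1/2) * h \<infinity>"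
      using m1 by (subst nn_integral_add) (auto simp: nn_integral_cmult)
    finally show ?thesis .
  qed
  have "rho_Xi 1 = distr M I_borel z"
  proof (rule measure_eqI)
    fix A assume A: "A \<in> sets (rho_Xi 1)"
    then have A': "A \<in> sets I_borel" by simp
    have "emeasure (distr M I_borel z) A = (\<integral>\<^sup>+y. indicator A y \<partial>distr M I_borel z)"
      using A' by simp
    also have "\<dots> = ennreal (1/2) * (\<integral>\<^sup>+u. indicator A (ereal u) * indicator {0..1} u \<partial>lborel)
        + ennreal (1/2) * indicator A \<infinity>"
      using A' by (intro int) auto
    also have "(\<integral>\<^sup>+u. indicator A (ereal u) * indicator {0..1} u \<partial>lborel)
        = (\<integral>\<^sup>+u. indicator {t \<in> {0..1}. ereal t \<in> A} u \<partial>lborel)"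
      by (intro nn_integral_cong) (auto split: split_indicator)
    also have "\<dots> = emeasure lborel {t \<in> {0..1}. ereal t \<in> A}"
      using sets_I_borel_vimage[OF A'] by simp
    finally show "emeasure (rho_Xi 1) A = emeasure (distr M I_borel z) A"
      using emeasure_rho_Xi[OF A', of 1] by simp
  qed simp
  then show ?thesis using int[OF h] by simp
qed

lemma geometric_tail_sums:
  fixes x :: real
  assumes "0 < x" "x < 1"
  shows "(\<lambda>k. if i \<le> k then a * x ^ k else 0) sums (a * x ^ i / (1 - x))"
proof -
  have "(\<lambda>k. a * x ^ i * x ^ k) sums (a * x ^ i * (1 / (1 - x)))"
    using assms by (intro sums_mult geometric_sums) auto
  then have "(\<lambda>k. if i \<le> k + i then a * x ^ (k + i) else 0) sums (a * x ^ i / (1 - x))"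
    by (simp add: power_add mult_ac)
  then show ?thesis by (subst (asm) sums_zero_iff_shift) auto
qed

lemma Xi_bounds:
  assumes "0 < \<theta>" "\<theta> \<le> 1" "s \<in> Xi \<theta>"
  shows "0 < s" "s \<le> 1"
  using assms by (auto simp: Xi_def power_le_one split: if_splits)

lemma Xi_mult:
  assumes "s \<in> Xi \<theta>" "t \<in> Xi \<theta>" "0 < \<theta>" "\<theta> \<le> 1"
  shows "s * t \<in> Xi \<theta>"
proof (cases "\<theta> < 1")
  case True
  then show ?thesis using assms by (auto simp: Xi_def power_add[symmetric])
next
  case False
  then show ?thesis using assms mult_le_one[of s t] by (auto simp: Xi_def)
qed

lemma one_in_Xi: "1 \<in> Xi \<theta>"
  by (auto simp: Xi_def intro!: image_eqI[of _ _ 0])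

lemma Xi_divide:
  assumes "s \<in> Xi \<theta>" "t \<in> Xi \<theta>" "t \<le> s" "0 < \<theta>" "\<theta> \<le> 1"
  shows "t / s \<in> Xi \<theta>"
proof (cases "\<theta> < 1")
  case True
  then obtain i j where ij: "s = \<theta> ^ i" "t = \<theta> ^ j" using assms by (auto simp: Xi_def)
  then have "i \<le> j" using assms True power_strict_decreasing[of j i \<theta>] by (cases "i \<le> j") auto
  then have "t / s = \<theta> ^ (j - i)" using assms ij by (simp add: power_diff)
  then show ?thesis using True by (auto simp: Xi_def)
next
  case False
  then show ?thesis using assms by (auto simp: Xi_def)
qed

text \<open>A geometric tail of ratio \<open>\<theta> ^ Suc n\<close>, or an integral of
  \<open>u ^ n\<close>. The case \<open>n = 0\<close> gives the marginal distribution function,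
  \<open>n = 1\<close> the truncated mean.\<close>

lemma nn_integral_rho_Xi_power:
  assumes \<theta>: "0 < \<theta>" "\<theta> \<le> 1" and s: "s \<in> Xi \<theta>"
  shows "(\<integral>\<^sup>+y. (if y \<le> ereal s then ennreal (real_of_ereal y ^ n) else 0) \<partial>rho_Xi \<theta>)
     = ennreal ((if \<theta> < 1 then (1 - \<theta>) / (1 + \<theta>) / (1 - \<theta> ^ Suc n) else 1 / 2 / Suc n) * s ^ Suc n)"
proof -
  let ?h = "\<lambda>y. if y \<le> ereal s then ennreal (real_of_ereal y ^ n) else 0"
  have id: "(\<lambda>x. x) \<in> borel_measurable I_borel" by (rule measurable_I_borel_borel)
  note [measurable] = id
  have h: "?h \<in> borel_measurable I_borel" by measurable
  show ?thesis
  proof (cases "\<theta> < 1")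
    case True
    note \<theta>' = \<theta>(1) True
    obtain i where i: "s = \<theta> ^ i" using s True by (auto simp: Xi_def)
    have x: "0 < \<theta> ^ Suc n" "\<theta> ^ Suc n < 1" using \<theta>' power_Suc_less_one[of \<theta> n] by auto
    have "(\<integral>\<^sup>+y. ?h y \<partial>rho_Xi \<theta>) = (\<Sum>k. ennreal ((1 - \<theta>) / (1 + \<theta>) * \<theta> ^ k) * ?h (ereal (\<theta> ^ k)))"
      by (subst nn_integral_rho_Xi_lt_1[OF \<theta>' h]) simp
    also have "\<dots> = (\<Sum>k. ennreal (if i \<le> k then (1 - \<theta>) / (1 + \<theta>) * (\<theta> ^ Suc n) ^ k else 0))"
    proof (intro suminf_cong)
      fix k
      have "(1 - \<theta>) / (1 + \<theta>) * (\<theta> ^ Suc n) ^ k = (1 - \<theta>) / (1 + \<theta>) * \<theta> ^ k * (\<theta> ^ k) ^ n"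
        by (simp add: power_mult_distrib power_mult[symmetric] mult.commute[of n k])
      then show "ennreal ((1 - \<theta>) / (1 + \<theta>) * \<theta> ^ k) * ?h (ereal (\<theta> ^ k))
        = ennreal (if i \<le> k then (1 - \<theta>) / (1 + \<theta>) * (\<theta> ^ Suc n) ^ k else 0)"
        using \<theta>' by (simp add: i power_decreasing_iff ennreal_mult[symmetric])
    qed
    also have "\<dots> = ennreal ((1 - \<theta>) / (1 + \<theta>) * (\<theta> ^ Suc n) ^ i / (1 - \<theta> ^ Suc n))"
      using \<theta>' by (intro suminf_ennreal_eq geometric_tail_sums x) auto
    also have "(\<theta> ^ Suc n) ^ i = s ^ Suc n"
      unfolding i power_mult[symmetric] by (simp only: mult.commute)
    finally show ?thesis using True by simp
  next
    case False
    then have 1: "\<theta> = 1" using \<theta> by simp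
    then have s': "0 < s" "s \<le> 1" using Xi_bounds[OF \<theta> s] by auto
    have "(\<integral>\<^sup>+y. ?h y \<partial>rho_Xi \<theta>) = ennreal (1/2) * (\<integral>\<^sup>+u. ?h (ereal u) * indicator {0..1} u \<partial>lborel)"
      unfolding 1 by (subst nn_integral_rho_Xi_1[OF h]) simp
    also have "(\<integral>\<^sup>+u. ?h (ereal u) * indicator {0..1} u \<partial>lborel)
        = (\<integral>\<^sup>+u. ennreal (u ^ n) * indicator {0..s} u \<partial>lborel)"
      using s' by (intro nn_integral_cong) (auto split: split_indicator)
    also have "\<dots> = ennreal (s ^ Suc n / Suc n - 0 ^ Suc n / Suc n)"
    proof (rule nn_integral_FTC_Icc[where F = "\<lambda>u. u ^ Suc n / real (Suc n)"])
      show "((\<lambda>u. u ^ Suc n / real (Suc n)) has_real_derivative u ^ n) (at u)" for u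
        using DERIV_cdivide[OF DERIV_pow[of "Suc n" u UNIV], of "real (Suc n)"]
        by (simp del: of_nat_Suc power_Suc)
    qed (use s' in auto)
    also have "ennreal (1/2) * ennreal (s ^ Suc n / Suc n - 0 ^ Suc n / Suc n)
        = ennreal (1/2 * (s ^ Suc n / Suc n - 0 ^ Suc n / Suc n))"
      using s' by (intro ennreal_mult[symmetric]) auto
    also have "1/2 * (s ^ Suc n / Suc n - 0 ^ Suc n / Suc n) = 1 / 2 / Suc n * s ^ Suc n" by simp
    finally show ?thesis unfolding 1 by (simp only: less_irrefl if_False)
  qed
qed

lemma emeasure_rho_Xi_le:
  assumes \<theta>: "0 < \<theta>" "\<theta> \<le> 1" and s: "s \<in> Xi \<theta>"
  shows "emeasure (rho_Xi \<theta>) {y \<in> I_set. y \<le> ereal s} = ennreal (s / (1 + \<theta>))"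
proof -
  have "{y \<in> I_set. y \<le> ereal s} \<in> sets I_borel"
    using measurable_sets[OF measurable_I_borel_borel, of "{..ereal s}"]
    by (simp add: vimage_def Int_def conj_commute)
  then have "emeasure (rho_Xi \<theta>) {y \<in> I_set. y \<le> ereal s}
     = (\<integral>\<^sup>+y. indicator {y \<in> I_set. y \<le> ereal s} y \<partial>rho_Xi \<theta>)" by simp
  also have "\<dots> = (\<integral>\<^sup>+y. (if y \<le> ereal s then ennreal (real_of_ereal y ^ 0) else 0) \<partial>rho_Xi \<theta>)"
    by (intro nn_integral_cong) auto
  also have "\<dots> = ennreal (s / (1 + \<theta>))"
  proof -
    have "(if \<theta> < 1 then (1 - \<theta>) / (1 + \<theta>) / (1 - \<theta> ^ Suc 0) else 1 / 2 / Suc 0) = 1 / (1 + \<theta>)"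
      using \<theta> by simp
    then show ?thesis unfolding nn_integral_rho_Xi_power[OF assms] by simp
  qed
  finally show ?thesis .
qed

lemma emeasure_rho_Xi_infinity:
  assumes "0 < \<theta>" "\<theta> \<le> 1"
  shows "emeasure (rho_Xi \<theta>) {\<infinity>} = ennreal (\<theta> / (1 + \<theta>))"
proof (cases "\<theta> < 1")
  case False
  then show ?thesis using assms by (subst emeasure_rho_Xi) auto
qed (use assms in \<open>auto simp: emeasure_rho_Xi\<close>)

lemma prob_space_rho_Xi:
  assumes "0 < \<theta>" "\<theta> \<le> 1"
  shows "prob_space (rho_Xi \<theta>)"
proof
  have "{y \<in> I_set. y \<le> ereal 1} \<in> sets I_borel" by (auto simp: sets_I_borel_iff I_set_def)
  moreover have "space (rho_Xi \<theta>) = {y \<in> I_set. y \<le> ereal 1} \<union> {\<infinity>}" by (auto elim!: I_set_cases)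
  ultimately have "emeasure (rho_Xi \<theta>) (space (rho_Xi \<theta>))
      = emeasure (rho_Xi \<theta>) {y \<in> I_set. y \<le> ereal 1} + emeasure (rho_Xi \<theta>) {\<infinity>}"
    by (simp only:) (subst plus_emeasure, auto)
  also have "\<dots> = ennreal (1 / (1 + \<theta>) + \<theta> / (1 + \<theta>))"
    using emeasure_rho_Xi_le[OF assms one_in_Xi] emeasure_rho_Xi_infinity[OF assms] assms by simp
  also have "1 / (1 + \<theta>) + \<theta> / (1 + \<theta>) = 1" using assms by (simp add: divide_simps)
  finally show "emeasure (rho_Xi \<theta>) (space (rho_Xi \<theta>)) = 1" by simp
qed

definition Xi_inf :: "real \<Rightarrow> ereal set" where
  "Xi_inf \<theta> = insert \<infinity> (ereal ` Xi \<theta>)"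

lemma AE_rho_Xi:
  assumes "0 < \<theta>" "\<theta> \<le> 1"
  shows "AE y in rho_Xi \<theta>. y \<in> Xi_inf \<theta>"
proof (cases "\<theta> < 1")
  case True
  have "countable (Xi_inf \<theta>)" using True by (auto simp: Xi_inf_def Xi_def)
  moreover have "{y} \<in> sets I_borel" if y: "y \<in> Xi_inf \<theta>" for y
  proof (rule I_singleton_sets)
    show "y \<in> I_set"
      using y Xi_bounds[OF assms] by (auto simp: Xi_inf_def less_imp_le)
  qed
  ultimately have "(\<Union>y\<in>Xi_inf \<theta>. {y}) \<in> sets I_borel" by (intro sets.countable_UN') auto
  then have J: "Xi_inf \<theta> \<in> sets I_borel" by simp
  have J': "I_set - Xi_inf \<theta> \<in> sets I_borel" using sets.compl_sets[OF J] by simp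
  have "indicator (I_set - Xi_inf \<theta>) (ereal (\<theta> ^ k)) = (0 :: ennreal)" for k
    using True by (simp add: Xi_inf_def Xi_def)
  moreover have "indicator (I_set - Xi_inf \<theta>) \<infinity> = (0 :: ennreal)" by (simp add: Xi_inf_def)
  ultimately have "emeasure (rho_Xi \<theta>) (I_set - Xi_inf \<theta>) = 0"
    using True by (simp only: emeasure_rho_Xi[OF J'] if_True mult_zero_right suminf_zero add_0_right)
  then show ?thesis using J' by (intro AE_I[of _ _ "I_set - Xi_inf \<theta>"]) auto
next
  case False
  then have 1: "\<theta> = 1" using assms by simp
  have "emeasure (rho_Xi 1) {ereal 0} = 0"
  proof (subst emeasure_rho_Xi)
    have "emeasure lborel {t \<in> {0..1}. ereal t \<in> {ereal 0}} \<le> emeasure lborel {0::real}"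
      by (intro emeasure_mono) auto
    then show "(if (1::real) < 1 then ennreal ((1 - 1) / (1 + 1)) * (\<Sum>k. ennreal (1 ^ k) * indicator {ereal 0} (ereal (1 ^ k))) + ennreal (1 / (1 + 1)) * indicator {ereal 0} \<infinity>
      else ennreal (1 / 2) * emeasure lborel {t \<in> {0..1}. ereal t \<in> {ereal 0}} + ennreal (1 / 2) * indicator {ereal 0} \<infinity>) = 0"
      by simp
  qed (rule I_singleton_sets, simp)
  moreover have "{ereal 0} \<in> sets I_borel" by (rule I_singleton_sets) simp
  ultimately show ?thesis unfolding 1
    by (intro AE_I[of _ _ "{ereal 0}"]) (auto simp: Xi_inf_def Xi_def elim!: I_set_cases)
qed

text \<open>Almost surely a threshold acts like the largest element of \<open>Xi \<theta>\<close>
  below it, and -1 stands for a threshold below all of them. Identities for all real thresholds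
  thereby reduce to thresholds in \<open>Xi \<theta>\<close> or equal to -1.\<close>

lemma Xi_round:
  assumes "0 < \<theta>" "\<theta> \<le> 1"
  obtains a' where "a' = -1 \<or> a' \<in> Xi \<theta> \<and> a' \<le> a"
    "\<And>y. y \<in> Xi_inf \<theta> \<Longrightarrow> y \<le> ereal a \<longleftrightarrow> y \<le> ereal a'"
proof -
  consider "a \<le> 0" | "1 \<le> a" | "0 < a" "a < 1" by linarith
  then show ?thesis
  proof cases
    case 1
    show ?thesis
    proof (rule that)
      show "-1 = (-1::real) \<or> -1 \<in> Xi \<theta> \<and> -1 \<le> a" by simp
      show "y \<le> ereal a \<longleftrightarrow> y \<le> ereal (-1)" if "y \<in> Xi_inf \<theta>" for y
        using that 1 Xi_bounds[OF assms] by (force simp: Xi_inf_def)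
    qed
  next
    case 2
    show ?thesis
    proof (rule that)
      show "1 = (-1::real) \<or> 1 \<in> Xi \<theta> \<and> 1 \<le> a" using 2 one_in_Xi by simp
      show "y \<le> ereal a \<longleftrightarrow> y \<le> ereal 1" if "y \<in> Xi_inf \<theta>" for y
        using that 2 Xi_bounds[OF assms] by (force simp: Xi_inf_def)
    qed
  next
    case 3
    show ?thesis
    proof (cases "\<theta> < 1")
      case True
      have "\<exists>n. \<theta> ^ n < a" using real_arch_pow_inv[OF 3(1) True] .
      then have ex: "\<exists>n. \<theta> ^ n \<le> a" by (meson less_imp_le)
      define n where "n = (LEAST n. \<theta> ^ n \<le> a)"
      have n: "\<theta> ^ n \<le> a" unfolding n_def using ex by (rule LeastI_ex)
      have iff: "\<theta> ^ k \<le> a \<longleftrightarrow> n \<le> k" for k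
        using n power_decreasing[of n k \<theta>] assms Least_le[of "\<lambda>n. \<theta> ^ n \<le> a" k]
        by (auto simp: n_def[symmetric] intro: order_trans)
      show ?thesis
      proof (rule that)
        show "\<theta> ^ n = -1 \<or> \<theta> ^ n \<in> Xi \<theta> \<and> \<theta> ^ n \<le> a" using n True by (auto simp: Xi_def)
        show "y \<le> ereal a \<longleftrightarrow> y \<le> ereal (\<theta> ^ n)" if "y \<in> Xi_inf \<theta>" for y
          using that True iff power_decreasing_iff[OF assms(1) True]
          by (auto simp: Xi_inf_def Xi_def)
      qed
    next
      case False
      show ?thesis
      proof (rule that)
        show "a = -1 \<or> a \<in> Xi \<theta> \<and> a \<le> a" using False 3 by (auto simp: Xi_def)
      qed simp
    qed
  qed
qed

section \<open>Scale invariance\<close>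

text \<open>The bound \<open>a \<le> 1\<close> makes \<open>s * a \<le> s\<close>, so points beyond
  \<open>s\<close>, which \<open>psi s\<close> sends to infinity, violate both sides.\<close>

lemma psi_le_iff:
  assumes "y \<in> I_set" "0 < s" "a \<le> 1"
  shows "psi s y \<le> ereal a \<longleftrightarrow> y \<le> ereal (s * a)"
  using assms(1)
proof (cases rule: I_set_cases)
  case (1 r)
  have "s * a \<le> s" using assms by (simp add: mult_le_cancel_left1)
  then show ?thesis
  proof (cases "r \<le> s")
    case True
    have "psi s y \<le> ereal a \<longleftrightarrow> inverse s * r \<le> a" using 1 True by (simp add: psi_def)
    also have "\<dots> \<longleftrightarrow> r \<le> s * a" using assms(2) by (simp add: field_simps)
    finally show ?thesis using 1 by simp
  next
    case False
    then have "\<not> r \<le> s * a" using \<open>s * a \<le> s\<close> by linarith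
    then show ?thesis using False 1 by (simp add: psi_def)
  qed
qed (auto simp: psi_def)

lemma real_of_psi: "y \<le> ereal s \<Longrightarrow> y \<in> I_set \<Longrightarrow> real_of_ereal (psi s y) = real_of_ereal y / s"
  by (auto simp: psi_def divide_inverse mult.commute elim!: I_set_cases)

lemma truncated_max_psi2:
  assumes "p \<in> I_set \<times> I_set" "0 < s" "a \<le> 1" "b \<le> 1"
  shows "truncated_max (s * a) (s * b) p = s * truncated_max a b (psi2 s p)"
proof -
  have le: "y \<le> ereal s" if "y \<le> ereal (s * c)" "c \<le> 1" for y c
  proof -
    have "ereal (s * c) \<le> ereal s" using that(2) assms(2) by (simp add: mult_le_cancel_left1)
    with that(1) show ?thesis by (rule order_trans)
  qed
  have eq: "(if y \<le> ereal (s * c) then real_of_ereal y else 0)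
      = s * (if psi s y \<le> ereal c then real_of_ereal (psi s y) else 0)"
    if "y \<in> I_set" "c \<le> 1" for y c
    using that assms(2) le[of y c] by (simp add: psi_le_iff real_of_psi)
  obtain x y where p: "p = (x, y)" "x \<in> I_set" "y \<in> I_set" using assms(1) by auto
  have "s * max u v = max (s * u) (s * v)" for u v :: real
    using assms(2) by (simp add: max_mult_distrib_left)
  then show ?thesis
    unfolding truncated_max_def psi2_def p(1)
    by (simp only: fst_conv snd_conv case_prod_conv eq[OF p(2) assms(3)] eq[OF p(3) assms(4)])
qed

lemma infinity_infinity_sets: "{(\<infinity>, \<infinity>)} \<in> sets I2_borel"
proof -
  have "{\<infinity>} \<times> {\<infinity>} \<in> sets (I_borel \<Otimes>\<^sub>M I_borel)"
    by (intro pair_measureI I_singleton_sets) simp_all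
  then show ?thesis by (simp add: I2_borel_def)
qed

context I2_prob
begin

lemma joint_cdf_eq_integral:
  "joint_cdf \<rho> s t = (\<integral>p. of_bool (fst p \<le> ereal s \<or> snd p \<le> ereal t) \<partial>\<rho>)"
proof -
  have "joint_cdf \<rho> s t = (\<integral>p. indicator {p \<in> space \<rho>. fst p \<le> ereal s \<or> snd p \<le> ereal t} p \<partial>\<rho>)"
    unfolding joint_cdf_def by simp
  also have "\<dots> = (\<integral>p. of_bool (fst p \<le> ereal s \<or> snd p \<le> ereal t) \<partial>\<rho>)"
    by (intro Bochner_Integration.integral_cong) auto
  finally show ?thesis .
qed

lemma psi2_measurable [measurable]: "0 < s \<Longrightarrow> psi2 s \<in> measurable \<rho> I2_borel"
  using measurable_psi2[of s] by (simp cong: measurable_cong_sets add: sets_eq)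

text \<open>Invariance under \<open>Gamma2 s\<close> says that the image of \<open>\<rho>\<close>
  under \<open>psi2 s\<close> is \<open>s\<close> times \<open>\<rho>\<close> away from
  \<open>(\<infinity>, \<infinity>)\<close>. The possibly negative correction sits at that point
  alone, where the integrand vanishes.\<close>

lemma nn_integral_psi2:
  assumes "\<rho> \<in> M2" and s: "0 < s" and inv: "Gamma2 s \<rho> = \<rho>"
    and f [measurable]: "f \<in> borel_measurable I2_borel" and f0: "f (\<infinity>, \<infinity>) = 0"
  shows "(\<integral>\<^sup>+p. f (psi2 s p) \<partial>\<rho>) = ennreal s * (\<integral>\<^sup>+p. f p \<partial>\<rho>)"
proof -
  define D where "D = distr \<rho> I2_borel (psi2 s)"
  interpret D: prob_space D unfolding D_def by (rule prob_space_distr) (use s in measurable)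
  have sD [measurable_cong]: "sets D = sets I2_borel" by (simp add: D_def)
  define A0 where "A0 = space I2_borel - {(\<infinity>, \<infinity>)}"
  have A0 [measurable]: "A0 \<in> sets I2_borel" unfolding A0_def using infinity_infinity_sets by blast
  have key: "emeasure D A = ennreal s * emeasure \<rho> A" if A: "A \<in> sets I2_borel" "(\<infinity>, \<infinity>) \<notin> A" for A
  proof -
    have "emeasure \<rho> A = ennreal (inverse s * measure D A)"
      using emeasure_Gamma2[OF assms(1) s A(1)] A(2) inv by (simp add: D_def)
    then have "ennreal s * emeasure \<rho> A = ennreal (s * (inverse s * measure D A))"
      using s by (simp add: ennreal_mult)
    also have "s * (inverse s * measure D A) = measure D A" using s by simp
    finally show ?thesis by (simp add: D.emeasure_eq_measure)
  qed
  have eq: "density D (indicator A0) = scale_measure (ennreal s) (density \<rho> (indicator A0))"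
  proof (rule measure_eqI)
    fix A assume "A \<in> sets (density D (indicator A0))"
    then have A: "A \<in> sets I2_borel" by (simp add: sD)
    show "emeasure (density D (indicator A0)) A = emeasure (scale_measure (ennreal s) (density \<rho> (indicator A0))) A"
      using A A0 key[of "A0 \<inter> A"] by (simp add: emeasure_restricted sD sets_eq A0_def)
  qed (simp add: sD sets_eq)
  have "(\<integral>\<^sup>+p. f (psi2 s p) \<partial>\<rho>) = (\<integral>\<^sup>+p. f p \<partial>D)"
    unfolding D_def using s by (subst nn_integral_distr) auto
  also have "\<dots> = (\<integral>\<^sup>+p. indicator A0 p * f p \<partial>D)"
    using f0 sets_eq_imp_space_eq[OF sD]
    by (intro nn_integral_cong) (auto simp: A0_def split: split_indicator)
  also have "\<dots> = (\<integral>\<^sup>+p. f p \<partial>density D (indicator A0))"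
    by (subst nn_integral_density) auto
  also have "\<dots> = ennreal s * (\<integral>\<^sup>+p. indicator A0 p * f p \<partial>\<rho>)"
    unfolding eq by (subst nn_integral_scale_measure) (auto simp: nn_integral_density)
  also have "(\<integral>\<^sup>+p. indicator A0 p * f p \<partial>\<rho>) = (\<integral>\<^sup>+p. f p \<partial>\<rho>)"
    using f0 sets_eq_imp_space_eq[OF sets_eq]
    by (intro nn_integral_cong) (auto simp: A0_def split: split_indicator)
  finally show ?thesis .
qed

lemma integral_psi2:
  fixes f :: "ereal \<times> ereal \<Rightarrow> real"
  assumes "\<rho> \<in> M2" and s: "0 < s" and "Gamma2 s \<rho> = \<rho>"
    and f [measurable]: "f \<in> borel_measurable I2_borel" and "f (\<infinity>, \<infinity>) = 0"
    and nonneg: "\<And>p. p \<in> I_set \<times> I_set \<Longrightarrow> 0 \<le> f p"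
  shows "(\<integral>p. f (psi2 s p) \<partial>\<rho>) = s * (\<integral>p. f p \<partial>\<rho>)"
proof -
  have psiI: "psi2 s p \<in> I_set \<times> I_set" if "p \<in> I_set \<times> I_set" for p
    using that psi_in_I[OF s] by (auto simp: psi2_def)
  have [measurable]: "(\<lambda>p. f (psi2 s p)) \<in> borel_measurable \<rho>"
    using s by measurable
  have "(\<integral>p. f (psi2 s p) \<partial>\<rho>) = enn2real (\<integral>\<^sup>+p. ennreal (f (psi2 s p)) \<partial>\<rho>)"
    using nonneg psiI by (intro integral_eq_nn_integral AE_I2) (auto simp: space_eq)
  also have "(\<integral>\<^sup>+p. ennreal (f (psi2 s p)) \<partial>\<rho>) = ennreal s * (\<integral>\<^sup>+p. ennreal (f p) \<partial>\<rho>)"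
    by (rule nn_integral_psi2[OF assms(1-3)]) (use assms in auto)
  also have "enn2real \<dots> = s * enn2real (\<integral>\<^sup>+p. ennreal (f p) \<partial>\<rho>)"
    using s by (simp add: enn2real_mult)
  also have "enn2real (\<integral>\<^sup>+p. ennreal (f p) \<partial>\<rho>) = (\<integral>p. f p \<partial>\<rho>)"
    using nonneg by (intro integral_eq_nn_integral[symmetric] AE_I2) (auto simp: space_eq)
  finally show ?thesis .
qed

text \<open>One factor \<open>s\<close> comes from the law and the other from the homogeneity of the
  integrand, so both sides of the RDE scale with \<open>s\<^sup>2\<close>.\<close>

lemma integral_truncated_max_scale:
  assumes "\<rho> \<in> M2" "0 < s" "Gamma2 s \<rho> = \<rho>" "a \<le> 1" "b \<le> 1"
  shows "(\<integral>p. truncated_max (s * a) (s * b) p \<partial>\<rho>) = s\<^sup>2 * (\<integral>p. truncated_max a b p \<partial>\<rho>)"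
proof -
  have "(\<integral>p. truncated_max (s * a) (s * b) p \<partial>\<rho>) = (\<integral>p. s * truncated_max a b (psi2 s p) \<partial>\<rho>)"
    using assms by (intro Bochner_Integration.integral_cong) (auto simp: space_eq truncated_max_psi2)
  also have "\<dots> = s * (\<integral>p. truncated_max a b (psi2 s p) \<partial>\<rho>)" by simp
  also have "(\<integral>p. truncated_max a b (psi2 s p) \<partial>\<rho>) = s * (\<integral>p. truncated_max a b p \<partial>\<rho>)"
  proof (rule integral_psi2[OF assms(1-3)])
    show "truncated_max a b (\<infinity>, \<infinity>) = 0" by (simp add: truncated_max_def)
  qed (use truncated_max_bounds in auto)
  finally show ?thesis by (simp add: power2_eq_square)
qed

lemma joint_cdf_scale:
  assumes "\<rho> \<in> M2" "0 < s" "Gamma2 s \<rho> = \<rho>" "a \<le> 1" "b \<le> 1"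
  shows "joint_cdf \<rho> (s * a) (s * b) = s * joint_cdf \<rho> a b"
proof -
  have "joint_cdf \<rho> (s * a) (s * b)
      = (\<integral>p. of_bool (fst (psi2 s p) \<le> ereal a \<or> snd (psi2 s p) \<le> ereal b) \<partial>\<rho>)"
    unfolding joint_cdf_eq_integral using assms
    by (intro Bochner_Integration.integral_cong) (auto simp: space_eq psi2_def psi_le_iff)
  also have "\<dots> = s * (\<integral>p. of_bool (fst p \<le> ereal a \<or> snd p \<le> ereal b) \<partial>\<rho>)"
    by (rule integral_psi2[OF assms(1-3)]) (auto simp: of_bool_def)
  finally show ?thesis unfolding joint_cdf_eq_integral .
qed

end

lemma I2_prob_if_M2: "\<rho> \<in> M2 \<Longrightarrow> I2_prob \<rho>"
  by (simp add: M2_def I2_prob_def I2_prob_axioms_def)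

lemma measurable_I2_fst_I: "fst \<in> measurable I2_borel I_borel"
  unfolding I2_borel_def by (rule measurable_fst)

lemma measurable_I2_snd_I: "snd \<in> measurable I2_borel I_borel"
  unfolding I2_borel_def by (rule measurable_snd)

locale I2_Xi = I2_prob \<rho> for \<rho> +
  fixes \<theta> :: real
  assumes \<theta>: "0 < \<theta>" "\<theta> \<le> 1"
    and marginals: "distr \<rho> I_borel fst = rho_Xi \<theta>" "distr \<rho> I_borel snd = rho_Xi \<theta>"
begin

lemma measurable_fst_I: "fst \<in> measurable \<rho> I_borel"
  using measurable_I2_fst_I by (simp cong: measurable_cong_sets add: sets_eq)

lemma measurable_snd_I: "snd \<in> measurable \<rho> I_borel"
  using measurable_I2_snd_I by (simp cong: measurable_cong_sets add: sets_eq)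

lemma AE_Xi: "AE p in \<rho>. fst p \<in> Xi_inf \<theta> \<and> snd p \<in> Xi_inf \<theta>"
proof -
  have "AE p in \<rho>. fst p \<in> Xi_inf \<theta>"
    using AE_distrD[OF measurable_fst_I] AE_rho_Xi[OF \<theta>] unfolding marginals by blast
  moreover have "AE p in \<rho>. snd p \<in> Xi_inf \<theta>"
    using AE_distrD[OF measurable_snd_I] AE_rho_Xi[OF \<theta>] unfolding marginals by blast
  ultimately show ?thesis by (rule AE_conjI)
qed

lemma joint_cdf_cong:
  assumes "\<And>y. y \<in> Xi_inf \<theta> \<Longrightarrow> y \<le> ereal a \<longleftrightarrow> y \<le> ereal a'"
    "\<And>y. y \<in> Xi_inf \<theta> \<Longrightarrow> y \<le> ereal b \<longleftrightarrow> y \<le> ereal b'"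
  shows "joint_cdf \<rho> a b = joint_cdf \<rho> a' b'"
  unfolding joint_cdf_eq_integral
proof (rule integral_cong_AE)
  show "AE p in \<rho>. (of_bool (fst p \<le> ereal a \<or> snd p \<le> ereal b) :: real)
      = of_bool (fst p \<le> ereal a' \<or> snd p \<le> ereal b')"
    using AE_Xi by eventually_elim (simp add: assms)
qed auto

lemma truncated_max_cong:
  assumes "\<And>y. y \<in> Xi_inf \<theta> \<Longrightarrow> y \<le> ereal a \<longleftrightarrow> y \<le> ereal a'"
    "\<And>y. y \<in> Xi_inf \<theta> \<Longrightarrow> y \<le> ereal b \<longleftrightarrow> y \<le> ereal b'"
  shows "(\<integral>p. truncated_max a b p \<partial>\<rho>) = (\<integral>p. truncated_max a' b' p \<partial>\<rho>)"
proof (rule integral_cong_AE)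
  show "AE p in \<rho>. truncated_max a b p = truncated_max a' b' p"
    using AE_Xi by eventually_elim (simp add: assms truncated_max_def)
qed auto

lemma negative_cong: "y \<in> Xi_inf \<theta> \<Longrightarrow> a < 0 \<Longrightarrow> \<not> y \<le> ereal a"
  using Xi_bounds[OF \<theta>] by (force simp: Xi_inf_def)

lemma not_le_minus_1: "y \<in> I_set \<Longrightarrow> \<not> y \<le> ereal (- 1)"
  by (auto elim!: I_set_cases)

lemma joint_cdf_minus_1:
  assumes "s \<in> Xi \<theta>"
  shows "joint_cdf \<rho> s (-1) = s / (1 + \<theta>)" "joint_cdf \<rho> (-1) s = s / (1 + \<theta>)"
proof -
  have "{y \<in> I_set. y \<le> ereal s} \<in> sets I_borel"
    using measurable_sets[OF measurable_I_borel_borel, of "{..ereal s}"]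
    by (simp add: vimage_def Int_def conj_commute)
  moreover have "measure (rho_Xi \<theta>) {y \<in> I_set. y \<le> ereal s} = s / (1 + \<theta>)"
    using emeasure_rho_Xi_le[OF \<theta> assms] \<theta> Xi_bounds[OF \<theta> assms]
    by (intro measure_eq_emeasure_eq_ennreal) auto
  ultimately have "measure \<rho> (fst -` {y \<in> I_set. y \<le> ereal s} \<inter> space \<rho>) = s / (1 + \<theta>)"
    "measure \<rho> (snd -` {y \<in> I_set. y \<le> ereal s} \<inter> space \<rho>) = s / (1 + \<theta>)"
    using measure_distr[OF measurable_fst_I] measure_distr[OF measurable_snd_I] marginals by metis+
  moreover have "fst -` {y \<in> I_set. y \<le> ereal s} \<inter> space \<rho> = {p \<in> space \<rho>. fst p \<le> ereal s \<or> snd p \<le> ereal (-1)}"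
    "snd -` {y \<in> I_set. y \<le> ereal s} \<inter> space \<rho> = {p \<in> space \<rho>. fst p \<le> ereal (-1) \<or> snd p \<le> ereal s}"
    using not_le_minus_1 by (auto simp: space_eq)
  ultimately show "joint_cdf \<rho> s (-1) = s / (1 + \<theta>)" "joint_cdf \<rho> (-1) s = s / (1 + \<theta>)"
    by (simp_all add: joint_cdf_def)
qed

lemma nn_integral_marginals:
  assumes "h \<in> borel_measurable I_borel"
  shows "(\<integral>\<^sup>+p. h (fst p) \<partial>\<rho>) = (\<integral>\<^sup>+y. h y \<partial>rho_Xi \<theta>)" "(\<integral>\<^sup>+p. h (snd p) \<partial>\<rho>) = (\<integral>\<^sup>+y. h y \<partial>rho_Xi \<theta>)"
  using nn_integral_distr[OF measurable_fst_I, of h] nn_integral_distr[OF measurable_snd_I, of h]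
    assms marginals by simp_all

lemma integral_truncated_max_eq: "ennreal (\<integral>p. truncated_max s t p \<partial>\<rho>) = (\<integral>\<^sup>+p. ennreal (truncated_max s t p) \<partial>\<rho>)"
  using truncated_max_bounds integrable_truncated_max
  by (intro nn_integral_eq_integral[symmetric] AE_I2) (auto simp: space_eq)

text \<open>With the second threshold below the support only a marginal is left; compared with
  \<open>joint_cdf_minus_1\<close> this is the one-dimensional RDE for
  \<open>rho_Xi \<theta>\<close>.\<close>

lemma truncated_max_minus_1:
  assumes "s \<in> Xi \<theta>"
  shows "(\<integral>p. truncated_max s (-1) p \<partial>\<rho>) = (s / (1 + \<theta>))\<^sup>2" "(\<integral>p. truncated_max (-1) s p \<partial>\<rho>) = (s / (1 + \<theta>))\<^sup>2"
proof -
  let ?h = "\<lambda>y. if y \<le> ereal s then ennreal (real_of_ereal y ^ 1) else 0"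
  note [measurable] = measurable_I_borel_borel
  have h: "?h \<in> borel_measurable I_borel" by measurable
  have "(1 - \<theta>) / (1 + \<theta>) / (1 - \<theta> ^ 2) = 1 / (1 + \<theta>)\<^sup>2" if "\<theta> < 1"
  proof -
    have "1 - \<theta> ^ 2 = (1 - \<theta>) * (1 + \<theta>)" by (simp add: power2_eq_square algebra_simps)
    then show ?thesis using that \<theta> by (simp add: power2_eq_square)
  qed
  then have c: "(if \<theta> < 1 then (1 - \<theta>) / (1 + \<theta>) / (1 - \<theta> ^ Suc 1) else 1 / 2 / Suc 1) * s ^ Suc 1 = (s / (1 + \<theta>))\<^sup>2"
    using \<theta> by (auto simp: power_divide numeral_2_eq_2)
  note int = nn_integral_rho_Xi_power[OF \<theta> assms, of 1, unfolded c]
  have tm: "ennreal (truncated_max s (-1) p) = ?h (fst p)" "ennreal (truncated_max (-1) s p) = ?h (snd p)"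
    if "p \<in> I_set \<times> I_set" for p
    using that not_le_minus_1 by (auto simp: truncated_max_def max_def elim!: I_set_cases)
  have "ennreal (\<integral>p. truncated_max s (-1) p \<partial>\<rho>) = (\<integral>\<^sup>+p. ?h (fst p) \<partial>\<rho>)"
    unfolding integral_truncated_max_eq by (intro nn_integral_cong tm) (simp add: space_eq)
  then have 1: "ennreal (\<integral>p. truncated_max s (-1) p \<partial>\<rho>) = ennreal ((s / (1 + \<theta>))\<^sup>2)"
    unfolding nn_integral_marginals(1)[OF h] int .
  have "ennreal (\<integral>p. truncated_max (-1) s p \<partial>\<rho>) = (\<integral>\<^sup>+p. ?h (snd p) \<partial>\<rho>)"
    unfolding integral_truncated_max_eq by (intro nn_integral_cong tm) (simp add: space_eq)
  then have 2: "ennreal (\<integral>p. truncated_max (-1) s p \<partial>\<rho>) = ennreal ((s / (1 + \<theta>))\<^sup>2)"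
    unfolding nn_integral_marginals(2)[OF h] int .
  have "0 \<le> (\<integral>p. truncated_max s t p \<partial>\<rho>)" for s t
    using truncated_max_bounds by (intro integral_nonneg_AE AE_I2) (auto simp: space_eq)
  then show "(\<integral>p. truncated_max s (-1) p \<partial>\<rho>) = (s / (1 + \<theta>))\<^sup>2" "(\<integral>p. truncated_max (-1) s p \<partial>\<rho>) = (s / (1 + \<theta>))\<^sup>2"
    using 1 2 by (subst (asm) ennreal_inj; simp)+
qed

lemma minus_1_minus_1: "joint_cdf \<rho> (-1) (-1) = 0" "(\<integral>p. truncated_max (-1) (-1) p \<partial>\<rho>) = 0"
proof -
  have empty: "{p \<in> space \<rho>. fst p \<le> ereal (-1) \<or> snd p \<le> ereal (-1)} = {}"
    using not_le_minus_1 by (auto simp: space_eq)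
  show "joint_cdf \<rho> (-1) (-1) = 0" unfolding joint_cdf_def empty by simp
  have "(\<integral>p. truncated_max (-1) (-1) p \<partial>\<rho>) = (\<integral>p. 0 \<partial>\<rho>)"
    using not_le_minus_1
    by (intro Bochner_Integration.integral_cong) (auto simp: space_eq truncated_max_def)
  then show "(\<integral>p. truncated_max (-1) (-1) p \<partial>\<rho>) = 0" by simp
qed

end

lemma psi_Xi_inf:
  assumes "0 < \<theta>" "\<theta> \<le> 1" "s \<in> Xi \<theta>" "y \<in> Xi_inf \<theta>"
  shows "psi s y \<in> Xi_inf \<theta>"
proof (cases "y \<le> ereal s")
  case True
  then obtain t where t: "y = ereal t" "t \<in> Xi \<theta>" "t \<le> s" using assms by (auto simp: Xi_inf_def)
  then have "psi s y = ereal (t / s)" using True by (simp add: psi_def divide_inverse mult.commute)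
  then show ?thesis using Xi_divide[OF assms(3) t(2,3) assms(1,2)] by (simp add: Xi_inf_def)
qed (simp add: psi_def Xi_inf_def)

locale I2_Xi_symmetric = I2_Xi +
  assumes symmetric: "distr \<rho> I2_borel (\<lambda>(y1, y2). (y2, y1)) = \<rho>"
begin

lemma integral_swap:
  assumes "f \<in> borel_measurable I2_borel"
  shows "(\<integral>p. f (snd p, fst p) \<partial>\<rho>) = (\<integral>p. f p \<partial>\<rho> :: real)"
proof -
  have "(\<lambda>(y1, y2). (y2, y1)) \<in> measurable \<rho> I2_borel"
    using measurable_pair_swap'[of I_borel I_borel] sets_eq
    by (simp cong: measurable_cong_sets add: I2_borel_def)
  then have "(\<integral>p. f p \<partial>distr \<rho> I2_borel (\<lambda>(y1, y2). (y2, y1))) = (\<integral>p. f (case p of (y1, y2) \<Rightarrow> (y2, y1)) \<partial>\<rho>)"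
    using assms by (rule integral_distr)
  then show ?thesis unfolding symmetric by (simp add: case_prod_beta)
qed

lemma joint_cdf_commute: "joint_cdf \<rho> s t = joint_cdf \<rho> t s"
  unfolding joint_cdf_eq_integral
  by (subst integral_swap[symmetric]) (auto simp: disj_commute)

lemma truncated_max_commute: "(\<integral>p. truncated_max s t p \<partial>\<rho>) = (\<integral>p. truncated_max t s p \<partial>\<rho>)"
proof -
  have "truncated_max s t (snd p, fst p) = truncated_max t s p" for p
    by (simp add: truncated_max_def max.commute)
  then show ?thesis using integral_swap[of "truncated_max s t"] by simp
qed

text \<open>The form \<open>s * F (t / s)\<close> is homogeneity of degree one, which is invariance
  under \<open>Gamma2\<close>, and \<open>F 1 \<le> 1\<close> is the bound in \<open>M2\<close>.
  Symmetry, rounding and the known marginals handle all other thresholds, so the RDE remains to be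
  checked only with one threshold equal to 1.\<close>

lemma M2_theta_and_RDE_criterion:
  assumes F: "\<And>s t. s \<in> Xi \<theta> \<Longrightarrow> t \<in> Xi \<theta> \<Longrightarrow> t \<le> s \<Longrightarrow> joint_cdf \<rho> s t = s * F (t / s)"
    and F1: "F 1 \<le> 1"
    and RDE: "\<And>x. x \<in> Xi \<theta> \<Longrightarrow> (\<integral>p. truncated_max 1 x p \<partial>\<rho>) = (F x)\<^sup>2"
  shows "\<rho> \<in> M2_theta \<theta>" "solves_bivariate_RDE \<rho>"
proof -
  have bound: "measure \<rho> ({0..ereal t} \<times> I_set \<union> I_set \<times> {0..ereal t}) \<le> t" if t: "t \<in> {0..1}" for t
  proof -
    have "ereal t \<le> 1" using t by simp
    then have "{0..ereal t} \<subseteq> {0..1}" by (metis atLeastatMost_subset_iff order_refl)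
    then have "{0..ereal t} \<subseteq> I_set" unfolding I_set_def by blast
    then have "{0..ereal t} \<times> I_set \<union> I_set \<times> {0..ereal t} = {p \<in> space \<rho>. fst p \<le> ereal t \<or> snd p \<le> ereal t}"
      by (auto simp: space_eq I_set_def)
    then have "measure \<rho> ({0..ereal t} \<times> I_set \<union> I_set \<times> {0..ereal t}) = joint_cdf \<rho> t t"
      by (simp add: joint_cdf_def)
    moreover obtain t' where t': "t' = -1 \<or> t' \<in> Xi \<theta> \<and> t' \<le> t"
      "\<And>y. y \<in> Xi_inf \<theta> \<Longrightarrow> y \<le> ereal t \<longleftrightarrow> y \<le> ereal t'"
      using Xi_round[OF \<theta>] by metis
    then have "joint_cdf \<rho> t t = joint_cdf \<rho> t' t'" by (intro joint_cdf_cong) auto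
    moreover have "joint_cdf \<rho> t' t' \<le> t"
    proof (cases "t' = -1")
      case True
      then show ?thesis using minus_1_minus_1 t by simp
    next
      case False
      then have t'': "t' \<in> Xi \<theta>" "t' \<le> t" using t' by auto
      then have "joint_cdf \<rho> t' t' = t' * F 1" using F[of t' t'] Xi_bounds[OF \<theta>, of t'] by simp
      also have "\<dots> \<le> t' * 1" using F1 Xi_bounds[OF \<theta> t''(1)] by (intro mult_left_mono) auto
      finally show ?thesis using t'' by simp
    qed
    ultimately show ?thesis by simp
  qed
  then have M2: "\<rho> \<in> M2" using symmetric sets_eq prob_space_axioms by (auto simp: M2_def)
  have scale1: "joint_cdf \<rho> (s * a) (s * b) = s * joint_cdf \<rho> a b"
    if "s \<in> Xi \<theta>" "a \<in> Xi \<theta>" "b \<in> Xi \<theta>" "b \<le> a" for s a b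
  proof -
    have "0 < s" "0 < a" using Xi_bounds[OF \<theta>] that by auto
    then show ?thesis using F[of "s * a" "s * b"] F[of a b] Xi_mult that \<theta> by simp
  qed
  have scale2: "joint_cdf \<rho> (s * a) (s * (-1)) = s * joint_cdf \<rho> a (-1)"
    if "s \<in> Xi \<theta>" "a \<in> Xi \<theta>" for s a
  proof -
    have "joint_cdf \<rho> (s * a) (s * (-1)) = joint_cdf \<rho> (s * a) (-1)"
      using Xi_bounds[OF \<theta> that(1)] negative_cong by (intro joint_cdf_cong) auto
    then show ?thesis using joint_cdf_minus_1 that Xi_mult[OF that \<theta>] by simp
  qed
  have scale: "joint_cdf \<rho> (s * a) (s * b) = s * joint_cdf \<rho> a b"
    if s: "s \<in> Xi \<theta>" and ab: "a = -1 \<or> a \<in> Xi \<theta>" "b = -1 \<or> b \<in> Xi \<theta>" for s a b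
  proof -
    consider "a = -1" "b = -1" | "a = -1" "b \<in> Xi \<theta>" | "a \<in> Xi \<theta>" "b = -1"
      | "a \<in> Xi \<theta>" "b \<in> Xi \<theta>" "b \<le> a" | "a \<in> Xi \<theta>" "b \<in> Xi \<theta>" "a \<le> b" using ab by force
    then show ?thesis
    proof cases
      case 1
      have "joint_cdf \<rho> (s * (-1)) (s * (-1)) = joint_cdf \<rho> (-1) (-1)"
        using Xi_bounds[OF \<theta> s] negative_cong by (intro joint_cdf_cong) auto
      then show ?thesis using minus_1_minus_1 1 by simp
    qed (use scale1[OF s, of a b] scale1[OF s, of b a] scale2[OF s, of a] scale2[OF s, of b]
        joint_cdf_commute in metis)+
  qed
  have Gamma: "Gamma2 s \<rho> = \<rho>" if s: "s \<in> Xi \<theta>" for s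
  proof -
    have s0: "0 < s" using Xi_bounds[OF \<theta> s] by simp
    define D where "D = distr \<rho> I2_borel (psi2 s)"
    have sG: "sets (Gamma2 s \<rho>) = sets I2_borel"
      unfolding Gamma2_def using sets.sigma_sets_eq[of I2_borel] sets.space_closed[of I2_borel]
      by (subst sets_measure_of) auto
    have spG: "space (Gamma2 s \<rho>) = I_set \<times> I_set" using sets_eq_imp_space_eq[OF sG] by simp
    interpret D: prob_space D unfolding D_def by (rule prob_space_distr[OF psi2_measurable[OF s0]])
    have spD: "space D = I_set \<times> I_set" by (simp add: D_def)
    have "emeasure (Gamma2 s \<rho>) (space (Gamma2 s \<rho>)) = 1"
      unfolding spG using emeasure_Gamma2[OF M2 s0, of "I_set \<times> I_set"] sets.top[of I2_borel] D.prob_space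
      by (simp add: D_def[symmetric] spD)
    then interpret G: I2_prob "Gamma2 s \<rho>"
      unfolding I2_prob_def I2_prob_axioms_def using sG by (auto intro: prob_spaceI)
    show ?thesis
    proof (rule I2_prob_eqI[OF G.I2_prob_axioms I2_prob_axioms])
      fix a b
      obtain a' where a': "a' = -1 \<or> a' \<in> Xi \<theta> \<and> a' \<le> a" "\<And>y. y \<in> Xi_inf \<theta> \<Longrightarrow> y \<le> ereal a \<longleftrightarrow> y \<le> ereal a'"
        using Xi_round[OF \<theta>] by metis
      obtain b' where b': "b' = -1 \<or> b' \<in> Xi \<theta> \<and> b' \<le> b" "\<And>y. y \<in> Xi_inf \<theta> \<Longrightarrow> y \<le> ereal b \<longleftrightarrow> y \<le> ereal b'"
        using Xi_round[OF \<theta>] by metis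
      have le1: "a' \<le> 1" "b' \<le> 1" using a'(1) b'(1) Xi_bounds[OF \<theta>] by auto
      define X where "X = {p \<in> I_set \<times> I_set. fst p \<le> ereal a \<or> snd p \<le> ereal b}"
      have "{p \<in> space I2_borel. fst p \<le> ereal a \<or> snd p \<le> ereal b} \<in> sets I2_borel" by measurable
      then have X: "X \<in> sets I2_borel" unfolding X_def space_I2_borel .
      \<comment> \<open>\<open>X\<close> omits \<open>(\<infinity>, \<infinity>)\<close>, so the
        correction term of \<open>Gamma2\<close> drops out.\<close>
      have "emeasure (Gamma2 s \<rho>) X = ennreal (inverse s * measure D X)"
        using emeasure_Gamma2[OF M2 s0 X] by (simp add: D_def[symmetric] X_def)
      then have "joint_cdf (Gamma2 s \<rho>) a b = inverse s * measure D X"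
        using s0 by (auto simp: joint_cdf_def spG X_def[symmetric] intro!: measure_eq_emeasure_eq_ennreal)
      also have "measure D X = measure \<rho> (psi2 s -` X \<inter> space \<rho>)"
        unfolding D_def by (rule measure_distr[OF psi2_measurable[OF s0] X])
      also have "\<dots> = measure \<rho> {p \<in> space \<rho>. fst p \<le> ereal (s * a') \<or> snd p \<le> ereal (s * b')}"
      proof (rule finite_measure_eq_AE)
        show "AE p in \<rho>. p \<in> psi2 s -` X \<inter> space \<rho> \<longleftrightarrow> p \<in> {p \<in> space \<rho>. fst p \<le> ereal (s * a') \<or> snd p \<le> ereal (s * b')}"
          using AE_Xi AE_space
        proof eventually_elim
          case (elim p)
          then have I: "fst p \<in> I_set" "snd p \<in> I_set" by (auto simp: space_eq)
          have "psi s (fst p) \<le> ereal a \<longleftrightarrow> psi s (fst p) \<le> ereal a'"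
            "psi s (snd p) \<le> ereal b \<longleftrightarrow> psi s (snd p) \<le> ereal b'"
            using elim psi_Xi_inf[OF \<theta> s] a'(2) b'(2) by auto
          then show ?case
            using I elim(2) psi_in_I[OF s0] psi_le_iff[OF _ s0] le1
            by (auto simp: X_def psi2_def case_prod_beta)
        qed
      qed (use X in \<open>auto intro: measurable_sets[OF psi2_measurable[OF s0]]\<close>)
      also have "\<dots> = joint_cdf \<rho> (s * a') (s * b')" by (simp add: joint_cdf_def)
      also have "\<dots> = s * joint_cdf \<rho> a' b'" using a'(1) b'(1) by (intro scale s) auto
      also have "joint_cdf \<rho> a' b' = joint_cdf \<rho> a b"
        using a'(2) b'(2) by (intro joint_cdf_cong) auto
      finally show "joint_cdf (Gamma2 s \<rho>) a b = joint_cdf \<rho> a b" using s0 by simp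
    qed
  qed
  show "\<rho> \<in> M2_theta \<theta>" unfolding M2_theta_def using M2 Gamma marginals by simp
  have RDE1: "(joint_cdf \<rho> s t)\<^sup>2 = (\<integral>p. truncated_max s t p \<partial>\<rho>)"
    if st: "s \<in> Xi \<theta>" "t \<in> Xi \<theta>" "t \<le> s" for s t
  proof -
    have s0: "0 < s" using Xi_bounds[OF \<theta> st(1)] by simp
    have x: "t / s \<in> Xi \<theta>" using Xi_divide[OF st \<theta>] .
    have "(\<integral>p. truncated_max s t p \<partial>\<rho>) = (\<integral>p. truncated_max (s * 1) (s * (t / s)) p \<partial>\<rho>)" using s0 by simp
    also have "\<dots> = s\<^sup>2 * (F (t / s))\<^sup>2"
      using Xi_bounds[OF \<theta> x] RDE[OF x]
      by (subst integral_truncated_max_scale[OF M2 s0 Gamma[OF st(1)]]) auto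
    finally show ?thesis unfolding F[OF st] by (simp add: power_mult_distrib)
  qed
  have RDE2: "(joint_cdf \<rho> s t)\<^sup>2 = (\<integral>p. truncated_max s t p \<partial>\<rho>)"
    if st: "s = -1 \<or> s \<in> Xi \<theta>" "t = -1 \<or> t \<in> Xi \<theta>" for s t
  proof -
    consider "s = -1" "t = -1" | "s = -1" "t \<in> Xi \<theta>" | "s \<in> Xi \<theta>" "t = -1"
      | "s \<in> Xi \<theta>" "t \<in> Xi \<theta>" "t \<le> s" | "s \<in> Xi \<theta>" "t \<in> Xi \<theta>" "s \<le> t" using st by force
    then show ?thesis
    proof cases
      case 1 then show ?thesis using minus_1_minus_1 by simp
    next
      case 2 then show ?thesis using joint_cdf_minus_1 truncated_max_minus_1 by simp
    next
      case 3 then show ?thesis using joint_cdf_minus_1 truncated_max_minus_1 by simp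
    next
      case 4 then show ?thesis by (rule RDE1)
    next
      case 5 then show ?thesis
        using RDE1[of t s] joint_cdf_commute[of s t] truncated_max_commute[of s t] by simp
    qed
  qed
  show "solves_bivariate_RDE \<rho>"
    unfolding solves_bivariate_RDE_iff
  proof (intro allI)
    fix s t
    obtain s' where s': "s' = -1 \<or> s' \<in> Xi \<theta> \<and> s' \<le> s" "\<And>y. y \<in> Xi_inf \<theta> \<Longrightarrow> y \<le> ereal s \<longleftrightarrow> y \<le> ereal s'"
      using Xi_round[OF \<theta>] by metis
    obtain t' where t': "t' = -1 \<or> t' \<in> Xi \<theta> \<and> t' \<le> t" "\<And>y. y \<in> Xi_inf \<theta> \<Longrightarrow> y \<le> ereal t \<longleftrightarrow> y \<le> ereal t'"
      using Xi_round[OF \<theta>] by metis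
    have "joint_cdf \<rho> s t = joint_cdf \<rho> s' t'" using s'(2) t'(2) by (intro joint_cdf_cong) auto
    moreover have "(\<integral>p. truncated_max s t p \<partial>\<rho>) = (\<integral>p. truncated_max s' t' p \<partial>\<rho>)"
      using s'(2) t'(2) by (intro truncated_max_cong) auto
    ultimately show "(joint_cdf \<rho> s t)\<^sup>2 = (\<integral>p. truncated_max s t p \<partial>\<rho>)"
      using RDE2[of s' t'] s'(1) t'(1) by auto
  qed
qed

end

section \<open>The diagonal solution and uniqueness\<close>

context I2_prob
begin

lemma joint_cdf_mono:
  assumes "s \<le> s'" "t \<le> t'"
  shows "joint_cdf \<rho> s t \<le> joint_cdf \<rho> s' t'"
  unfolding joint_cdf_def
proof (rule finite_measure_mono)
  have "ereal s \<le> ereal s'" "ereal t \<le> ereal t'" using assms by auto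
  then show "{p \<in> space \<rho>. fst p \<le> ereal s \<or> snd p \<le> ereal t} \<subseteq> {p \<in> space \<rho>. fst p \<le> ereal s' \<or> snd p \<le> ereal t'}"
    by (blast intro: order_trans)
qed measurable

end

text \<open>For \<open>t \<le> s\<close> the distribution function lies between its marginal value
  and its value at \<open>(s, s)\<close>. When these agree it is determined everywhere, so the law
  must be the diagonal one.\<close>

lemma I2_Xi_symmetric_eqI:
  assumes "I2_Xi_symmetric \<rho> \<theta>" "I2_Xi_symmetric \<rho>' \<theta>"
    and "\<And>s. s \<in> Xi \<theta> \<Longrightarrow> joint_cdf \<rho> s s = s / (1 + \<theta>)"
    and "\<And>s. s \<in> Xi \<theta> \<Longrightarrow> joint_cdf \<rho>' s s = s / (1 + \<theta>)"
  shows "\<rho> = \<rho>'"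
proof -
  have val: "joint_cdf \<rho> s t = (if s = -1 then 0 else s / (1 + \<theta>))"
    if "I2_Xi_symmetric \<rho> \<theta>" "\<And>s. s \<in> Xi \<theta> \<Longrightarrow> joint_cdf \<rho> s s = s / (1 + \<theta>)"
      "s = -1 \<or> s \<in> Xi \<theta>" "t = -1 \<or> t \<in> Xi \<theta>" "t \<le> s" for \<rho> s t
  proof -
    interpret I2_Xi_symmetric \<rho> \<theta> by fact
    show ?thesis
    proof (cases "s = -1")
      case True
      then have "t = -1" using that Xi_bounds[OF \<theta>] by force
      then show ?thesis using True minus_1_minus_1 by simp
    next
      case False
      then have s: "s \<in> Xi \<theta>" using that by simp
      have "-1 \<le> t" using that(4) Xi_bounds[OF \<theta>] by force
      then have "joint_cdf \<rho> s (-1) \<le> joint_cdf \<rho> s t" "joint_cdf \<rho> s t \<le> joint_cdf \<rho> s s"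
        using that(5) by (auto intro: joint_cdf_mono)
      then show ?thesis using joint_cdf_minus_1[OF s] that(2)[OF s] False by simp
    qed
  qed
  interpret A: I2_Xi_symmetric \<rho> \<theta> by fact
  interpret B: I2_Xi_symmetric \<rho>' \<theta> by fact
  show ?thesis
  proof (rule I2_prob_eqI[OF A.I2_prob_axioms B.I2_prob_axioms])
    fix s t
    obtain s' where s': "s' = -1 \<or> s' \<in> Xi \<theta> \<and> s' \<le> s" "\<And>y. y \<in> Xi_inf \<theta> \<Longrightarrow> y \<le> ereal s \<longleftrightarrow> y \<le> ereal s'"
      using Xi_round[OF A.\<theta>] by metis
    obtain t' where t': "t' = -1 \<or> t' \<in> Xi \<theta> \<and> t' \<le> t" "\<And>y. y \<in> Xi_inf \<theta> \<Longrightarrow> y \<le> ereal t \<longleftrightarrow> y \<le> ereal t'"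
      using Xi_round[OF A.\<theta>] by metis
    have "joint_cdf \<rho> s t = joint_cdf \<rho> s' t'" "joint_cdf \<rho>' s t = joint_cdf \<rho>' s' t'"
      using s'(2) t'(2) by (auto intro!: A.joint_cdf_cong B.joint_cdf_cong)
    moreover have "joint_cdf \<rho> s' t' = joint_cdf \<rho>' s' t'"
    proof (cases "t' \<le> s'")
      case True
      then show ?thesis
        using val[OF assms(1,3), of s' t'] val[OF assms(2,4), of s' t'] s'(1) t'(1) by auto
    next
      case False
      then show ?thesis
        using val[OF assms(1,3), of t' s'] val[OF assms(2,4), of t' s'] s'(1) t'(1)
          A.joint_cdf_commute[of s' t'] B.joint_cdf_commute[of s' t'] by auto
    qed
    ultimately show "joint_cdf \<rho> s t = joint_cdf \<rho>' s t" by simp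
  qed
qed

lemma I2_Xi_symmetric_if_M2_theta:
  assumes "\<rho> \<in> M2_theta \<theta>" "0 < \<theta>" "\<theta> \<le> 1"
  shows "I2_Xi_symmetric \<rho> \<theta>"
proof -
  interpret I2_prob \<rho> using assms by (auto simp: M2_theta_def intro: I2_prob_if_M2)
  show ?thesis by unfold_locales (use assms in \<open>auto simp: M2_theta_def M2_def\<close>)
qed

context
  fixes \<theta> :: real
  assumes \<theta>: "0 < \<theta>" "\<theta> \<le> 1"
begin

lemma measurable_diagonal: "(\<lambda>y. (y, y)) \<in> measurable (rho_Xi \<theta>) I2_borel"
  unfolding I2_borel_def by (intro measurable_Pair) (auto cong: measurable_cong_sets)

lemma AE_rho_bar: "AE p in rho_bar \<theta>. fst p = snd p"
  unfolding rho_bar_def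
proof (subst AE_distr_iff[OF measurable_diagonal])
  show "{p \<in> space I2_borel. fst p = snd p} \<in> sets I2_borel" by measurable
qed simp

lemma I2_Xi_symmetric_rho_bar: "I2_Xi_symmetric (rho_bar \<theta>) \<theta>"
proof -
  interpret X: prob_space "rho_Xi \<theta>" by (rule prob_space_rho_Xi[OF \<theta>])
  interpret prob_space "rho_bar \<theta>"
    unfolding rho_bar_def by (rule X.prob_space_distr[OF measurable_diagonal])
  have id: "distr (rho_Xi \<theta>) I_borel (\<lambda>y. y) = rho_Xi \<theta>" by (rule distr_id2) simp
  have swap: "(\<lambda>(y1, y2). (y2, y1)) \<in> measurable I2_borel I2_borel"
    unfolding I2_borel_def by (rule measurable_pair_swap')
  show ?thesis
  proof unfold_locales
    show "distr (rho_bar \<theta>) I_borel fst = rho_Xi \<theta>"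
      unfolding rho_bar_def by (subst distr_distr[OF measurable_I2_fst_I measurable_diagonal]) (simp add: comp_def id)
    show "distr (rho_bar \<theta>) I_borel snd = rho_Xi \<theta>"
      unfolding rho_bar_def by (subst distr_distr[OF measurable_I2_snd_I measurable_diagonal]) (simp add: comp_def id)
    show "distr (rho_bar \<theta>) I2_borel (\<lambda>(y1, y2). (y2, y1)) = rho_bar \<theta>"
      unfolding rho_bar_def by (subst distr_distr[OF swap measurable_diagonal]) (simp add: comp_def)
  qed (use \<theta> in \<open>auto simp: rho_bar_def\<close>)
qed

lemma joint_cdf_rho_bar:
  assumes "s \<in> Xi \<theta>" "t \<le> s"
  shows "joint_cdf (rho_bar \<theta>) s t = s / (1 + \<theta>)"
proof -
  interpret I2_Xi_symmetric "rho_bar \<theta>" \<theta> by (rule I2_Xi_symmetric_rho_bar)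
  have "joint_cdf (rho_bar \<theta>) s t = joint_cdf (rho_bar \<theta>) s (-1)"
    unfolding joint_cdf_eq_integral
  proof (rule integral_cong_AE)
    show "AE p in rho_bar \<theta>. (of_bool (fst p \<le> ereal s \<or> snd p \<le> ereal t) :: real)
        = of_bool (fst p \<le> ereal s \<or> snd p \<le> ereal (- 1))"
      using AE_rho_bar AE_space
    proof eventually_elim
      case (elim p)
      have "fst p \<le> ereal s" if "fst p \<le> ereal t" using that assms(2) by (auto intro: order_trans)
      then show ?case using elim not_le_minus_1 by (auto simp: space_eq)
    qed
  qed auto
  then show ?thesis using joint_cdf_minus_1[OF assms(1)] by simp
qed

text \<open>On the diagonal the second threshold \<open>x \<le> 1\<close> adds nothing to the
  threshold 1, and the RDE reduces to the marginal one.\<close>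

lemma rho_bar_solves: "rho_bar \<theta> \<in> M2_theta \<theta>" "solves_bivariate_RDE (rho_bar \<theta>)"
proof -
  interpret I2_Xi_symmetric "rho_bar \<theta>" \<theta> by (rule I2_Xi_symmetric_rho_bar)
  have F: "joint_cdf (rho_bar \<theta>) s t = s * (1 / (1 + \<theta>))" if "s \<in> Xi \<theta>" "t \<in> Xi \<theta>" "t \<le> s" for s t
    using joint_cdf_rho_bar that by simp
  have R: "(\<integral>p. truncated_max 1 x p \<partial>rho_bar \<theta>) = (1 / (1 + \<theta>))\<^sup>2" if x: "x \<in> Xi \<theta>" for x
  proof -
    have "(\<integral>p. truncated_max 1 x p \<partial>rho_bar \<theta>) = (\<integral>p. truncated_max 1 (-1) p \<partial>rho_bar \<theta>)"
    proof (rule integral_cong_AE)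
      show "AE p in rho_bar \<theta>. truncated_max 1 x p = truncated_max 1 (-1) p"
        using AE_rho_bar AE_space
      proof eventually_elim
        case (elim p)
        then have "fst p \<in> I_set" by (auto simp: space_eq)
        then show ?case
        proof (cases rule: I_set_cases)
          case (1 r)
          moreover from this have "snd p = ereal r" using elim by simp
          ultimately show ?thesis using Xi_bounds[OF \<theta> x] by (simp add: truncated_max_def)
        next
          case 2
          moreover from this have "snd p = \<infinity>" using elim by simp
          ultimately show ?thesis by (simp add: truncated_max_def)
        qed
      qed
    qed auto
    then show ?thesis using truncated_max_minus_1(1)[OF one_in_Xi] by simp
  qed
  have "1 / (1 + \<theta>) \<le> 1" using \<theta> by simp
  from M2_theta_and_RDE_criterion[of "\<lambda>_. 1 / (1 + \<theta>)", OF F this R]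
  show "rho_bar \<theta> \<in> M2_theta \<theta>" "solves_bivariate_RDE (rho_bar \<theta>)" by auto
qed

end

section \<open>From the RDE to the recursion\<close>

text \<open>The contribution \<open>(Y' - Y)\<^sup>+\<close> of the event \<open>Y' = 1\<close>; scaling moves it to \<open>Y' = \<theta> ^ j\<close>.\<close>
definition top_excess :: "ereal \<times> ereal \<Rightarrow> real" where
  "top_excess p = (if snd p = 1 \<and> fst p \<le> 1 then 1 - real_of_ereal (fst p) else 0)"

lemma measurable_top_excess [measurable]: "top_excess \<in> borel_measurable I2_borel"
  unfolding top_excess_def by measurable

lemma top_excess_bounds: "p \<in> I_set \<times> I_set \<Longrightarrow> 0 \<le> top_excess p" "p \<in> I_set \<times> I_set \<Longrightarrow> top_excess p \<le> 1"
  by (auto simp: top_excess_def one_ereal_def elim!: I_set_cases)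

lemma Xi_le_step:
  assumes "0 < \<theta>" "\<theta> < 1" "x \<in> Xi \<theta>"
  shows "x \<le> \<theta> ^ Suc j \<longleftrightarrow> x < \<theta> ^ j"
proof -
  obtain k where "x = \<theta> ^ k" using assms by (auto simp: Xi_def)
  then show ?thesis
    using power_decreasing_iff[OF assms(1,2), of k "Suc j"] power_decreasing_iff[OF assms(1,2), of j k]
    by (auto simp: not_le[symmetric] simp del: power_Suc)
qed

text \<open>Only the event \<open>Y' = \<theta> ^ j\<close> matters. There the maximum drops by
  \<open>\<theta> ^ j\<close> if \<open>Y\<close> is infinite, by \<open>\<theta> ^ j - Y\<close> if
  \<open>Y \<le> \<theta> ^ j\<close>, and not at all otherwise; the two summands record the first
  two cases.\<close>

lemma truncated_max_diff:
  assumes \<theta>: "0 < \<theta>" "\<theta> < 1" and p: "fst p \<in> Xi_inf \<theta>" "snd p \<in> Xi_inf \<theta>"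
  shows "truncated_max 1 (\<theta> ^ j) p - truncated_max 1 (\<theta> ^ Suc j) p
    = \<theta> ^ j * (of_bool (fst p \<le> ereal 1 \<or> snd p \<le> ereal (\<theta> ^ j)) - of_bool (fst p \<le> ereal 1 \<or> snd p \<le> ereal (\<theta> ^ Suc j)))
      + \<theta> ^ j * top_excess (psi2 (\<theta> ^ j) p)"
proof -
  have t: "0 < \<theta> ^ j" using \<theta> by simp
  have step: "y \<le> \<theta> ^ Suc j \<longleftrightarrow> y < \<theta> ^ j" if "ereal y = snd p" for y
    using that p Xi_le_step[OF \<theta>, of y j] by (auto simp: Xi_inf_def)
  have bounds: "0 < x" "x \<le> 1" if "ereal x \<in> Xi_inf \<theta>" for x
    using that \<theta> Xi_bounds[of \<theta> x] by (auto simp: Xi_inf_def)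
  consider "snd p = \<infinity>" | y where "snd p = ereal y" "y < \<theta> ^ j" | y where "snd p = ereal y" "\<theta> ^ j < y"
    | "snd p = ereal (\<theta> ^ j)" "fst p = \<infinity>" | x where "snd p = ereal (\<theta> ^ j)" "fst p = ereal x" "x \<le> \<theta> ^ j"
    | x where "snd p = ereal (\<theta> ^ j)" "fst p = ereal x" "\<theta> ^ j < x"
    using p unfolding Xi_inf_def by (auto, (metis linorder_less_linear linorder_not_le)+)
  then show ?thesis
  proof cases
    case 1
    then show ?thesis by (simp add: truncated_max_def top_excess_def psi2_def psi_def case_prod_beta)
  next
    case (2 y)
    then have "inverse (\<theta> ^ j) * y \<noteq> 1" using t by (auto simp: field_simps)
    then show ?thesis using 2 step[of y]
      by (simp add: truncated_max_def top_excess_def psi2_def psi_def case_prod_beta one_ereal_def del: power_Suc)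
  next
    case (3 y)
    then show ?thesis using step[of y]
      by (simp add: truncated_max_def top_excess_def psi2_def psi_def case_prod_beta del: power_Suc)
  next
    case 4
    then show ?thesis using t step[of "\<theta> ^ j"]
      by (simp add: truncated_max_def top_excess_def psi2_def psi_def case_prod_beta del: power_Suc)
  next
    case (5 x)
    then have "0 < x" "x \<le> 1" using bounds p by auto
    moreover have "inverse (\<theta> ^ j) * x \<le> 1" using 5 t by (simp add: field_simps)
    moreover have "inverse (\<theta> ^ j) * \<theta> ^ j = 1" "\<theta> ^ j * inverse (\<theta> ^ j) = 1"
      using \<theta> by (simp_all add: left_inverse right_inverse)
    ultimately show ?thesis using 5 t step[of "\<theta> ^ j"]
      by (simp add: truncated_max_def top_excess_def psi2_def psi_def case_prod_beta one_ereal_def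
          right_diff_distrib del: power_Suc)
  next
    case (6 x)
    then have "0 < x" "x \<le> 1" using bounds p by auto
    then show ?thesis using 6 t step[of "\<theta> ^ j"]
      by (simp add: truncated_max_def top_excess_def psi2_def psi_def case_prod_beta del: power_Suc)
  qed
qed

text \<open>Only pairs with a coordinate equal to 1 contribute. If the other one is at most
  \<theta>, the drop is an excess; otherwise it is 1 and the pair leaves the event in the
  bracket.\<close>

lemma truncated_max_diagonal_diff:
  assumes \<theta>: "0 < \<theta>" "\<theta> < 1" and p: "fst p \<in> Xi_inf \<theta>" "snd p \<in> Xi_inf \<theta>"
  shows "truncated_max 1 1 p - truncated_max \<theta> \<theta> p = top_excess p + top_excess (snd p, fst p)
    + (of_bool (fst p \<le> ereal 1 \<or> snd p \<le> ereal 1) - of_bool (fst p \<le> ereal \<theta> \<or> snd p \<le> ereal \<theta>))"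
proof -
  have split: "y = \<infinity> \<or> y = ereal 1 \<or> (\<exists>r. y = ereal r \<and> 0 < r \<and> r \<le> \<theta>)" if y: "y \<in> Xi_inf \<theta>" for y
  proof (cases "y = \<infinity>")
    case False
    then obtain r where r: "y = ereal r" "r \<in> Xi \<theta>" using y by (auto simp: Xi_inf_def)
    then have "r \<le> \<theta> \<longleftrightarrow> r < 1" "0 < r" "r \<le> 1"
      using Xi_le_step[OF \<theta> r(2), of 0] Xi_bounds[of \<theta> r] \<theta> by auto
    then show ?thesis using r by auto
  qed simp
  obtain x y where xy: "p = (x, y)" by (cases p)
  from split[OF p(1)] split[OF p(2)] show ?thesis
    using \<theta> unfolding xy fst_conv snd_conv
    by (elim disjE exE conjE) (simp_all add: truncated_max_def top_excess_def one_ereal_def)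
qed

context I2_Xi_symmetric
begin

text \<open>Differencing the RDE in the second threshold gives \<open>(f j)\<^sup>2 - (f (Suc
  j))\<^sup>2 = \<theta> ^ j * (f j - f (Suc j)) + (\<theta>\<^sup>2) ^ j * C\<close>. Scale
  invariance makes \<open>C\<close>, the mean of \<open>top_excess\<close>, independent of
  \<open>j\<close>.\<close>

lemma RDE_recursion:
  assumes lt: "\<theta> < 1" and M: "\<rho> \<in> M2_theta \<theta>" and R: "solves_bivariate_RDE \<rho>"
  defines "f \<equiv> \<lambda>j. joint_cdf \<rho> 1 (\<theta> ^ j)"
  shows "(f j - f (Suc j)) * (f j + f (Suc j) - \<theta> ^ j) = (1 - \<theta>\<^sup>2) * f 0 * (f 0 - 1 / (1 + \<theta>)) / 2 * (\<theta>\<^sup>2) ^ j"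
proof -
  have M2: "\<rho> \<in> M2" and Gamma: "Gamma2 s \<rho> = \<rho>" if "s \<in> Xi \<theta>" for s using M that by (auto simp: M2_theta_def)
  have M2: "\<rho> \<in> M2" using M by (simp add: M2_theta_def)
  have pow: "\<theta> ^ j \<in> Xi \<theta>" "0 < \<theta> ^ j" for j using lt \<theta> by (auto simp: Xi_def)
  have th: "\<theta> \<in> Xi \<theta>" using pow(1)[of 1] by simp
  have RDE: "(joint_cdf \<rho> s t)\<^sup>2 = (\<integral>p. truncated_max s t p \<partial>\<rho>)" for s t
    using R solves_bivariate_RDE_iff by blast
  define C where "C = (\<integral>p. top_excess p \<partial>\<rho>)"
  have intt: "integrable \<rho> (truncated_max s t)" for s t by (rule integrable_truncated_max)
  have inte: "integrable \<rho> top_excess"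
    using top_excess_bounds by (intro integrable_const_bound[of _ 1] AE_I2) (auto simp: space_eq)
  have intb: "integrable \<rho> (\<lambda>p. of_bool (fst p \<le> ereal s \<or> snd p \<le> ereal t) :: real)" for s t
    by (intro integrable_const_bound[of _ 1] AE_I2) (auto simp: of_bool_def)
  have diff: "(f j - f (Suc j)) * (f j + f (Suc j) - \<theta> ^ j) = (\<theta>\<^sup>2) ^ j * C" for j
  proof -
    have psiI: "psi2 (\<theta> ^ j) p \<in> I_set \<times> I_set" if "p \<in> I_set \<times> I_set" for p
      using that psi_in_I[OF pow(2)] by (auto simp: psi2_def)
    have m [measurable]: "(\<lambda>p. top_excess (psi2 (\<theta> ^ j) p)) \<in> borel_measurable \<rho>"
      using pow(2)[of j] by measurable
    have intp: "integrable \<rho> (\<lambda>p. top_excess (psi2 (\<theta> ^ j) p))"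
      using top_excess_bounds psiI by (intro integrable_const_bound[of _ 1] AE_I2) (auto simp: space_eq)
    let ?A = "\<lambda>p. \<theta> ^ j * (of_bool (fst p \<le> ereal 1 \<or> snd p \<le> ereal (\<theta> ^ j))
        - of_bool (fst p \<le> ereal 1 \<or> snd p \<le> ereal (\<theta> ^ Suc j)))
      + \<theta> ^ j * top_excess (psi2 (\<theta> ^ j) p)"
    have "(f j)\<^sup>2 - (f (Suc j))\<^sup>2 = (\<integral>p. truncated_max 1 (\<theta> ^ j) p - truncated_max 1 (\<theta> ^ Suc j) p \<partial>\<rho>)"
      unfolding f_def RDE using intt by (simp del: power_Suc)
    also have "\<dots> = (\<integral>p. ?A p \<partial>\<rho>)"
    proof (rule integral_cong_AE)
      show "AE p in \<rho>. truncated_max 1 (\<theta> ^ j) p - truncated_max 1 (\<theta> ^ Suc j) p = ?A p"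
        using AE_Xi by eventually_elim (rule truncated_max_diff[OF \<theta>(1) lt], auto)
    qed measurable
    also have "\<dots> = \<theta> ^ j * (f j - f (Suc j)) + \<theta> ^ j * (\<integral>p. top_excess (psi2 (\<theta> ^ j) p) \<partial>\<rho>)"
      unfolding f_def joint_cdf_eq_integral using intb intp by (simp del: power_Suc)
    also have "(\<integral>p. top_excess (psi2 (\<theta> ^ j) p) \<partial>\<rho>) = \<theta> ^ j * C"
      unfolding C_def
      by (rule integral_psi2[OF M2 pow(2) Gamma[OF pow(1)]]) (auto simp: top_excess_def[of "(\<infinity>, \<infinity>)"] top_excess_bounds)
    finally show ?thesis by (simp add: power2_eq_square power_mult_distrib algebra_simps)
  qed
  let ?B = "\<lambda>p. top_excess p + top_excess (snd p, fst p) + (of_bool (fst p \<le> ereal 1 \<or> snd p \<le> ereal 1)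
    - of_bool (fst p \<le> ereal \<theta> \<or> snd p \<le> ereal \<theta>))"
  \<comment> \<open>Differencing along the diagonal instead determines \<open>C\<close> in terms of
    \<open>f 0\<close>; by symmetry the excess occurs twice.\<close>
  have "(f 0)\<^sup>2 - \<theta>\<^sup>2 * (f 0)\<^sup>2 = (\<integral>p. truncated_max 1 1 p - truncated_max \<theta> \<theta> p \<partial>\<rho>)"
    using integral_truncated_max_scale[OF M2 \<theta>(1) Gamma[OF th], of 1 1] RDE[of 1 1] intt
    by (simp add: f_def)
  also have "\<dots> = (\<integral>p. ?B p \<partial>\<rho>)"
  proof (rule integral_cong_AE)
    show "AE p in \<rho>. truncated_max 1 1 p - truncated_max \<theta> \<theta> p = ?B p"
      using AE_Xi by eventually_elim (rule truncated_max_diagonal_diff[OF \<theta>(1) lt], auto)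
    show "?B \<in> borel_measurable \<rho>"
      unfolding top_excess_def by measurable
  qed measurable
  also have "\<dots> = (\<integral>p. top_excess p \<partial>\<rho>) + (\<integral>p. top_excess (snd p, fst p) \<partial>\<rho>) + (joint_cdf \<rho> 1 1 - joint_cdf \<rho> \<theta> \<theta>)"
  proof -
    have "(\<lambda>p. top_excess (snd p, fst p)) \<in> borel_measurable \<rho>" unfolding top_excess_def by measurable
    then have "integrable \<rho> (\<lambda>p. top_excess (snd p, fst p))"
      using top_excess_bounds by (intro integrable_const_bound[of _ 1] AE_I2) (auto simp: space_eq)
    then show ?thesis unfolding joint_cdf_eq_integral using inte intb by simp
  qed
  also have "\<dots> = C + C + (f 0 - \<theta> * f 0)"
    using joint_cdf_scale[OF M2 \<theta>(1) Gamma[OF th], of 1 1]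
    by (simp add: C_def f_def integral_swap)
  finally have "C = ((1 - \<theta>\<^sup>2) * (f 0)\<^sup>2 - (1 - \<theta>) * f 0) / 2" by (simp add: algebra_simps)
  also have "\<dots> = (1 - \<theta>\<^sup>2) * f 0 * (f 0 - 1 / (1 + \<theta>)) / 2"
  proof -
    have 1: "1 - \<theta> = (1 - \<theta>\<^sup>2) * (1 / (1 + \<theta>))" using \<theta> by (simp add: field_simps power2_eq_square)
    have 2: "(A * x\<^sup>2 - A * q * x) / 2 = A * x * (x - q) / 2" for A q x :: real
      by (simp add: power2_eq_square algebra_simps)
    show ?thesis by (subst 1) (rule 2)
  qed
  finally show ?thesis unfolding diff by (simp add: mult.commute)
qed

lemma RDE_solution_unique:
  assumes lt: "\<theta> < 1" and M: "\<rho> \<in> M2_theta \<theta>" and R: "solves_bivariate_RDE \<rho>" and g: "0 \<le> g \<theta>"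
  shows "\<rho> = rho_bar \<theta>"
proof -
  define c where "c = 1 / (1 + \<theta>)"
  define f where "f j = joint_cdf \<rho> 1 (\<theta> ^ j)" for j
  define e where "e j = f j - c" for j
  have M2: "\<rho> \<in> M2" using M by (simp add: M2_theta_def)
  have pow: "\<theta> ^ j \<in> Xi \<theta>" "0 < \<theta> ^ j" for j using lt \<theta> by (auto simp: Xi_def)
  have marg1: "joint_cdf \<rho> 1 (-1) = c" using joint_cdf_minus_1(1)[OF one_in_Xi] by (simp add: c_def)
  have e_nonneg: "0 \<le> e j" for j
    using joint_cdf_mono[of 1 1 "-1" "\<theta> ^ j"] pow(2)[of j] marg1 by (simp add: e_def f_def)
  have dec: "decseq e"
    unfolding decseq_Suc_iff e_def f_def
    using \<theta> by (auto intro!: joint_cdf_mono power_decreasing simp del: power_Suc)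
  \<comment> \<open>The excess is at most the marginal probability of the second event, by
    subadditivity; this forces the limit 0.\<close>
  have le: "e j \<le> \<theta> ^ j / (1 + \<theta>)" for j
  proof -
    have "f j \<le> joint_cdf \<rho> 1 (-1) + joint_cdf \<rho> (-1) (\<theta> ^ j)"
      unfolding f_def joint_cdf_eq_integral
      by (subst Bochner_Integration.integral_add[symmetric])
        (auto intro!: integral_mono integrable_const_bound[of _ 1] AE_I2 Bochner_Integration.integrable_add simp: of_bool_def)
    then show ?thesis using marg1 joint_cdf_minus_1(2)[OF pow(1), of j] by (simp add: e_def)
  qed
  have "(\<lambda>j. \<theta> ^ j / (1 + \<theta>)) \<longlonglongrightarrow> 0 / (1 + \<theta>)"
    using \<theta> lt by (intro tendsto_divide tendsto_const LIMSEQ_power_zero) auto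
  then have lim: "e \<longlonglongrightarrow> 0"
    using e_nonneg le tendsto_sandwich[of "\<lambda>_. 0" e sequentially "\<lambda>j. \<theta> ^ j / (1 + \<theta>)" 0] by simp
  have rec: "(e j - e (Suc j)) * (2 / (1 + \<theta>) - \<theta> ^ j + e j + e (Suc j))
      = (1 - \<theta>\<^sup>2) * (1 / (1 + \<theta>) + e 0) * e 0 / 2 * (\<theta>\<^sup>2) ^ j" for j
  proof -
    have "2 / (1 + \<theta>) - \<theta> ^ j + e j + e (Suc j) = f j + f (Suc j) - \<theta> ^ j" by (simp add: e_def c_def)
    moreover have "e j - e (Suc j) = f j - f (Suc j)" by (simp add: e_def)
    moreover have "1 / (1 + \<theta>) + e 0 = f 0" "e 0 = f 0 - 1 / (1 + \<theta>)" by (simp_all add: e_def c_def)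
    ultimately show ?thesis using RDE_recursion[OF lt M R, of j] by (simp only: f_def)
  qed
  have "e 0 = 0"
  proof (rule ccontr)
    assume "e 0 \<noteq> 0"
    then have "0 < e 0" using e_nonneg[of 0] by simp
    from g_neg_if_nontrivial_recursion[OF \<theta>(1) lt e_nonneg dec lim this rec] g show False by simp
  qed
  then have f0: "joint_cdf \<rho> 1 1 = 1 / (1 + \<theta>)" by (simp add: e_def f_def c_def)
  show ?thesis
  proof (rule I2_Xi_symmetric_eqI[OF I2_Xi_symmetric_axioms I2_Xi_symmetric_rho_bar[OF \<theta>]])
    fix s assume s: "s \<in> Xi \<theta>"
    then have "Gamma2 s \<rho> = \<rho>" "0 < s" using M Xi_bounds[OF \<theta>] by (auto simp: M2_theta_def)
    then show "joint_cdf \<rho> s s = s / (1 + \<theta>)"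
      using joint_cdf_scale[OF M2, of s 1 1] f0 by simp
    show "joint_cdf (rho_bar \<theta>) s s = s / (1 + \<theta>)" using joint_cdf_rho_bar[OF \<theta> s] by simp
  qed
qed

end

section \<open>Scale-invariant densities\<close>

text \<open>
  A joint law with density \<open>D\<close> against \<open>rho_Xi \<theta> \<Otimes> rho_Xi \<theta>\<close>. Here \<open>q (y / s)\<close> is the conditional
  probability of \<open>Y > s\<close> given \<open>Y' = y \<le> s\<close>, and \<open>\<kappa> * y\<close> the conditional mean of \<open>(y - Y)\<^sup>+\<close>.
\<close>
locale scale_invariant_density =
  fixes \<theta> :: real and D :: "ereal \<Rightarrow> ereal \<Rightarrow> ennreal" and q F :: "real \<Rightarrow> real" and \<kappa> :: real
  assumes \<theta>: "0 < \<theta>" "\<theta> \<le> 1"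
    and D_measurable: "(\<lambda>p. D (fst p) (snd p)) \<in> borel_measurable I2_borel"
    and D_symmetric: "D u v = D v u"
    and D_total: "v \<in> Xi_inf \<theta> \<Longrightarrow> (\<integral>\<^sup>+y'. D y' v \<partial>rho_Xi \<theta>) = 1"
    and D_tail: "s \<in> Xi \<theta> \<Longrightarrow> y \<in> Xi \<theta> \<Longrightarrow> y \<le> s \<Longrightarrow>
      (\<integral>\<^sup>+y'. (if ereal s < y' then D y' (ereal y) else 0) \<partial>rho_Xi \<theta>) = ennreal (q (y / s))"
    and D_excess: "y \<in> Xi \<theta> \<Longrightarrow>
      (\<integral>\<^sup>+y'. (if y' \<le> ereal y then ennreal (y - real_of_ereal y') * D y' (ereal y) else 0) \<partial>rho_Xi \<theta>)
        = ennreal (\<kappa> * y)"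
    and q_integral: "s \<in> Xi \<theta> \<Longrightarrow> t \<in> Xi \<theta> \<Longrightarrow> t \<le> s \<Longrightarrow>
      (\<integral>\<^sup>+y. (if y \<le> ereal t then ennreal (q (real_of_ereal y / s)) else 0) \<partial>rho_Xi \<theta>)
        = ennreal (s * (F (t / s) - 1 / (1 + \<theta>)))"
    and F_square: "x \<in> Xi \<theta> \<Longrightarrow>
      (\<integral>\<^sup>+y. (if y \<le> ereal x then ennreal (real_of_ereal y * q (real_of_ereal y) + \<kappa> * real_of_ereal y) else 0) \<partial>rho_Xi \<theta>)
        = ennreal ((F x)\<^sup>2 - (1 / (1 + \<theta>))\<^sup>2)"
    and q_nonneg: "y \<in> Xi \<theta> \<Longrightarrow> 0 \<le> q y" and \<kappa>_nonneg: "0 \<le> \<kappa>"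
    and F_ge: "x \<in> Xi \<theta> \<Longrightarrow> 1 / (1 + \<theta>) \<le> F x" and F_le: "F 1 \<le> 1"
begin

definition \<rho> :: "(ereal \<times> ereal) measure" where
  "\<rho> = density (rho_Xi \<theta> \<Otimes>\<^sub>M rho_Xi \<theta>) (\<lambda>p. D (fst p) (snd p))"

sublocale X: prob_space "rho_Xi \<theta>"
  by (rule prob_space_rho_Xi[OF \<theta>])

sublocale P: pair_prob_space "rho_Xi \<theta>" "rho_Xi \<theta>" ..

lemma sets_pair: "sets (rho_Xi \<theta> \<Otimes>\<^sub>M rho_Xi \<theta>) = sets I2_borel"
  unfolding I2_borel_def by (intro sets_pair_measure_cong sets_rho_Xi)

lemma sets_\<rho>: "sets \<rho> = sets I2_borel"
  unfolding \<rho>_def sets_density by (rule sets_pair)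

lemma D_meas [measurable]: "(\<lambda>p. D (fst p) (snd p)) \<in> borel_measurable (rho_Xi \<theta> \<Otimes>\<^sub>M rho_Xi \<theta>)"
  using D_measurable measurable_cong_sets[OF sets_pair refl] by blast

lemma meas_pairI: "f \<in> borel_measurable I2_borel \<Longrightarrow> f \<in> borel_measurable (rho_Xi \<theta> \<Otimes>\<^sub>M rho_Xi \<theta>)"
  using measurable_cong_sets[OF sets_pair refl] by blast

lemma nn_integral_\<rho>:
  assumes f: "f \<in> borel_measurable I2_borel"
  shows "(\<integral>\<^sup>+p. f p \<partial>\<rho>) = (\<integral>\<^sup>+y. (\<integral>\<^sup>+y'. D y' y * f (y', y) \<partial>rho_Xi \<theta>) \<partial>rho_Xi \<theta>)"
proof -
  note [measurable] = meas_pairI[OF f]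
  have "(\<integral>\<^sup>+p. f p \<partial>\<rho>) = (\<integral>\<^sup>+p. D (fst p) (snd p) * f p \<partial>(rho_Xi \<theta> \<Otimes>\<^sub>M rho_Xi \<theta>))"
    unfolding \<rho>_def by (subst nn_integral_density) measurable
  also have "\<dots> = (\<integral>\<^sup>+y. (\<integral>\<^sup>+y'. D y' y * f (y', y) \<partial>rho_Xi \<theta>) \<partial>rho_Xi \<theta>)"
    by (subst P.nn_integral_snd[symmetric]) simp_all
  finally show ?thesis .
qed

lemma D_section: "y \<in> I_set \<Longrightarrow> (\<lambda>y'. D y' y) \<in> borel_measurable I_borel"
  using measurable_Pair1[OF D_meas, of y] by (simp cong: measurable_cong_sets)

lemma marginal_snd: "distr \<rho> I_borel snd = rho_Xi \<theta>"
proof (rule measure_eqI)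
  fix A assume "A \<in> sets (distr \<rho> I_borel snd)"
  then have A: "A \<in> sets I_borel" by simp
  have snd_m: "snd \<in> measurable \<rho> I_borel"
    using measurable_I2_snd_I by (simp cong: measurable_cong_sets add: sets_\<rho>)
  have m: "(\<lambda>p. indicator A (snd p) :: ennreal) \<in> borel_measurable I2_borel"
    using A by (intro measurable_compose[OF measurable_I2_snd_I] borel_measurable_indicator)
  have "emeasure (distr \<rho> I_borel snd) A = (\<integral>\<^sup>+p. indicator A p \<partial>distr \<rho> I_borel snd)" using A by simp
  also have "\<dots> = (\<integral>\<^sup>+p. indicator A (snd p) \<partial>\<rho>)"
    by (rule nn_integral_distr[OF snd_m]) (use A in simp)
  also have "\<dots> = (\<integral>\<^sup>+y. (\<integral>\<^sup>+y'. D y' y * indicator A y \<partial>rho_Xi \<theta>) \<partial>rho_Xi \<theta>)"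
    by (subst nn_integral_\<rho>[OF m]) simp
  also have "\<dots> = (\<integral>\<^sup>+y. indicator A y \<partial>rho_Xi \<theta>)"
  proof (rule nn_integral_cong_AE)
    show "AE y in rho_Xi \<theta>. (\<integral>\<^sup>+y'. D y' y * indicator A y \<partial>rho_Xi \<theta>) = indicator A y"
      using AE_rho_Xi[OF \<theta>] AE_space
    proof eventually_elim
      case (elim y)
      then have "(\<lambda>y'. D y' y) \<in> borel_measurable (rho_Xi \<theta>)"
        using D_section[of y] by (simp cong: measurable_cong_sets)
      then show ?case using D_total[OF elim(1)] by (simp add: nn_integral_multc)
    qed
  qed
  also have "\<dots> = emeasure (rho_Xi \<theta>) A" using A by simp
  finally show "emeasure (distr \<rho> I_borel snd) A = emeasure (rho_Xi \<theta>) A" .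
qed simp

lemma swap_measurable: "(\<lambda>(y1, y2). (y2, y1)) \<in> measurable I2_borel I2_borel"
  unfolding I2_borel_def by (rule measurable_pair_swap')

lemma \<rho>_symmetric: "distr \<rho> I2_borel (\<lambda>(y1, y2). (y2, y1)) = \<rho>"
proof (rule measure_eqI)
  fix A assume "A \<in> sets (distr \<rho> I2_borel (\<lambda>(y1, y2). (y2, y1)))"
  then have A: "A \<in> sets I2_borel" by simp
  let ?R2 = "rho_Xi \<theta> \<Otimes>\<^sub>M rho_Xi \<theta>"
  define h where "h p = D (fst p) (snd p) * indicator A (snd p, fst p)" for p
  have sw: "(\<lambda>(y1, y2). (y2, y1)) \<in> measurable \<rho> I2_borel"
    using swap_measurable by (simp cong: measurable_cong_sets add: sets_\<rho>)
  have ind: "(\<lambda>p. indicator A (snd p, fst p) :: ennreal) \<in> borel_measurable I2_borel"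
    using measurable_compose[OF swap_measurable borel_measurable_indicator[OF A]] by (simp add: case_prod_beta)
  note [measurable] = meas_pairI[OF ind] meas_pairI[OF borel_measurable_indicator[OF A]]
  have h: "h \<in> borel_measurable ?R2" unfolding h_def by measurable
  have "emeasure (distr \<rho> I2_borel (\<lambda>(y1, y2). (y2, y1))) A
      = (\<integral>\<^sup>+p. indicator A p \<partial>distr \<rho> I2_borel (\<lambda>(y1, y2). (y2, y1)))" using A by simp
  also have "\<dots> = (\<integral>\<^sup>+p. indicator A (snd p, fst p) \<partial>\<rho>)"
    by (subst nn_integral_distr[OF sw]) (use A in \<open>auto simp: case_prod_beta\<close>)
  also have "\<dots> = (\<integral>\<^sup>+p. h p \<partial>?R2)"
    unfolding \<rho>_def h_def by (subst nn_integral_density) measurable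
  also have "\<dots> = (\<integral>\<^sup>+p. h p \<partial>distr ?R2 ?R2 (\<lambda>(x, y). (y, x)))"
    by (subst P.distr_pair_swap[symmetric]) simp
  also have "\<dots> = (\<integral>\<^sup>+p. h (case p of (x, y) \<Rightarrow> (y, x)) \<partial>?R2)"
    by (rule nn_integral_distr[OF measurable_pair_swap']) (use h in simp)
  also have "\<dots> = (\<integral>\<^sup>+p. D (fst p) (snd p) * indicator A p \<partial>?R2)"
    by (intro nn_integral_cong) (simp add: h_def case_prod_beta D_symmetric)
  also have "\<dots> = (\<integral>\<^sup>+p. indicator A p \<partial>\<rho>)"
    unfolding \<rho>_def by (subst nn_integral_density) measurable
  also have "\<dots> = emeasure \<rho> A" using A by (simp add: sets_\<rho>)
  finally show "emeasure (distr \<rho> I2_borel (\<lambda>(y1, y2). (y2, y1))) A = emeasure \<rho> A" .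
qed (simp add: sets_\<rho>)

lemma marginal_fst: "distr \<rho> I_borel fst = rho_Xi \<theta>"
proof -
  have sw: "(\<lambda>(y1, y2). (y2, y1)) \<in> measurable \<rho> I2_borel"
    using swap_measurable by (simp cong: measurable_cong_sets add: sets_\<rho>)
  have "distr \<rho> I_borel fst = distr (distr \<rho> I2_borel (\<lambda>(y1, y2). (y2, y1))) I_borel fst"
    by (simp only: \<rho>_symmetric)
  also have "\<dots> = distr \<rho> I_borel snd"
    by (subst distr_distr[OF measurable_I2_fst_I sw]) (simp add: comp_def case_prod_beta)
  finally show ?thesis using marginal_snd by simp
qed

sublocale S: I2_Xi_symmetric \<rho> \<theta>
proof -
  have snd_m: "snd \<in> measurable \<rho> I_borel"
    using measurable_I2_snd_I by (simp cong: measurable_cong_sets add: sets_\<rho>)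
  have "prob_space (distr \<rho> I_borel snd)" unfolding marginal_snd by (rule X.prob_space_axioms)
  then have "prob_space \<rho>" by (rule prob_space_distrD[OF snd_m])
  then interpret prob_space \<rho> .
  show "I2_Xi_symmetric \<rho> \<theta>"
    by unfold_locales (simp_all add: sets_\<rho> \<theta> marginal_fst marginal_snd \<rho>_symmetric)
qed

lemma ennreal_joint_cdf: "ennreal (joint_cdf \<rho> s t) = (\<integral>\<^sup>+p. (if fst p \<le> ereal s \<or> snd p \<le> ereal t then 1 else 0) \<partial>\<rho>)"
proof -
  have "ennreal (joint_cdf \<rho> s t) = (\<integral>\<^sup>+p. indicator {p \<in> space \<rho>. fst p \<le> ereal s \<or> snd p \<le> ereal t} p \<partial>\<rho>)"
    unfolding joint_cdf_def by (simp add: S.emeasure_eq_measure)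
  also have "\<dots> = (\<integral>\<^sup>+p. (if fst p \<le> ereal s \<or> snd p \<le> ereal t then 1 else 0) \<partial>\<rho>)"
    by (intro nn_integral_cong) auto
  finally show ?thesis .
qed

text \<open>The event splits into \<open>Y \<le> s\<close>, a marginal event, and
  \<open>Y > s\<close> with \<open>Y' \<le> t\<close>, whose mass is the conditional tail
  \<open>q\<close> integrated over \<open>Y'\<close>.\<close>

lemma joint_cdf_\<rho>:
  assumes st: "s \<in> Xi \<theta>" "t \<in> Xi \<theta>" "t \<le> s"
  shows "joint_cdf \<rho> s t = s * F (t / s)"
proof -
  have ts: "t / s \<in> Xi \<theta>" by (rule Xi_divide[OF st \<theta>])
  have s0: "0 < s" using Xi_bounds[OF \<theta> st(1)] by simp
  have lt: "\<not> y \<le> ereal (-1)" if "y \<in> I_set" for y using S.not_le_minus_1[OF that] .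
  have m1: "(\<lambda>p. if fst p \<le> ereal s \<or> snd p \<le> ereal (-1) then 1 else 0 :: ennreal) \<in> borel_measurable \<rho>"
    by measurable
  have m2: "(\<lambda>p. if ereal s < fst p \<and> snd p \<le> ereal t then 1 else 0 :: ennreal) \<in> borel_measurable I2_borel"
    by measurable
  have "ennreal (joint_cdf \<rho> s t) = (\<integral>\<^sup>+p. (if fst p \<le> ereal s \<or> snd p \<le> ereal (-1) then 1 else 0)
      + (if ereal s < fst p \<and> snd p \<le> ereal t then 1 else 0) \<partial>\<rho>)"
    unfolding ennreal_joint_cdf using lt by (intro nn_integral_cong) (auto simp: S.space_eq not_le)
  also have "\<dots> = ennreal (joint_cdf \<rho> s (-1)) + (\<integral>\<^sup>+p. (if ereal s < fst p \<and> snd p \<le> ereal t then 1 else 0) \<partial>\<rho>)"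
    unfolding ennreal_joint_cdf
    by (intro nn_integral_add m1) (use m2 in \<open>simp cong: measurable_cong_sets add: sets_\<rho>\<close>)
  also have "(\<integral>\<^sup>+p. (if ereal s < fst p \<and> snd p \<le> ereal t then 1 else 0) \<partial>\<rho>)
      = (\<integral>\<^sup>+y. (if y \<le> ereal t then ennreal (q (real_of_ereal y / s)) else 0) \<partial>rho_Xi \<theta>)"
    unfolding nn_integral_\<rho>[OF m2]
  proof (rule nn_integral_cong_AE)
    show "AE y in rho_Xi \<theta>. (\<integral>\<^sup>+y'. D y' y * (if ereal s < fst (y', y) \<and> snd (y', y) \<le> ereal t then 1 else 0) \<partial>rho_Xi \<theta>)
        = (if y \<le> ereal t then ennreal (q (real_of_ereal y / s)) else 0)"
      using AE_rho_Xi[OF \<theta>]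
    proof eventually_elim
      case (elim y)
      show ?case
      proof (cases "y \<le> ereal t")
        case True
        then obtain r where r: "y = ereal r" "r \<in> Xi \<theta>" "r \<le> t" using elim by (auto simp: Xi_inf_def)
        have "(\<integral>\<^sup>+y'. D y' y * (if ereal s < fst (y', y) \<and> snd (y', y) \<le> ereal t then 1 else 0) \<partial>rho_Xi \<theta>)
            = (\<integral>\<^sup>+y'. (if ereal s < y' then D y' (ereal r) else 0) \<partial>rho_Xi \<theta>)"
          using True r by (intro nn_integral_cong) auto
        then show ?thesis using True r D_tail[OF st(1) r(2)] st(3) by simp
      qed simp
    qed
  qed
  also have "\<dots> = ennreal (s * (F (t / s) - 1 / (1 + \<theta>)))" by (rule q_integral[OF st])
  also have "ennreal (joint_cdf \<rho> s (-1)) + \<dots> = ennreal (s * F (t / s))"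
    using S.joint_cdf_minus_1(1)[OF st(1)] mult_left_mono[OF F_ge[OF ts], of s] s0 \<theta>
    by (subst ennreal_plus[symmetric]) (auto simp: algebra_simps)
  finally have "ennreal (joint_cdf \<rho> s t) = ennreal (s * F (t / s))" .
  moreover have "0 \<le> F (t / s)" using F_ge[OF ts] \<theta> by (smt (verit) divide_nonneg_nonneg)
  ultimately show ?thesis using s0 by (subst (asm) ennreal_inj) (auto simp: joint_cdf_def)
qed

lemma truncated_max_\<rho>:
  assumes x: "x \<in> Xi \<theta>"
  shows "(\<integral>p. truncated_max 1 x p \<partial>\<rho>) = (F x)\<^sup>2"
proof -
  have x1: "0 < x" "x \<le> 1" using Xi_bounds[OF \<theta> x] by auto
  \<comment> \<open>The amount by which \<open>Y'\<close> raises the maximum above the contribution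
    of \<open>Y\<close> alone: all of \<open>Y'\<close> when \<open>Y\<close> is infinite, and
    \<open>Y' - Y\<close> when \<open>Y \<le> Y'\<close>.\<close>
  define e where "e p = (if snd p \<le> ereal x then
      (if ereal 1 < fst p then ennreal (real_of_ereal (snd p)) else 0)
      + (if fst p \<le> snd p then ennreal (real_of_ereal (snd p) - real_of_ereal (fst p)) else 0) else 0)"
    for p :: "ereal \<times> ereal"
  have e: "e \<in> borel_measurable I2_borel" unfolding e_def by measurable
  have lt: "\<not> y \<le> ereal (-1)" if "y \<in> I_set" for y using S.not_le_minus_1[OF that] .
  have tm: "ennreal (truncated_max 1 x p) = ennreal (truncated_max 1 (-1) p) + e p" if "p \<in> I_set \<times> I_set" for p
  proof -
    obtain y' y where p: "p = (y', y)" "y' \<in> I_set" "y \<in> I_set" using \<open>p \<in> I_set \<times> I_set\<close> by auto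
    from p(2) p(3) show ?thesis
    proof (cases rule: I_set_cases[case_product I_set_cases])
      case ("1_1" r' r)
      then show ?thesis using x1 unfolding p(1)
        by (auto simp: truncated_max_def e_def max_def ennreal_plus[symmetric] simp del: ennreal_plus)
    qed (use x1 in \<open>auto simp: p(1) truncated_max_def e_def max_def\<close>)
  qed
  have "ennreal (\<integral>p. truncated_max 1 x p \<partial>\<rho>) = (\<integral>\<^sup>+p. ennreal (truncated_max 1 (-1) p) + e p \<partial>\<rho>)"
    unfolding S.integral_truncated_max_eq by (intro nn_integral_cong tm) (simp add: S.space_eq)
  also have "\<dots> = ennreal (\<integral>p. truncated_max 1 (-1) p \<partial>\<rho>) + (\<integral>\<^sup>+p. e p \<partial>\<rho>)"
    unfolding S.integral_truncated_max_eq
    by (intro nn_integral_add) (use e in \<open>simp_all cong: measurable_cong_sets add: sets_\<rho>\<close>)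
  also have "(\<integral>\<^sup>+p. e p \<partial>\<rho>) = (\<integral>\<^sup>+y. (if y \<le> ereal x then ennreal (real_of_ereal y * q (real_of_ereal y) + \<kappa> * real_of_ereal y) else 0) \<partial>rho_Xi \<theta>)"
    unfolding nn_integral_\<rho>[OF e]
  proof (rule nn_integral_cong_AE)
    show "AE y in rho_Xi \<theta>. (\<integral>\<^sup>+y'. D y' y * e (y', y) \<partial>rho_Xi \<theta>)
        = (if y \<le> ereal x then ennreal (real_of_ereal y * q (real_of_ereal y) + \<kappa> * real_of_ereal y) else 0)"
      using AE_rho_Xi[OF \<theta>] AE_space
    proof eventually_elim
      case (elim y)
      show ?case
      proof (cases "y \<le> ereal x")
        case True
        then obtain r where r: "y = ereal r" "r \<in> Xi \<theta>" "r \<le> x" using elim by (auto simp: Xi_inf_def)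
        have r1: "0 < r" "r \<le> 1" using Xi_bounds[OF \<theta> r(2)] by auto
        note id = measurable_I_borel_borel
        have Dm: "(\<lambda>y'. D y' (ereal r)) \<in> borel_measurable (rho_Xi \<theta>)"
          using D_section[of y] elim(2) r(1) by (simp cong: measurable_cong_sets)
        have idm: "(\<lambda>y. y) \<in> borel_measurable (rho_Xi \<theta>)"
          using id by (simp cong: measurable_cong_sets)
        note [measurable] = Dm idm
        have "(\<integral>\<^sup>+y'. D y' y * e (y', y) \<partial>rho_Xi \<theta>)
          = (\<integral>\<^sup>+y'. ennreal r * (if ereal 1 < y' then D y' (ereal r) else 0)
            + (if y' \<le> ereal r then ennreal (r - real_of_ereal y') * D y' (ereal r) else 0) \<partial>rho_Xi \<theta>)"
          using True r by (intro nn_integral_cong) (auto simp: e_def distrib_left mult.commute)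
        also have "\<dots> = ennreal r * ennreal (q (r / 1)) + ennreal (\<kappa> * r)"
          using r1 r by (subst nn_integral_add)
            (auto simp: nn_integral_cmult D_tail[OF one_in_Xi r(2)] D_excess[OF r(2)])
        also have "\<dots> = ennreal (r * q r + \<kappa> * r)"
          using r1 q_nonneg[OF r(2)] \<kappa>_nonneg by (simp add: ennreal_mult)
        finally show ?thesis using True r by simp
      qed (simp add: e_def)
    qed
  qed
  also have "\<dots> = ennreal ((F x)\<^sup>2 - (1 / (1 + \<theta>))\<^sup>2)" by (rule F_square[OF x])
  also have "ennreal (\<integral>p. truncated_max 1 (-1) p \<partial>\<rho>) + \<dots> = ennreal ((F x)\<^sup>2)"
  proof -
    have "(1 / (1 + \<theta>))\<^sup>2 \<le> (F x)\<^sup>2" using F_ge[OF x] \<theta> by (intro power_mono) auto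
    then show ?thesis
      unfolding S.truncated_max_minus_1(1)[OF one_in_Xi] by (subst ennreal_plus[symmetric]) auto
  qed
  finally have "ennreal (\<integral>p. truncated_max 1 x p \<partial>\<rho>) = ennreal ((F x)\<^sup>2)" .
  moreover have "0 \<le> (\<integral>p. truncated_max 1 x p \<partial>\<rho>)"
    using truncated_max_bounds by (intro integral_nonneg_AE AE_I2) (auto simp: S.space_eq)
  ultimately show ?thesis by (subst (asm) ennreal_inj) auto
qed

lemma \<rho>_solves: "\<rho> \<in> M2_theta \<theta>" "solves_bivariate_RDE \<rho>"
  using S.M2_theta_and_RDE_criterion[of F] joint_cdf_\<rho> truncated_max_\<rho> F_le by auto

lemma \<rho>_neq_rho_bar: "F 1 \<noteq> 1 / (1 + \<theta>) \<Longrightarrow> \<rho> \<noteq> rho_bar \<theta>"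
  using joint_cdf_\<rho>[OF one_in_Xi one_in_Xi] joint_cdf_rho_bar[OF \<theta> one_in_Xi, of 1] by auto

end

section \<open>A nontrivial solution for \<open>\<theta> < 1\<close>\<close>

lemma nn_integral_rho_Xi_sums:
  assumes \<theta>: "0 < \<theta>" "\<theta> < 1" and h: "h \<in> borel_measurable I_borel"
    and val: "\<And>k. h (ereal (\<theta> ^ k)) = ennreal (a k)" "h \<infinity> = ennreal b"
    and nonneg: "\<And>k. 0 \<le> a k" "0 \<le> b"
    and sums: "(\<lambda>k. (1 - \<theta>) / (1 + \<theta>) * \<theta> ^ k * a k) sums S"
  shows "(\<integral>\<^sup>+y. h y \<partial>rho_Xi \<theta>) = ennreal (S + \<theta> / (1 + \<theta>) * b)"
proof -
  have w: "0 \<le> (1 - \<theta>) / (1 + \<theta>) * \<theta> ^ k" for k using \<theta> by simp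
  have S: "0 \<le> S"
    unfolding sums_unique[OF sums]
    by (rule suminf_nonneg[OF sums_summable[OF sums]]) (rule mult_nonneg_nonneg[OF w nonneg(1)])
  have "(\<integral>\<^sup>+y. h y \<partial>rho_Xi \<theta>)
      = (\<Sum>k. ennreal ((1 - \<theta>) / (1 + \<theta>) * \<theta> ^ k * a k)) + ennreal (\<theta> / (1 + \<theta>) * b)"
    unfolding nn_integral_rho_Xi_lt_1[OF \<theta> h] val
    using w nonneg \<theta> by (simp only: ennreal_mult divide_nonneg_nonneg less_imp_le add_nonneg_nonneg zero_le_one)
  also have "(\<Sum>k. ennreal ((1 - \<theta>) / (1 + \<theta>) * \<theta> ^ k * a k)) = ennreal S"
    by (rule suminf_ennreal_eq[OF _ sums]) (rule mult_nonneg_nonneg[OF w nonneg(1)])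
  finally show ?thesis using S nonneg(2) \<theta> by simp
qed

locale nontrivial_sequence =
  fixes \<theta> :: real and f :: "nat \<Rightarrow> real"
  assumes \<theta>: "0 < \<theta>" "\<theta> < 1"
    and f0: "1 / (1 + \<theta>) < f 0" "f 0 \<le> 1" and f: "decseq f" "f \<longlonglongrightarrow> 1 / (1 + \<theta>)"
    and rec: "\<And>j. (f j - f (Suc j)) * (f j + f (Suc j) - \<theta> ^ j)
      = (1 - \<theta>\<^sup>2) * f 0 * (f 0 - 1 / (1 + \<theta>)) / 2 * (\<theta>\<^sup>2) ^ j"
begin

definition c where "c = 1 / (1 + \<theta>)"
definition w where "w = (1 - \<theta>) / (1 + \<theta>)"
definition K where "K = (1 - \<theta>\<^sup>2) * f 0 * (f 0 - c) / 2"
definition d where "d k = f k - f (Suc k)" for k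

text \<open>\<open>p k\<close> is the mass of the pair \<open>(1, \<theta> ^ k)\<close>, \<open>d k\<close> that of \<open>(\<infinity>, \<theta> ^ k)\<close>.\<close>
definition p where "p k = (case k of 0 \<Rightarrow> 2 * f 1 - (1 + \<theta>) * f 0 | Suc l \<Rightarrow> \<theta> * d l - d (Suc l))"
text \<open>\<open>p\<close> is the mixed second difference of \<open>H\<close> at the atoms, with
  \<open>H \<theta> (\<theta> ^ k)\<close> replaced by \<open>\<theta> * f (k - 1)\<close> for
  \<open>k > 0\<close>. Symmetry and scaling by \<theta> then determine all other masses.\<close>

definition mass where "mass i j = (if i \<le> j then \<theta> ^ i * p (j - i) else \<theta> ^ j * p (i - j))"

lemma c_props: "0 < c" "w = (1 - \<theta>) * c" "(1 - \<theta>\<^sup>2) * c = 1 - \<theta>" "0 < w" "\<theta> / (1 + \<theta>) = 1 - c"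
  using \<theta> by (auto simp: c_def w_def field_simps power2_eq_square)

lemma f_ge: "c \<le> f j"
  using decseq_ge[OF f] by (simp add: c_def)

lemma d_nonneg: "0 \<le> d k"
  using decseq_SucD[OF f(1)] by (simp add: d_def)

lemma p_nonneg: "0 \<le> p k"
  using sequence_second_differences[OF \<theta> f0(1) f rec] by (cases k) (auto simp: p_def d_def)

lemma mass_nonneg: "0 \<le> mass i j"
  using p_nonneg \<theta> by (simp add: mass_def)

lemma K_nonneg: "0 \<le> K"
proof -
  have "0 < 1 - \<theta>\<^sup>2" by (rule one_minus_square_pos[OF \<theta>])
  then show ?thesis unfolding K_def using f_ge[of 0] c_props(1) by (intro divide_nonneg_pos mult_nonneg_nonneg) auto
qed

lemma shift_sums: "(\<lambda>k. g (k + i) - g (Suc k + i)) sums (g i - l)" if "g \<longlonglongrightarrow> l" for g :: "nat \<Rightarrow> real"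
  using telescope_sums'[OF LIMSEQ_ignore_initial_segment[OF that, of i]] by simp

lemma d_sums: "(\<lambda>k. d (k + i)) sums (f i - c)"
  using shift_sums[OF f(2), of i] by (simp add: d_def c_def)

text \<open>The recursion solved for a difference of squares, which telescopes; after the marginal
  weights are multiplied in, this is \<open>F_square\<close> of the density locale.\<close>

lemma square_sums: "(\<lambda>k. \<theta> ^ (k + i) * d (k + i) + K * (\<theta>\<^sup>2) ^ (k + i)) sums ((f i)\<^sup>2 - c\<^sup>2)"
proof -
  have "(f j)\<^sup>2 - (f (Suc j))\<^sup>2 = \<theta> ^ j * d j + K * (\<theta>\<^sup>2) ^ j" for j
  proof -
    have "(f j)\<^sup>2 - (f (Suc j))\<^sup>2 = \<theta> ^ j * d j + (f j - f (Suc j)) * (f j + f (Suc j) - \<theta> ^ j)"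
      by (simp add: d_def power2_eq_square algebra_simps)
    then show ?thesis unfolding rec K_def c_def .
  qed
  then show ?thesis
    using shift_sums[OF tendsto_power[OF f(2), of 2], of i] by (simp add: c_def)
qed

lemma weighted_d_sums: "(\<lambda>k. \<theta> ^ k * d k) sums ((f 0)\<^sup>2 - c\<^sup>2 - K / (1 - \<theta>\<^sup>2))"
proof -
  have "1 - \<theta>\<^sup>2 \<noteq> 0" using one_minus_square_pos[OF \<theta>] by simp
  then have "(\<lambda>k. K * (\<theta>\<^sup>2) ^ k) sums (K / (1 - \<theta>\<^sup>2))"
    using sums_mult[OF geometric_weight_sums[OF \<theta>], of "K / (1 - \<theta>\<^sup>2)"] by simp
  from sums_diff[OF square_sums[of 0] this] show ?thesis by simp
qed

lemma p_sums: "p sums (w - d 0)"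
proof -
  have "(\<lambda>k. p (Suc k)) sums (\<theta> * (f 0 - c) - (f 1 - c))"
    unfolding p_def using sums_diff[OF sums_mult[OF d_sums[of 0], of \<theta>] d_sums[of 1]] by simp
  then have "p sums (\<theta> * (f 0 - c) - (f 1 - c) + p 0)" by (rule sums_Suc)
  then show ?thesis by (simp add: p_def d_def c_props(2) algebra_simps)
qed

text \<open>A consistency check: the mean excess of the constructed masses has to return the
  constant \<open>K\<close> that the recursion was run with. It does because \<open>K\<close> has
  the particular form in \<open>f 0\<close>.\<close>

lemma p_excess_sums: "(\<lambda>k. (1 - \<theta> ^ k) * p k) sums K"
proof -
  let ?S = "(f 0)\<^sup>2 - c\<^sup>2 - K / (1 - \<theta>\<^sup>2)"
  have 1: "(\<lambda>k. \<theta> * d k - d (k + 1)) sums (\<theta> * (f 0 - c) - (f 1 - c))"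
    using sums_diff[OF sums_mult[OF d_sums[of 0], of \<theta>] d_sums[of 1]] by simp
  have "(\<lambda>k. \<theta> ^ Suc k * d (Suc k)) sums (?S - d 0)"
    using weighted_d_sums by (subst sums_Suc_iff) simp
  from sums_diff[OF this sums_mult[OF weighted_d_sums, of "\<theta>\<^sup>2"]]
  have 2: "(\<lambda>k. \<theta> ^ Suc k * d (Suc k) - \<theta>\<^sup>2 * (\<theta> ^ k * d k)) sums (?S - d 0 - \<theta>\<^sup>2 * ?S)" .
  have "(\<lambda>k. (1 - \<theta> ^ Suc k) * p (Suc k)) sums (\<theta> * (f 0 - c) - (f 1 - c) + (?S - d 0 - \<theta>\<^sup>2 * ?S))"
    using sums_add[OF 1 2] by (simp add: p_def power2_eq_square algebra_simps)
  then have "(\<lambda>k. (1 - \<theta> ^ k) * p k) sums (\<theta> * (f 0 - c) - (f 1 - c) + (?S - d 0 - \<theta>\<^sup>2 * ?S))"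
    by (subst (asm) sums_Suc_iff) simp
  moreover have "\<theta> * (f 0 - c) - (f 1 - c) + (?S - d 0 - \<theta>\<^sup>2 * ?S) = K"
  proof -
    have "(1 - \<theta>\<^sup>2) * ?S = (1 - \<theta>\<^sup>2) * ((f 0)\<^sup>2 - c\<^sup>2) - K"
      using one_minus_square_pos[OF \<theta>] by (simp add: right_diff_distrib)
    moreover have "(1 - \<theta>\<^sup>2) * ((f 0)\<^sup>2 - c\<^sup>2) - (1 - \<theta>) * (f 0 - c) = 2 * K"
      unfolding K_def c_props(3)[symmetric] by (simp add: power2_eq_square algebra_simps)
    moreover have e: "\<theta> * (f 0 - c) - (f 1 - c) + (S - d 0 - \<theta>\<^sup>2 * S) = (1 - \<theta>\<^sup>2) * S - (1 - \<theta>) * (f 0 - c)" for S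
      by (simp add: d_def algebra_simps)
    moreover note e[of ?S]
    ultimately show ?thesis by linarith
  qed
  ultimately show ?thesis by simp
qed

text \<open>For \<open>i < j\<close> the mass is
  \<open>\<theta> ^ Suc i * d (j - Suc i) - \<theta> ^ i * d (j - i)\<close>, which telescopes;
  \<open>d j\<close> accounts for the atom at infinity.\<close>

lemma mass_tail: "i \<le> j \<Longrightarrow> (\<Sum>k<i. mass k j) + d j = \<theta> ^ i * d (j - i)"
proof (induction i)
  case (Suc i)
  obtain l where l: "j - i = Suc l" "j - Suc i = l" using Suc.prems by (cases "j - i") auto
  have "mass i j = \<theta> ^ i * (\<theta> * d l - d (Suc l))"
    using Suc.prems by (simp add: mass_def p_def l)
  then show ?case using Suc l by (simp add: algebra_simps)
qed simp

lemma mass_sums: "(\<lambda>i. mass i j) sums (w * \<theta> ^ j - d j)"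
proof -
  have "mass (k + j) j = \<theta> ^ j * p k" for k by (cases k) (auto simp: mass_def)
  then have "(\<lambda>k. mass (k + j) j) sums (\<theta> ^ j * (w - d 0))"
    using sums_mult[OF p_sums, of "\<theta> ^ j"] by simp
  then have "(\<lambda>i. mass i j) sums (\<theta> ^ j * (w - d 0) + (\<Sum>k<j. mass k j))"
    by (subst (asm) sums_iff_shift) simp
  moreover have "\<theta> ^ j * (w - d 0) + (\<Sum>k<j. mass k j) = w * \<theta> ^ j - d j"
    using mass_tail[of j j] by (simp add: algebra_simps)
  ultimately show ?thesis by simp
qed

text \<open>Recovers the exponent of an atom. \<open>LEAST\<close> makes it a measurable function on
  all of \<open>ereal\<close>; only its values at the atoms enter integrals against
  \<open>rho_Xi \<theta>\<close>.\<close>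

definition ix :: "ereal \<Rightarrow> nat" where
  "ix y = (LEAST i. ereal (\<theta> ^ i) \<le> y)"

lemma ix_power: "ix (ereal (\<theta> ^ j)) = j"
  unfolding ix_def using \<theta> by (intro Least_equality) (auto simp: power_decreasing_iff)

text \<open>Masses divided by the product of the marginal weights, which are
  \<open>w * \<theta> ^ i\<close> at an atom and \<open>1 - c\<close> at infinity. The numerator
  \<open>1 - f 0\<close> at infinity is the mass left over.\<close>

definition D :: "ereal \<Rightarrow> ereal \<Rightarrow> ennreal" where
  "D u v = (if u = \<infinity> then (if v = \<infinity> then ennreal ((1 - f 0) / (1 - c)\<^sup>2) else ennreal (d (ix v) / (w * \<theta> ^ ix v * (1 - c))))
    else (if v = \<infinity> then ennreal (d (ix u) / (w * \<theta> ^ ix u * (1 - c)))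
      else ennreal (mass (ix u) (ix v) / (w * \<theta> ^ ix u * (w * \<theta> ^ ix v)))))"

lemma D_commute: "D u v = D v u"
  unfolding D_def by (auto simp: mass_def mult_ac)

lemma D_power:
  "D (ereal (\<theta> ^ i)) (ereal (\<theta> ^ j)) = ennreal (mass i j / (w * \<theta> ^ i * (w * \<theta> ^ j)))"
  "D \<infinity> (ereal (\<theta> ^ j)) = ennreal (d j / (w * \<theta> ^ j * (1 - c)))"
  "D (ereal (\<theta> ^ i)) \<infinity> = ennreal (d i / (w * \<theta> ^ i * (1 - c)))"
  "D \<infinity> \<infinity> = ennreal ((1 - f 0) / (1 - c)\<^sup>2)"
  by (simp_all add: D_def ix_power)

lemma ix_measurable [measurable]: "ix \<in> measurable borel (count_space UNIV)"
  unfolding ix_def by measurable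

lemma D_measurable_I2: "(\<lambda>q. D (fst q) (snd q)) \<in> borel_measurable I2_borel"
proof -
  have 1: "(\<lambda>q. ix (fst q)) \<in> measurable I2_borel (count_space UNIV)"
    "(\<lambda>q. ix (snd q)) \<in> measurable I2_borel (count_space UNIV)"
    by measurable
  have 2: "(\<lambda>q. h (ix (fst q)) (ix (snd q))) \<in> borel_measurable I2_borel" for h :: "nat \<Rightarrow> nat \<Rightarrow> ennreal"
  proof (rule measurable_compose_countable[OF _ 1(1)])
    show "(\<lambda>q. h i (ix (snd q))) \<in> borel_measurable I2_borel" for i
      by (rule measurable_compose[OF 1(2)]) simp
  qed
  note [measurable] = 2[of "\<lambda>i j. ennreal (d j / (w * \<theta> ^ j * (1 - c)))"]
    2[of "\<lambda>i j. ennreal (d i / (w * \<theta> ^ i * (1 - c)))"]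
    2[of "\<lambda>i j. ennreal (mass i j / (w * \<theta> ^ i * (w * \<theta> ^ j)))"]
  show ?thesis unfolding D_def by measurable
qed

lemma D_section_measurable: "v \<in> I_set \<Longrightarrow> (\<lambda>y'. D y' v) \<in> borel_measurable I_borel"
  using measurable_Pair1[OF D_measurable_I2[unfolded I2_borel_def], of v] by simp

lemma power_in_I: "ereal (\<theta> ^ j) \<in> I_set"
  using \<theta> by (simp add: power_le_one)

lemma c_less_1: "0 < 1 - c"
  using c_props(5) \<theta> by (metis add_pos_pos divide_pos_pos zero_less_one)

lemma D_nonneg_facts:
  "0 \<le> mass i j / (w * \<theta> ^ i * (w * \<theta> ^ j))" "0 \<le> d j / (w * \<theta> ^ j * (1 - c))" "0 \<le> (1 - f 0) / (1 - c)\<^sup>2"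
  using mass_nonneg d_nonneg c_props(4) c_less_1 \<theta> f0(2) by simp_all

text \<open>Dividing \<open>\<theta> ^ i * d (j - i)\<close> from \<open>mass_tail\<close> by the
  weight \<open>w * \<theta> ^ j\<close> gives the conditional tail; dividing the excess
  \<open>\<theta> ^ (2 * j) * K\<close> by it gives the slope \<open>K / w\<close>.\<close>

sublocale scale_invariant_density \<theta> D "\<lambda>r. d (ix (ereal r)) / (w * r)" "\<lambda>r. f (ix (ereal r))" "K / w"
proof
  note id [measurable] = measurable_I_borel_borel
  show "0 < \<theta>" "\<theta> \<le> 1" using \<theta> by auto
  show "(\<lambda>q. D (fst q) (snd q)) \<in> borel_measurable I2_borel" by (rule D_measurable_I2)
  show "D u v = D v u" for u v by (rule D_commute)
  have Xi: "s \<in> Xi \<theta> \<longleftrightarrow> (\<exists>i. s = \<theta> ^ i)" for s using \<theta> by (auto simp: Xi_def)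
  have w0: "w \<noteq> 0" "\<theta> \<noteq> 0" "1 - c \<noteq> 0" using c_props(4) c_less_1 \<theta> by auto
  note weight = w_def[symmetric] c_props(5)
  show "(\<integral>\<^sup>+y'. D y' v \<partial>rho_Xi \<theta>) = 1" if v: "v \<in> Xi_inf \<theta>" for v
  proof -
    consider j where "v = ereal (\<theta> ^ j)" | "v = \<infinity>" using v by (auto simp: Xi_inf_def Xi)
    then show ?thesis
    proof cases
      case (1 j)
      have "(\<integral>\<^sup>+y'. D y' v \<partial>rho_Xi \<theta>) = ennreal ((w * \<theta> ^ j - d j) / (w * \<theta> ^ j)
          + \<theta> / (1 + \<theta>) * (d j / (w * \<theta> ^ j * (1 - c))))"
      proof (rule nn_integral_rho_Xi_sums[OF \<theta>, where a = "\<lambda>i. mass i j / (w * \<theta> ^ i * (w * \<theta> ^ j))"])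
        show "(\<lambda>k. (1 - \<theta>) / (1 + \<theta>) * \<theta> ^ k * (mass k j / (w * \<theta> ^ k * (w * \<theta> ^ j)))) sums ((w * \<theta> ^ j - d j) / (w * \<theta> ^ j))"
          unfolding weight using sums_divide[OF mass_sums[of j], of "w * \<theta> ^ j"] w0 by simp
      qed (use 1 D_nonneg_facts in \<open>simp_all add: D_power D_section_measurable[OF power_in_I]\<close>)
      also have "(w * \<theta> ^ j - d j) / (w * \<theta> ^ j) + \<theta> / (1 + \<theta>) * (d j / (w * \<theta> ^ j * (1 - c))) = 1"
        unfolding weight using w0 by (simp add: diff_divide_distrib)
      finally show ?thesis by simp
    next
      case 2
      have "(\<integral>\<^sup>+y'. D y' v \<partial>rho_Xi \<theta>) = ennreal ((f 0 - c) / (1 - c)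
          + \<theta> / (1 + \<theta>) * ((1 - f 0) / (1 - c)\<^sup>2))"
      proof (rule nn_integral_rho_Xi_sums[OF \<theta>, where a = "\<lambda>i. d i / (w * \<theta> ^ i * (1 - c))"])
        show "(\<lambda>k. (1 - \<theta>) / (1 + \<theta>) * \<theta> ^ k * (d k / (w * \<theta> ^ k * (1 - c)))) sums ((f 0 - c) / (1 - c))"
          unfolding weight using sums_divide[OF d_sums[of 0], of "1 - c"] w0 by simp
      qed (use 2 D_nonneg_facts in \<open>simp_all add: D_power D_section_measurable\<close>)
      also have "(f 0 - c) / (1 - c) + \<theta> / (1 + \<theta>) * ((1 - f 0) / (1 - c)\<^sup>2) = 1"
        unfolding weight using w0 by (simp add: power2_eq_square add_divide_distrib[symmetric])
      finally show ?thesis by simp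
    qed
  qed
  show "(\<integral>\<^sup>+y'. (if ereal s < y' then D y' (ereal y) else 0) \<partial>rho_Xi \<theta>) = ennreal (d (ix (ereal (y / s))) / (w * (y / s)))" (is "integral\<^sup>N _ ?h = _")
    if sy: "s \<in> Xi \<theta>" "y \<in> Xi \<theta>" "y \<le> s" for s y
  proof -
    obtain i j where ij: "s = \<theta> ^ i" "y = \<theta> ^ j" using sy Xi by auto
    then have le: "i \<le> j" using sy(3) \<theta> by (simp add: power_decreasing_iff)
    have ys: "y / s = \<theta> ^ (j - i)" using le w0 by (simp add: ij power_diff)
    have [measurable]: "(\<lambda>y'. D y' (ereal y)) \<in> borel_measurable I_borel"
      unfolding ij by (rule D_section_measurable[OF power_in_I])
    have lt: "\<theta> ^ i < \<theta> ^ k \<longleftrightarrow> k < i" for k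
      using \<theta> by (simp add: not_le[symmetric] power_decreasing_iff)
    have "integral\<^sup>N (rho_Xi \<theta>) ?h
        = ennreal ((\<Sum>k<i. mass k j) / (w * \<theta> ^ j) + \<theta> / (1 + \<theta>) * (d j / (w * \<theta> ^ j * (1 - c))))"
    proof (rule nn_integral_rho_Xi_sums[OF \<theta>, where a = "\<lambda>k. if k < i then mass k j / (w * \<theta> ^ k * (w * \<theta> ^ j)) else 0"])
      show "?h \<in> borel_measurable I_borel" by measurable
      have "(\<lambda>k. if k \<in> {..<i} then mass k j / (w * \<theta> ^ j) else 0) sums (\<Sum>k<i. mass k j / (w * \<theta> ^ j))"
        by (rule sums_If_finite_set) simp
      moreover have "(1 - \<theta>) / (1 + \<theta>) * \<theta> ^ k * (if k < i then mass k j / (w * \<theta> ^ k * (w * \<theta> ^ j)) else 0)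
          = (if k \<in> {..<i} then mass k j / (w * \<theta> ^ j) else 0)" for k
        unfolding weight using w0 by simp
      ultimately show "(\<lambda>k. (1 - \<theta>) / (1 + \<theta>) * \<theta> ^ k * (if k < i then mass k j / (w * \<theta> ^ k * (w * \<theta> ^ j)) else 0)) sums ((\<Sum>k<i. mass k j) / (w * \<theta> ^ j))"
        by (simp add: sum_divide_distrib)
    qed (use D_nonneg_facts in \<open>simp_all add: ij D_power lt\<close>)
    also have "(\<Sum>k<i. mass k j) / (w * \<theta> ^ j) + \<theta> / (1 + \<theta>) * (d j / (w * \<theta> ^ j * (1 - c))) = d (j - i) / (w * \<theta> ^ (j - i))"
    proof -
      have "\<theta> ^ j = \<theta> ^ i * \<theta> ^ (j - i)" using le by (simp add: power_add[symmetric])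
      then have "\<theta> ^ i * d (j - i) / (w * \<theta> ^ j) = d (j - i) / (w * \<theta> ^ (j - i))" using w0 by simp
      moreover have "(\<Sum>k<i. mass k j) / (w * \<theta> ^ j) + \<theta> / (1 + \<theta>) * (d j / (w * \<theta> ^ j * (1 - c)))
          = ((\<Sum>k<i. mass k j) + d j) / (w * \<theta> ^ j)"
        unfolding weight using w0 by (simp add: add_divide_distrib)
      ultimately show ?thesis unfolding mass_tail[OF le] by simp
    qed
    finally show ?thesis unfolding ys ix_power .
  qed
  show "(\<integral>\<^sup>+y'. (if y' \<le> ereal y then ennreal (y - real_of_ereal y') * D y' (ereal y) else 0) \<partial>rho_Xi \<theta>) = ennreal (K / w * y)" (is "integral\<^sup>N _ ?h = _")
    if y: "y \<in> Xi \<theta>" for y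
  proof -
    obtain j where j: "y = \<theta> ^ j" using y Xi by auto
    have [measurable]: "(\<lambda>y'. D y' (ereal y)) \<in> borel_measurable I_borel"
      unfolding j by (rule D_section_measurable[OF power_in_I])
    let ?a = "\<lambda>k. if j \<le> k then (\<theta> ^ j - \<theta> ^ k) * (mass k j / (w * \<theta> ^ k * (w * \<theta> ^ j))) else 0"
    have "integral\<^sup>N (rho_Xi \<theta>) ?h
        = ennreal (K / w * y + \<theta> / (1 + \<theta>) * 0)"
    proof (rule nn_integral_rho_Xi_sums[OF \<theta>, where a = ?a])
      show "?h \<in> borel_measurable I_borel"
        by measurable
      have tm_eq: "(1 - \<theta>) / (1 + \<theta>) * \<theta> ^ (k + j) * ?a (k + j) = \<theta> ^ j / w * ((1 - \<theta> ^ k) * p k)" for k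
      proof -
        have "mass (k + j) j = \<theta> ^ j * p k" by (cases k) (auto simp: mass_def)
        moreover have "\<theta> ^ j - \<theta> ^ (k + j) = \<theta> ^ j * (1 - \<theta> ^ k)" by (simp add: power_add algebra_simps)
        ultimately show ?thesis unfolding weight using w0 by simp
      qed
      have "(\<lambda>k. (1 - \<theta>) / (1 + \<theta>) * \<theta> ^ (k + j) * ?a (k + j)) sums (\<theta> ^ j / w * K)"
        unfolding tm_eq by (rule sums_mult[OF p_excess_sums])
      then show "(\<lambda>k. (1 - \<theta>) / (1 + \<theta>) * \<theta> ^ k * ?a k) sums (K / w * y)"
        by (subst (asm) sums_zero_iff_shift) (auto simp: j mult.commute)
      show "0 \<le> ?a k" for k
      proof (cases "j \<le> k")
        case True
        then have "0 \<le> \<theta> ^ j - \<theta> ^ k" using \<theta> by (simp add: power_decreasing_iff)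
        from mult_nonneg_nonneg[OF this D_nonneg_facts(1)[of k j]] show ?thesis by simp
      qed simp
      show "?h (ereal (\<theta> ^ k)) = ennreal (?a k)" for k
      proof (cases "j \<le> k")
        case True
        then have "0 \<le> \<theta> ^ j - \<theta> ^ k" using \<theta> by (simp add: power_decreasing_iff)
        from ennreal_mult[OF this D_nonneg_facts(1)[of k j]] show ?thesis
          using True \<theta> by (simp add: j D_power power_decreasing_iff)
      qed (use \<theta> in \<open>simp add: j power_decreasing_iff\<close>)
    qed simp_all
    then show ?thesis by simp
  qed
  show "(\<integral>\<^sup>+y. (if y \<le> ereal t then ennreal (d (ix (ereal (real_of_ereal y / s))) / (w * (real_of_ereal y / s))) else 0) \<partial>rho_Xi \<theta>)
      = ennreal (s * (f (ix (ereal (t / s))) - 1 / (1 + \<theta>)))" (is "integral\<^sup>N _ ?h = _")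
    if st: "s \<in> Xi \<theta>" "t \<in> Xi \<theta>" "t \<le> s" for s t
  proof -
    obtain i j where ij: "s = \<theta> ^ i" "t = \<theta> ^ j" using st Xi by auto
    then have le: "i \<le> j" using st(3) \<theta> by (simp add: power_decreasing_iff)
    have ts: "t / s = \<theta> ^ (j - i)" using le w0 by (simp add: ij power_diff)
    have ks: "\<theta> ^ k / s = \<theta> ^ (k - i)" if "j \<le> k" for k using le that w0 by (simp add: ij power_diff)
    let ?a = "\<lambda>k. if j \<le> k then d (k - i) / (w * \<theta> ^ (k - i)) else 0"
    have "integral\<^sup>N (rho_Xi \<theta>) ?h
        = ennreal (s * (f (j - i) - c) + \<theta> / (1 + \<theta>) * 0)"
    proof (rule nn_integral_rho_Xi_sums[OF \<theta>, where a = ?a])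
      have "(\<lambda>y. ix (ereal (real_of_ereal y / s))) \<in> measurable borel (count_space UNIV)" by measurable
      then have [measurable]: "(\<lambda>y. d (ix (ereal (real_of_ereal y / s)))) \<in> borel_measurable borel"
        by (rule measurable_compose) simp
      then have "?h \<in> borel_measurable borel" by measurable
      from measurable_compose[OF id this]
      show "?h \<in> borel_measurable I_borel" .
      have tm_eq: "(1 - \<theta>) / (1 + \<theta>) * \<theta> ^ (k + j) * ?a (k + j) = \<theta> ^ i * d (k + (j - i))" for k
      proof -
        have "k + j - i = k + (j - i)" "\<theta> ^ (k + j) = \<theta> ^ i * \<theta> ^ (k + (j - i))"
          using le by (simp_all add: power_add[symmetric])
        then show ?thesis unfolding weight using w0 by simp
      qed
      have "(\<lambda>k. (1 - \<theta>) / (1 + \<theta>) * \<theta> ^ (k + j) * ?a (k + j)) sums (\<theta> ^ i * (f (j - i) - c))"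
        unfolding tm_eq by (rule sums_mult[OF d_sums])
      then show "(\<lambda>k. (1 - \<theta>) / (1 + \<theta>) * \<theta> ^ k * ?a k) sums (s * (f (j - i) - c))"
        by (subst (asm) sums_zero_iff_shift) (auto simp: ij)
      show "0 \<le> ?a k" for k using d_nonneg c_props(4) \<theta> by simp
      show "?h (ereal (\<theta> ^ k)) = ennreal (?a k)" for k
        using \<theta> ks[of k] by (simp add: ij(2) power_decreasing_iff ix_power)
    qed simp_all
    then show ?thesis unfolding ts ix_power by (simp add: c_def)
  qed
  show "(\<integral>\<^sup>+y. (if y \<le> ereal x then ennreal (real_of_ereal y * (d (ix (ereal (real_of_ereal y))) / (w * real_of_ereal y)) + K / w * real_of_ereal y) else 0) \<partial>rho_Xi \<theta>)
      = ennreal ((f (ix (ereal x)))\<^sup>2 - (1 / (1 + \<theta>))\<^sup>2)" (is "integral\<^sup>N _ ?h = _")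
    if x: "x \<in> Xi \<theta>" for x
  proof -
    obtain j where j: "x = \<theta> ^ j" using x Xi by auto
    let ?a = "\<lambda>k. if j \<le> k then d k / w + K / w * \<theta> ^ k else 0"
    have "integral\<^sup>N (rho_Xi \<theta>) ?h
        = ennreal ((f j)\<^sup>2 - c\<^sup>2 + \<theta> / (1 + \<theta>) * 0)"
    proof (rule nn_integral_rho_Xi_sums[OF \<theta>, where a = ?a])
      have "(\<lambda>y. ix (ereal (real_of_ereal y))) \<in> measurable borel (count_space UNIV)" by measurable
      then have [measurable]: "(\<lambda>y. d (ix (ereal (real_of_ereal y)))) \<in> borel_measurable borel"
        by (rule measurable_compose) simp
      then have "?h \<in> borel_measurable borel" by measurable
      from measurable_compose[OF id this]
      show "?h \<in> borel_measurable I_borel" .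
      have tm_eq: "(1 - \<theta>) / (1 + \<theta>) * \<theta> ^ (k + j) * ?a (k + j) = \<theta> ^ (k + j) * d (k + j) + K * (\<theta>\<^sup>2) ^ (k + j)" for k
      proof -
        have "w * t * (b / w + K / w * t) = t * b + K * (t * t)" for t b
          using w0 by (simp add: distrib_left mult_ac)
        moreover have "(\<theta>\<^sup>2) ^ (k + j) = \<theta> ^ (k + j) * \<theta> ^ (k + j)"
          by (simp only: power2_eq_square power_mult_distrib)
        ultimately show ?thesis unfolding weight by simp
      qed
      have "(\<lambda>k. (1 - \<theta>) / (1 + \<theta>) * \<theta> ^ (k + j) * ?a (k + j)) sums ((f j)\<^sup>2 - c\<^sup>2)"
        unfolding tm_eq by (rule square_sums)
      then show "(\<lambda>k. (1 - \<theta>) / (1 + \<theta>) * \<theta> ^ k * ?a k) sums ((f j)\<^sup>2 - c\<^sup>2)"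
        by (subst (asm) sums_zero_iff_shift) auto
      show "0 \<le> ?a k" for k using d_nonneg[of k] K_nonneg c_props(4) \<theta> by simp
      show "?h (ereal (\<theta> ^ k)) = ennreal (?a k)" for k
        using \<theta> by (simp add: j power_decreasing_iff ix_power)
    qed simp_all
    then show ?thesis unfolding j ix_power by (simp add: c_def)
  qed
  show "0 \<le> d (ix (ereal y)) / (w * y)" if "y \<in> Xi \<theta>" for y
    using that d_nonneg c_props(4) \<theta> by (auto simp: Xi)
  show "0 \<le> K / w" using K_nonneg c_props(4) by simp
  show "1 / (1 + \<theta>) \<le> f (ix (ereal x))" for x using f_ge by (simp add: c_def)
  show "f (ix (ereal 1)) \<le> 1" using f0(2) ix_power[of 0] by simp
qed

end

lemma exists_nontrivial_solution_lt_1: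
  assumes "0 < \<theta>" "\<theta> < 1" "g \<theta> < 0"
  shows "\<exists>\<rho>\<in>M2_theta \<theta>. \<rho> \<noteq> rho_bar \<theta> \<and> solves_bivariate_RDE \<rho>"
proof -
  obtain f where seq: "1 / (1 + \<theta>) < f 0" "f 0 \<le> 1" "decseq f" "f \<longlonglongrightarrow> 1 / (1 + \<theta>)"
    "\<And>j. (f j - f (Suc j)) * (f j + f (Suc j) - \<theta> ^ j) = (1 - \<theta>\<^sup>2) * f 0 * (f 0 - 1 / (1 + \<theta>)) / 2 * (\<theta>\<^sup>2) ^ j"
    by (rule exists_nontrivial_sequence[OF assms]) blast
  interpret nontrivial_sequence \<theta> f
    by unfold_locales (use assms seq in auto)
  have "f (ix (ereal 1)) = f 0" using ix_power[of 0] by simp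
  then have "\<rho> \<noteq> rho_bar \<theta>" using \<rho>_neq_rho_bar seq(1) by simp
  then show ?thesis using \<rho>_solves by blast
qed

section \<open>A nontrivial solution for \<open>\<theta> = 1\<close>\<close>

text \<open>\<open>a\<close> and \<open>-(1 + a)\<close> are to be the growth rates of the linear
  system and \<open>F\<close> the value \<open>f 1\<close>. The product equation is the
  compatibility condition on \<open>k = a * (1 + a) / 2\<close>, and the logarithmic one says that a
  single time \<open>T\<close> satisfies both \<open>exp (a * T) = 2 * F + a\<close> and
  \<open>exp (- (1 + a) * T) = 2 * F - 1 - a\<close>.\<close>

lemma exists_exponent:
  obtains a F :: real where "0 < a" "1 / 2 < F" "F \<le> 1" "F * (2 * F - 1) = a * (1 + a)" "0 < 2 * F - 1 - a"
    "(1 + a) * ln (2 * F + a) + a * ln (2 * F - 1 - a) = 0"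
proof -
  \<comment> \<open>\<open>F a\<close> is the positive root of the product equation. As
    \<open>a * (1 + a)\<close> then factors into \<open>(2 * F a + a) * (2 * F a - 1 - a)\<close>,
    the logarithmic equation becomes \<open>L a = 0\<close>.\<close>
  define b where "b a = sqrt (1 + 8 * (a * (1 + a)))" for a :: real
  define F where "F a = (1 + b a) / 4" for a
  define L where "L a = ln (2 * F a + a) + a * ln (a * (1 + a))" for a
  have b_sq: "(b a)\<^sup>2 = 1 + 8 * (a * (1 + a))" if "0 < a" for a
    unfolding b_def using that by (intro real_sqrt_pow2) (simp add: add_nonneg_nonneg)
  have b_gt: "1 + 2 * a < b a" if "0 < a" for a
  proof -
    have "(1 + 2 * a)\<^sup>2 < 1 + 8 * (a * (1 + a))"
    proof -
      have "(1 + 2 * a)\<^sup>2 = 1 + 4 * a + 4 * (a * a)" "1 + 8 * (a * (1 + a)) = 1 + 8 * a + 8 * (a * a)"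
        by (simp_all add: power2_eq_square algebra_simps)
      then show ?thesis using that mult_pos_pos[OF that that] by linarith
    qed
    then show ?thesis unfolding b_def by (rule real_less_rsqrt)
  qed
  have F_eq: "F a * (2 * F a - 1) = a * (1 + a)" if "0 < a" for a
    using b_sq[OF that] by (simp add: F_def power2_eq_square field_simps)
  have F_gt: "1 / 2 < F a" "0 < 2 * F a - 1 - a" if "0 < a" for a
    using b_gt[OF that] that by (simp_all add: F_def field_simps)
  have "continuous_on {1/64..1/2} L"
    unfolding L_def F_def b_def
  proof (intro continuous_intros ballI)
    fix a :: real assume "a \<in> {1/64..1/2}"
    then have "0 < a" by simp
    then have ne: "2 * F a + a \<noteq> 0" "a * (1 + a) \<noteq> 0" using F_gt(1)[of a] by auto
    show "2 * ((1 + sqrt (1 + 8 * (a * (1 + a)))) / 4) + a \<noteq> 0" "a * (1 + a) \<noteq> 0"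
      using ne unfolding F_def b_def by blast+
  qed auto
  \<comment> \<open>Convenient end points: at \<open>1/64\<close> one has
    \<open>2 * F - 1 \<le> 130/4096\<close> and \<open>65/4096 \<le> 1/32\<close>, while at
    \<open>1/2\<close> the value is at least half of \<open>ln (27/16)\<close>. The range
    \<open>a \<le> 1/2\<close> also keeps \<open>F \<le> 1\<close>.\<close>
  moreover have "L (1/64) \<le> 0"
  proof -
    have F: "1 / 2 < F (1/64)" using F_gt(1) by simp
    have "F (1/64) * (2 * F (1/64) - 1) = 65 / 4096" using F_eq[of "1/64"] by simp
    moreover have "1 / 2 * (2 * F (1/64) - 1) \<le> F (1/64) * (2 * F (1/64) - 1)"
      using F by (intro mult_right_mono) auto
    ultimately have "2 * F (1/64) + 1/64 - 1 \<le> 130 / 4096 + 1/64" by simp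
    moreover have "ln (2 * F (1/64) + 1/64) \<le> 2 * F (1/64) + 1/64 - 1"
      using F by (intro ln_le_minus_one) auto
    moreover have "ln (65 / 4096 :: real) \<le> - (10/3)"
    proof -
      have "ln (65 / 4096 :: real) \<le> ln (inverse (2 ^ 5))" by simp
      also have "\<dots> = - (5 * ln 2)" by (simp only: ln_inverse ln_realpow zero_less_numeral)
      also have "\<dots> \<le> - (10/3)" using ln2_ge_two_thirds by simp
      finally show ?thesis .
    qed
    ultimately show ?thesis by (simp add: L_def)
  qed
  moreover have "0 \<le> L (1/2)"
  proof -
    have F: "1 / 2 < F (1/2)" using F_gt(1) by simp
    have "0 \<le> ln ((3/2)\<^sup>2 * (3/4::real))" by (simp add: power2_eq_square)
    also have "\<dots> = ln ((3/2)\<^sup>2) + ln (3/4 :: real)" by (rule ln_mult_pos) auto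
    also have "\<dots> = 2 * ln (3/2) + ln (3/4 :: real)" using ln_realpow[of "3/2::real" 2] by simp
    also have "\<dots> \<le> 2 * ln (2 * F (1/2) + 1/2) + ln (3/4)" using F by simp
    finally show ?thesis by (simp add: L_def)
  qed
  ultimately obtain a where a: "1/64 \<le> a" "a \<le> 1/2" "L a = 0"
    using IVT'[of L "1/64" 0 "1/2"] by auto
  then have a0: "0 < a" by simp
  have "a * (1 + a) \<le> 1/2 * (1 + 1/2)" using a by (intro mult_mono) auto
  then have "b a \<le> sqrt (3\<^sup>2)" unfolding b_def by (intro real_sqrt_le_mono) simp
  then have "F a \<le> 1" by (simp add: F_def)
  moreover have "(1 + a) * ln (2 * F a + a) + a * ln (2 * F a - 1 - a) = 0"
  proof -
    have "a * (1 + a) = (2 * F a + a) * (2 * F a - 1 - a)"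
      using F_eq[OF a0] by (simp add: algebra_simps)
    then have "ln (a * (1 + a)) = ln (2 * F a + a) + ln (2 * F a - 1 - a)"
      using F_gt[OF a0] a0 by (simp add: ln_mult)
    then show ?thesis using a(3) by (simp add: L_def algebra_simps)
  qed
  ultimately show ?thesis using that a0 F_gt[OF a0] F_eq[OF a0] by blast
qed

text \<open>
  The continuum limit of the recursion is \<open>f' y * (2 * f y - y) = k * y\<close>. Along a suitable time
  parameter \<open>s\<close> it is the linear system \<open>y' = 2 * f - y\<close>, \<open>f' = k * y\<close>, whose solution is explicit.
\<close>
lemma exists_ode_solution:
  obtains f :: "real \<Rightarrow> real" and k :: real where
    "0 < k" "\<And>y. (f has_real_derivative k * y / (2 * f y - y)) (at y)" "\<And>y. 0 < 2 * f y - y"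
    "\<And>y. k * y\<^sup>2 < f y * (2 * f y - y)" "f 0 = 1 / 2" "1 / 2 < f 1" "f 1 \<le> 1"
    "2 * k = f 1 * (2 * f 1 - 1)"
proof -
  obtain a F :: real where aF: "0 < a" "1 / 2 < F" "F \<le> 1" "F * (2 * F - 1) = a * (1 + a)" "0 < 2 * F - 1 - a"
    "(1 + a) * ln (2 * F + a) + a * ln (2 * F - 1 - a) = 0"
    by (rule exists_exponent)
  define k where "k = a * (1 + a) / 2"
  \<comment> \<open>The trajectory of \<open>(y, f)\<close> started at \<open>(0, 1/2)\<close>, with
    \<open>x'\<close> the velocity of the first component.\<close>
  define x where "x s = (exp (a * s) - exp (- (1 + a) * s)) / (1 + 2 * a)" for s
  define x' where "x' s = (a * exp (a * s) + (1 + a) * exp (- (1 + a) * s)) / (1 + 2 * a)" for s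
  define \<phi> where "\<phi> s = ((1 + a) * exp (a * s) + a * exp (- (1 + a) * s)) / (2 * (1 + 2 * a))" for s
  have a2: "1 + 2 * a \<noteq> 0" using aF(1) by simp
  have dx: "(x has_real_derivative x' s) (at s)" for s
  proof -
    have "((\<lambda>s. exp (a * s) - exp (- (1 + a) * s)) has_real_derivative a * exp (a * s) + (1 + a) * exp (- (1 + a) * s)) (at s)"
      by (auto intro!: derivative_eq_intros simp: algebra_simps)
    then show ?thesis unfolding x_def[abs_def] x'_def by (rule DERIV_cdivide)
  qed
  have d\<phi>: "(\<phi> has_real_derivative k * x s) (at s)" for s
  proof -
    have "((\<lambda>s. (1 + a) * exp (a * s) + a * exp (- (1 + a) * s)) has_real_derivative
        a * (1 + a) * (exp (a * s) - exp (- (1 + a) * s))) (at s)"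
      by (auto intro!: derivative_eq_intros simp: algebra_simps)
    from DERIV_cdivide[OF this, of "2 * (1 + 2 * a)"] show ?thesis
      unfolding \<phi>_def[abs_def] k_def x_def by (simp add: mult.assoc)
  qed
  have x'pos: "0 < x' s" for s unfolding x'_def using aF(1) by (intro divide_pos_pos add_pos_pos mult_pos_pos) auto
  have x'_eq: "x' s = 2 * \<phi> s - x s" for s
    unfolding x'_def x_def \<phi>_def using a2 by (simp add: divide_simps) (simp add: algebra_simps)
  \<comment> \<open>The eigencombinations of the linear system. Their positivity later gives
    \<open>ineq\<close>, as their product is
    \<open>2 * (f y * (2 * f y - y) - k * y\<^sup>2)\<close>; at time \<open>T\<close> they identify
    the end point.\<close>
  have e1: "2 * \<phi> s + a * x s = exp (a * s)" for s
    unfolding \<phi>_def x_def using a2 by (simp add: divide_simps) (simp add: algebra_simps)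
  have e2: "2 * \<phi> s - (1 + a) * x s = exp (- (1 + a) * s)" for s
    unfolding \<phi>_def x_def using a2 by (simp add: divide_simps) (simp add: algebra_simps)
  have xmono: "strict_mono x"
  proof (rule strict_monoI)
    fix u v :: real assume "u < v"
    then show "x u < x v"
    proof (rule DERIV_pos_imp_increasing)
      show "\<exists>y. (x has_real_derivative y) (at r) \<and> 0 < y" for r
        using dx[of r] x'pos[of r] by (intro exI conjI)
    qed
  qed
  have cont: "isCont x s" for s using dx by (rule DERIV_isCont)
  \<comment> \<open>Reaching every real \<open>y\<close> makes \<open>f\<close> differentiable on
    the whole line, so no one-sided derivatives occur at 0 and 1. \<open>M\<close> is chosen so that
    \<open>exp u \<ge> 1 + u\<close> already suffices.\<close>
  have surj: "\<exists>s. x s = y" for y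
  proof -
    define M where "M = (1 + 2 * a) * (\<bar>y\<bar> + 1) / a"
    have M: "0 \<le> M" unfolding M_def using aF(1) by simp
    have aM: "a * M = (1 + 2 * a) * (\<bar>y\<bar> + 1)" using aF(1) by (simp add: M_def)
    have E: "1 + u \<le> exp u" for u :: real by (rule exp_ge_add_one_self)
    have "(1 + 2 * a) * y \<le> a * M"
      unfolding aM using aF(1) by (intro mult_left_mono) auto
    also have "\<dots> \<le> exp (a * M) - exp (- (1 + a) * M)"
    proof -
      have "0 \<le> (1 + a) * M" using M aF(1) by (intro mult_nonneg_nonneg) auto
      then have "exp (- (1 + a) * M) \<le> 1" by (simp only: mult_minus_left exp_le_one_iff neg_le_0_iff_le)
      then show ?thesis using E[of "a * M"] by linarith
    qed
    finally have up: "y \<le> x M" using aF(1) by (simp add: x_def field_simps)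
    have "exp (a * (- M)) - exp (- (1 + a) * (- M)) \<le> - (a * M)"
    proof -
      have "exp (a * (- M)) \<le> 1" using M aF(1) by simp
      moreover have "1 + a * M \<le> exp (- (1 + a) * (- M))"
      proof -
        have m: "- (1 + a) * (- M) = (1 + a) * M" "(1 + a) * M = a * M + M" by (simp_all add: algebra_simps)
        show ?thesis unfolding m(1) using E[of "(1 + a) * M"] m(2) M by linarith
      qed
      ultimately show ?thesis by linarith
    qed
    also have "- (a * M) \<le> (1 + 2 * a) * y"
    proof -
      have "(1 + 2 * a) * (- y) \<le> a * M" unfolding aM using aF(1) by (intro mult_left_mono) auto
      then show ?thesis by simp
    qed
    finally have "x (- M) \<le> y" using aF(1) by (simp add: x_def field_simps)
    with up M cont show ?thesis using IVT[of x "- M" y M] by auto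
  qed
  define S where "S = inv x"
  have xS: "x (S y) = y" for y unfolding S_def using surj by (intro f_inv_into_f) (metis rangeI)
  have Sx: "S (x s) = s" for s
    unfolding S_def using strict_mono_imp_inj_on[OF xmono] by (rule inv_f_f)
  have contS: "isCont S y" for y
  proof -
    have "isCont S (x (S y))"
      by (rule isCont_inverse_function2[of "S y - 1" _ "S y + 1"]) (use Sx cont in auto)
    then show ?thesis by (simp add: xS)
  qed
  have dS: "(S has_real_derivative inverse (x' (S y))) (at y)" for y
    by (rule DERIV_inverse_function[OF dx, where a = "y - 1" and b = "y + 1"])
      (use x'pos[of "S y"] xS contS in auto)
  define f where "f y = \<phi> (S y)" for y
  have f2: "2 * f y - y = x' (S y)" for y using x'_eq[of "S y"] by (simp add: f_def xS)
  have df: "(f has_real_derivative k * y / (2 * f y - y)) (at y)" for y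
    unfolding f_def[abs_def] f2[unfolded f_def]
    using DERIV_chain2[OF d\<phi> dS, of y] by (simp add: xS divide_inverse)
  have pos: "0 < 2 * f y - y" for y unfolding f2 by (rule x'pos)
  have ineq: "k * y\<^sup>2 < f y * (2 * f y - y)" for y
  proof -
    have "0 < (2 * f y + a * y) * (2 * f y - (1 + a) * y)"
      using e1[of "S y"] e2[of "S y"] by (simp add: f_def xS)
    also have "\<dots> = 2 * (f y * (2 * f y - y) - k * y\<^sup>2)"
      by (simp add: k_def power2_eq_square algebra_simps)
    finally show ?thesis by simp
  qed
  have "x 0 = 0" by (simp add: x_def)
  then have "S 0 = 0" using Sx[of 0] by simp
  then have f0: "f 0 = 1 / 2" using aF(1) by (simp add: f_def \<phi>_def field_simps)
  define T where "T = ln (2 * F + a) / a"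
  have E1: "exp (a * T) = 2 * F + a" unfolding T_def using aF by simp
  have E2: "exp (- (1 + a) * T) = 2 * F - 1 - a"
  proof -
    have "- (1 + a) * T = - ((1 + a) * ln (2 * F + a)) / a"
      unfolding T_def by (simp only: mult_minus_left times_divide_eq_right minus_divide_left)
    also have "\<dots> = a * ln (2 * F - 1 - a) / a" using aF(6) by (simp add: add_eq_0_iff)
    also have "\<dots> = ln (2 * F - 1 - a)" using aF(1) by simp
    finally show ?thesis using aF(5) by simp
  qed
  have "x T = 1" unfolding x_def E1 E2 using a2 by simp
  then have "S 1 = T" using Sx[of T] by simp
  have "\<phi> T = ((1 + a) * (2 * F + a) + a * (2 * F - 1 - a)) / (2 * (1 + 2 * a))" unfolding \<phi>_def E1 E2 ..
  also have "(1 + a) * (2 * F + a) + a * (2 * F - 1 - a) = 2 * (1 + 2 * a) * F" by (simp add: algebra_simps)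
  finally have f1: "f 1 = F" using a2 \<open>S 1 = T\<close> by (simp add: f_def)
  show ?thesis
  proof (rule that[of k f])
    show "0 < k" using aF(1) by (simp add: k_def)
    show "2 * k = f 1 * (2 * f 1 - 1)" using aF(4) by (simp add: k_def f1)
  qed (use df pos ineq f0 f1 aF in auto)
qed

text \<open>\<open>A\<close>, \<open>B\<close> and 0 are exempt from \<open>eq\<close> as null
  points, so integrands cut off by a strict inequality fit the closed interval. The halves in
  \<open>I\<close> are the density and the atom of \<open>rho_Xi 1\<close>.\<close>

lemma nn_integral_rho_Xi_1_FTC:
  assumes h: "h \<in> borel_measurable I_borel" and b: "h \<infinity> = ennreal b" "0 \<le> b"
    and AB: "0 \<le> A" "A \<le> B" "B \<le> 1" and \<psi>: "\<psi> \<in> borel_measurable borel"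
    and \<Psi>: "\<And>u. u \<in> {A..B} \<Longrightarrow> (\<Psi> has_real_derivative \<psi> u) (at u)" "\<And>u. u \<in> {A..B} \<Longrightarrow> 0 \<le> \<psi> u"
    and eq: "\<And>u. 0 < u \<Longrightarrow> u \<le> 1 \<Longrightarrow> u \<noteq> A \<Longrightarrow> u \<noteq> B \<Longrightarrow> h (ereal u) = ennreal (\<psi> u) * indicator {A..B} u"
    and I: "I = (\<Psi> B - \<Psi> A) / 2 + b / 2"
  shows "(\<integral>\<^sup>+y. h y \<partial>rho_Xi 1) = ennreal I"
proof -
  have ae: "AE u in lborel. u \<noteq> A \<and> u \<noteq> B \<and> u \<noteq> (0::real)"
    using AE_lborel_singleton[of A] AE_lborel_singleton[of B] AE_lborel_singleton[of "0::real"]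
    by eventually_elim simp
  have "(\<integral>\<^sup>+u. h (ereal u) * indicator {0..1} u \<partial>lborel) = (\<integral>\<^sup>+u. ennreal (\<psi> u) * indicator {A..B} u \<partial>lborel)"
  proof (rule nn_integral_cong_AE)
    show "AE u in lborel. h (ereal u) * indicator {0..1} u = ennreal (\<psi> u) * indicator {A..B} u"
      using ae
    proof eventually_elim
      case (elim u)
      then show ?case using eq[of u] AB by (cases "u \<in> {0..1}") (auto simp: indicator_def)
    qed
  qed
  also have "\<dots> = ennreal (\<Psi> B - \<Psi> A)"
    by (rule nn_integral_FTC_Icc[OF \<psi> \<Psi> AB(2)])
  finally have 1: "(\<integral>\<^sup>+u. h (ereal u) * indicator {0..1} u \<partial>lborel) = ennreal (\<Psi> B - \<Psi> A)" .
  have "\<Psi> A \<le> \<Psi> B"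
    by (rule DERIV_nonneg_imp_nondecreasing[OF AB(2)]) (use \<Psi> in auto)
  then show ?thesis
    unfolding nn_integral_rho_Xi_1[OF h] 1 b(1) I using b(2)
    by (simp only: ennreal_mult[symmetric] ennreal_plus[symmetric] diff_ge_0_iff_ge zero_le_divide_1_iff zero_le_numeral mult_nonneg_nonneg) simp
qed

section \<open>The joint density for \<theta> = 1\<close>

locale ode_solution =
  fixes f :: "real \<Rightarrow> real" and k :: real
  assumes k: "0 < k" and f_deriv: "\<And>y. (f has_real_derivative k * y / (2 * f y - y)) (at y)"
    and denom: "\<And>y. 0 < 2 * f y - y" and ineq: "\<And>y. k * y\<^sup>2 < f y * (2 * f y - y)"
    and f_0: "f 0 = 1 / 2" and f_1: "1 / 2 < f 1" "f 1 \<le> 1" and k_eq: "2 * k = f 1 * (2 * f 1 - 1)"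
begin

definition f' where "f' y = k * y / (2 * f y - y)"
definition f'' where "f'' y = 2 * k * (f y - y * f' y) / (2 * f y - y)\<^sup>2"

lemma DERIV_f: "(f has_real_derivative f' y) (at y)"
  unfolding f'_def by (rule f_deriv)

lemma f'_eq: "f' y * (2 * f y - y) = k * y"
  using denom[of y] by (simp add: f'_def)

lemma DERIV_f': "(f' has_real_derivative f'' y) (at y)"
proof -
  have "2 * f y - y \<noteq> 0" using denom[of y] by simp
  then have "((\<lambda>y. k * y / (2 * f y - y)) has_real_derivative
      (k * (2 * f y - y) - k * y * (2 * f' y - 1)) / ((2 * f y - y) * (2 * f y - y))) (at y)"
    by (auto intro!: derivative_eq_intros DERIV_f)
  moreover have "(k * (2 * f y - y) - k * y * (2 * f' y - 1)) = 2 * k * (f y - y * f' y)"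
    by (simp add: algebra_simps)
  ultimately show ?thesis by (simp add: f'_def[abs_def] f''_def power2_eq_square)
qed

text \<open>Multiplying \<open>f y - y * f' y\<close> by \<open>2 * f y - y\<close> gives exactly
  the gap in \<open>ineq\<close>.\<close>

lemma f''_nonneg: "0 \<le> f'' y"
proof -
  have "(f y - y * f' y) * (2 * f y - y) = f y * (2 * f y - y) - k * y\<^sup>2"
    using f'_eq[of y] by (simp add: power2_eq_square algebra_simps)
  then have "0 < (f y - y * f' y) * (2 * f y - y)" using ineq[of y] by simp
  then have "0 < f y - y * f' y" using denom[of y] by (simp add: zero_less_mult_iff)
  then show ?thesis unfolding f''_def using k by simp
qed

lemma f'_nonneg: "0 \<le> y \<Longrightarrow> 0 \<le> f' y"
  unfolding f'_def using k denom[of y] by simp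

text \<open>The form of \<open>k_eq\<close> that balances the masses: the conditional law given
  \<open>Y' = t\<close> puts \<open>1 - f 1\<close> below \<open>t\<close> and
  \<open>2 * f' 1\<close> above it.\<close>

lemma f'_1: "f' 1 = f 1 / 2"
proof -
  have "f' 1 * (2 * f 1 - 1) = (f 1 / 2) * (2 * f 1 - 1)" using f'_eq[of 1] k_eq by simp
  then show "f' 1 = f 1 / 2" using denom[of 1] by (simp only: mult_cancel_right) simp
qed

lemma isCont_f: "isCont f y" and isCont_f': "isCont f' y"
  by (rule DERIV_isCont[OF DERIV_f], rule DERIV_isCont[OF DERIV_f'])

lemma f_measurable [measurable]: "f \<in> borel_measurable borel"
  by (intro borel_measurable_continuous_onI continuous_at_imp_continuous_on ballI isCont_f)

lemma f'_measurable [measurable]: "f' \<in> borel_measurable borel"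
  by (intro borel_measurable_continuous_onI continuous_at_imp_continuous_on ballI isCont_f')

lemma f''_measurable [measurable]: "f'' \<in> borel_measurable borel"
  unfolding f''_def[abs_def] by measurable

text \<open>With \<open>H s t = s * f (t / s)\<close> for \<open>t \<le> s\<close>, minus the mixed
  derivative of \<open>H\<close> is \<open>f'' (t / s) * t / s\<^sup>2\<close>, the pairs with
  \<open>Y\<close> infinite have density \<open>f' t\<close> in \<open>Y'\<close>, and mass
  \<open>1 - f 1\<close> remains for both infinite. The factor 4 is due to the two marginal weights
  \<open>1/2\<close>.\<close>

definition D :: "ereal \<Rightarrow> ereal \<Rightarrow> ennreal" where
  "D u v = (if u = \<infinity> then (if v = \<infinity> then ennreal (4 * (1 - f 1)) else ennreal (4 * f' (real_of_ereal v)))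
    else (if v = \<infinity> then ennreal (4 * f' (real_of_ereal u))
      else ennreal (4 * f'' (real_of_ereal (min u v) / real_of_ereal (max u v))
        * real_of_ereal (min u v) / (real_of_ereal (max u v))\<^sup>2)))"

lemma D_commute: "D u v = D v u"
  by (simp add: D_def min.commute max.commute)

lemma D_measurable_I2: "(\<lambda>q. D (fst q) (snd q)) \<in> borel_measurable I2_borel"
  unfolding D_def by measurable

lemma D_section_measurable: "v \<in> I_set \<Longrightarrow> (\<lambda>y'. D y' v) \<in> borel_measurable I_borel"
  using measurable_Pair1[OF D_measurable_I2[unfolded I2_borel_def], of v] by simp

lemma D_values:
  "D \<infinity> \<infinity> = ennreal (4 * (1 - f 1))" "D \<infinity> (ereal t) = ennreal (4 * f' t)" "D (ereal u) \<infinity> = ennreal (4 * f' u)"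
  "u \<le> t \<Longrightarrow> D (ereal u) (ereal t) = ennreal (4 * f'' (u / t) * u / t\<^sup>2)"
  "t \<le> u \<Longrightarrow> D (ereal u) (ereal t) = ennreal (4 * f'' (t / u) * t / u\<^sup>2)"
  by (simp_all add: D_def min_def max_def)

text \<open>In \<open>z = u / t\<close> the integrand is a multiple of \<open>z * f'' z\<close>,
  with antiderivative \<open>z * f' z - f z\<close>; \<open>f'_1\<close> evaluates it at 1.\<close>

lemma D_lower:
  assumes t: "0 < t" "t \<le> 1"
  shows "(\<integral>\<^sup>+y'. (if y' \<le> ereal t then D y' (ereal t) else 0) \<partial>rho_Xi 1) = ennreal (1 - f 1)" (is "integral\<^sup>N _ ?h = _")
proof (rule nn_integral_rho_Xi_1_FTC[where A = 0 and B = t and b = 0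
      and \<psi> = "\<lambda>u. 4 * f'' (u / t) * u / t\<^sup>2" and \<Psi> = "\<lambda>u. 4 * (u / t * f' (u / t) - f (u / t))"])
  note [measurable] = measurable_I_borel_borel
  have [measurable]: "(\<lambda>y'. D y' (ereal t)) \<in> borel_measurable I_borel"
    using t by (intro D_section_measurable) simp
  show "?h \<in> borel_measurable I_borel" by measurable
  show "((\<lambda>u. 4 * (u / t * f' (u / t) - f (u / t))) has_real_derivative 4 * f'' (u / t) * u / t\<^sup>2) (at u)" for u
    using t by (auto intro!: derivative_eq_intros DERIV_chain2[OF DERIV_f] DERIV_chain2[OF DERIV_f'] simp: field_simps power2_eq_square)
  show "1 - f 1 = (4 * (t / t * f' (t / t) - f (t / t)) - 4 * (0 / t * f' (0 / t) - f (0 / t))) / 2 + 0 / 2"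
    using t by (simp add: f'_1 f_0)
qed (use t f''_nonneg in \<open>auto simp: D_values split: split_indicator\<close>)

text \<open>The boundary term of the antiderivative at \<open>u = 1\<close> cancels against the atom
  at infinity, so the result depends on \<open>t / s\<close> alone.\<close>

lemma D_upper:
  assumes t: "0 < t" "t \<le> s" "s \<le> 1"
  shows "(\<integral>\<^sup>+y'. (if ereal s < y' then D y' (ereal t) else 0) \<partial>rho_Xi 1) = ennreal (2 * f' (t / s))" (is "integral\<^sup>N _ ?h = _")
proof (rule nn_integral_rho_Xi_1_FTC[where A = s and B = 1 and b = "4 * f' t"
      and \<psi> = "\<lambda>u. 4 * f'' (t / u) * t / u\<^sup>2" and \<Psi> = "\<lambda>u. - 4 * f' (t / u)"])
  note [measurable] = measurable_I_borel_borel
  have [measurable]: "(\<lambda>y'. D y' (ereal t)) \<in> borel_measurable I_borel"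
    using t by (intro D_section_measurable) simp
  show "?h \<in> borel_measurable I_borel" by measurable
  show "((\<lambda>u. - 4 * f' (t / u)) has_real_derivative 4 * f'' (t / u) * t / u\<^sup>2) (at u)" if "u \<in> {s..1}" for u
    using t that by (auto intro!: derivative_eq_intros DERIV_chain2[OF DERIV_f'] simp: field_simps power2_eq_square)
  show "2 * f' (t / s) = (- 4 * f' (t / 1) - - 4 * f' (t / s)) / 2 + 4 * f' t / 2" by (simp add: field_simps)
qed (use t f''_nonneg f'_nonneg in \<open>auto simp: D_values split: split_indicator\<close>)

lemma D_excess_integral:
  assumes t: "0 < t" "t \<le> 1"
  shows "(\<integral>\<^sup>+y'. (if y' \<le> ereal t then ennreal (t - real_of_ereal y') * D y' (ereal t) else 0) \<partial>rho_Xi 1) = ennreal (2 * k * t)" (is "integral\<^sup>N _ ?h = _")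
proof (rule nn_integral_rho_Xi_1_FTC[where A = 0 and B = t and b = 0
      and \<psi> = "\<lambda>u. (t - u) * (4 * f'' (u / t) * u / t\<^sup>2)"
      and \<Psi> = "\<lambda>u. 4 * t * ((u / t - (u / t)\<^sup>2) * f' (u / t) - f (u / t) + 2 * (f (u / t))\<^sup>2 - k * (u / t)\<^sup>2)"])
  note [measurable] = measurable_I_borel_borel
  have [measurable]: "(\<lambda>y'. D y' (ereal t)) \<in> borel_measurable I_borel"
    using t by (intro D_section_measurable) simp
  show "?h \<in> borel_measurable I_borel" by measurable
  \<comment> \<open>Integrating \<open>(z - z\<^sup>2) * f'' z\<close> by parts leaves the integral
    of \<open>z * f' z\<close>, and the differential equation in the form
    \<open>z * f' z = 2 * f z * f' z - k * z\<close> integrates this to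
    \<open>(f z)\<^sup>2 - k * z\<^sup>2 / 2\<close>.\<close>
  define \<Phi> where "\<Phi> z = (z - z\<^sup>2) * f' z - f z + 2 * (f z)\<^sup>2 - k * z\<^sup>2" for z
  have d\<Phi>: "(\<Phi> has_real_derivative (z - z\<^sup>2) * f'' z) (at z)" for z
  proof -
    have "(\<Phi> has_real_derivative (1 - 2 * z) * f' z + (z - z\<^sup>2) * f'' z - f' z + 4 * f z * f' z - 2 * k * z) (at z)"
      unfolding \<Phi>_def[abs_def] by (auto intro!: derivative_eq_intros DERIV_f DERIV_f')
    moreover have "(1 - 2 * z) * f' z + (z - z\<^sup>2) * f'' z - f' z + 4 * f z * f' z - 2 * k * z = (z - z\<^sup>2) * f'' z"
      using f'_eq[of z] by (simp add: algebra_simps)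
    ultimately show ?thesis by simp
  qed
  have "((\<lambda>u. 4 * t * \<Phi> (u / t)) has_real_derivative 4 * t * (((u / t) - (u / t)\<^sup>2) * f'' (u / t) * (1 / t))) (at u)" for u
    using t by (intro DERIV_cmult DERIV_chain2[OF d\<Phi>] DERIV_cdivide DERIV_ident)
  moreover have "4 * t * (((u / t) - (u / t)\<^sup>2) * f'' (u / t) * (1 / t)) = (t - u) * (4 * f'' (u / t) * u / t\<^sup>2)" for u
    using t by (simp add: field_simps power2_eq_square)
  ultimately show "((\<lambda>u. 4 * t * ((u / t - (u / t)\<^sup>2) * f' (u / t) - f (u / t) + 2 * (f (u / t))\<^sup>2 - k * (u / t)\<^sup>2))
      has_real_derivative (t - u) * (4 * f'' (u / t) * u / t\<^sup>2)) (at u)" for u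
    unfolding \<Phi>_def by simp
  have "\<Phi> 1 - \<Phi> 0 = k"
    using k_eq by (simp add: \<Phi>_def f_0 power2_eq_square algebra_simps)
  then have "2 * k * t = 4 * t * (\<Phi> 1 - \<Phi> 0) / 2" by simp
  then show "2 * k * t = (4 * t * ((t / t - (t / t)\<^sup>2) * f' (t / t) - f (t / t) + 2 * (f (t / t))\<^sup>2 - k * (t / t)\<^sup>2)
      - 4 * t * ((0 / t - (0 / t)\<^sup>2) * f' (0 / t) - f (0 / t) + 2 * (f (0 / t))\<^sup>2 - k * (0 / t)\<^sup>2)) / 2 + 0 / 2"
    using t by (simp add: \<Phi>_def right_diff_distrib)
qed (use t f''_nonneg in \<open>auto simp: D_values ennreal_mult[symmetric] split: split_indicator\<close>)

sublocale scale_invariant_density 1 D "\<lambda>r. 2 * f' r" f "2 * k"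
proof
  note [measurable] = measurable_I_borel_borel
  have Xi: "s \<in> Xi 1 \<longleftrightarrow> 0 < s \<and> s \<le> 1" for s by (simp add: Xi_def)
  show "(\<lambda>q. D (fst q) (snd q)) \<in> borel_measurable I2_borel" by (rule D_measurable_I2)
  show "D u v = D v u" for u v by (rule D_commute)
  show "(\<integral>\<^sup>+y'. D y' v \<partial>rho_Xi 1) = 1" if v: "v \<in> Xi_inf 1" for v
  proof -
    consider t where "v = ereal t" "0 < t" "t \<le> 1" | "v = \<infinity>" using v by (auto simp: Xi_inf_def Xi)
    then show ?thesis
    proof cases
      case (1 t)
      have D: "(\<lambda>y'. D y' (ereal t)) \<in> borel_measurable (rho_Xi 1)"
        using 1 D_section_measurable[of "ereal t"] by (simp cong: measurable_cong_sets)
      have id: "(\<lambda>y. y) \<in> borel_measurable (rho_Xi 1)"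
        using measurable_I_borel_borel by (simp cong: measurable_cong_sets)
      note [measurable] = D id
      have "(\<integral>\<^sup>+y'. D y' v \<partial>rho_Xi 1) = (\<integral>\<^sup>+y'. (if y' \<le> ereal t then D y' (ereal t) else 0)
          + (if ereal t < y' then D y' (ereal t) else 0) \<partial>rho_Xi 1)"
        unfolding 1 by (intro nn_integral_cong) auto
      also have "\<dots> = ennreal (1 - f 1) + ennreal (2 * f' (t / t))"
        by (subst nn_integral_add) (use 1 in \<open>simp_all add: D_lower D_upper\<close>)
      also have "\<dots> = 1" using 1 f_1 by (simp add: f'_1 ennreal_plus[symmetric] del: ennreal_plus)
      finally show ?thesis .
    next
      case 2
      have "(\<integral>\<^sup>+y'. D y' v \<partial>rho_Xi 1) = ennreal 1"
      proof (rule nn_integral_rho_Xi_1_FTC[where A = 0 and B = 1 and b = "4 * (1 - f 1)"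
            and \<psi> = "\<lambda>u. 4 * f' u" and \<Psi> = "\<lambda>u. 4 * f u"])
        show "(\<lambda>y'. D y' v) \<in> borel_measurable I_borel" using 2 by (intro D_section_measurable) simp
        show "((\<lambda>u. 4 * f u) has_real_derivative 4 * f' u) (at u)" for u
          by (intro DERIV_cmult DERIV_f)
        show "D \<infinity> v = ennreal (4 * (1 - f 1))" using 2 by (simp add: D_values)
        show "0 \<le> 4 * (1 - f 1)" using f_1 by simp
        show "0 \<le> 4 * f' u" if "u \<in> {0..1}" for u using f'_nonneg[of u] that by simp
        show "D (ereal u) v = ennreal (4 * f' u) * indicator {0..1} u" if "0 < u" "u \<le> 1" for u
          using that 2 by (simp add: D_values)
        show "1 = (4 * f 1 - 4 * f 0) / 2 + 4 * (1 - f 1) / 2" unfolding f_0 by (simp add: field_simps)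
      qed simp_all
      then show ?thesis by simp
    qed
  qed
  show "(\<integral>\<^sup>+y'. (if ereal s < y' then D y' (ereal y) else 0) \<partial>rho_Xi 1) = ennreal (2 * f' (y / s))"
    if "s \<in> Xi 1" "y \<in> Xi 1" "y \<le> s" for s y
    using that by (intro D_upper) (auto simp: Xi)
  show "(\<integral>\<^sup>+y'. (if y' \<le> ereal y then ennreal (y - real_of_ereal y') * D y' (ereal y) else 0) \<partial>rho_Xi 1) = ennreal (2 * k * y)"
    if "y \<in> Xi 1" for y
    using that by (intro D_excess_integral) (auto simp: Xi)
  show "(\<integral>\<^sup>+y. (if y \<le> ereal t then ennreal (2 * f' (real_of_ereal y / s)) else 0) \<partial>rho_Xi 1)
      = ennreal (s * (f (t / s) - 1 / (1 + 1)))" (is "integral\<^sup>N _ ?h = _")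
    if st: "s \<in> Xi 1" "t \<in> Xi 1" "t \<le> s" for s t
  proof (rule nn_integral_rho_Xi_1_FTC[where A = 0 and B = t and b = 0
        and \<psi> = "\<lambda>u. 2 * f' (u / s)" and \<Psi> = "\<lambda>u. 2 * s * f (u / s)"])
    show "?h \<in> borel_measurable I_borel"
      by measurable
    have "((\<lambda>u. 2 * s * f (u / s)) has_real_derivative 2 * s * (f' (u / s) * (1 / s))) (at u)" for u
      by (intro DERIV_cmult DERIV_chain2[OF DERIV_f] DERIV_cdivide DERIV_ident)
    then show "((\<lambda>u. 2 * s * f (u / s)) has_real_derivative 2 * f' (u / s)) (at u)" for u
      using st by (simp add: Xi)
    show "0 \<le> 2 * f' (u / s)" if "u \<in> {0..t}" for u using f'_nonneg[of "u / s"] that st by (simp add: Xi)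
    show "?h (ereal u) = ennreal (2 * f' (u / s)) * indicator {0..t} u" if "0 < u" for u
      using that by simp
    show "s * (f (t / s) - 1 / (1 + 1)) = (2 * s * f (t / s) - 2 * s * f (0 / s)) / 2 + 0 / 2"
      using f_0 by (simp add: right_diff_distrib)
  qed (use st in \<open>simp_all add: Xi\<close>)
  show "(\<integral>\<^sup>+y. (if y \<le> ereal x then ennreal (real_of_ereal y * (2 * f' (real_of_ereal y)) + 2 * k * real_of_ereal y) else 0) \<partial>rho_Xi 1)
      = ennreal ((f x)\<^sup>2 - (1 / (1 + 1))\<^sup>2)" (is "integral\<^sup>N _ ?h = _")
    if x: "x \<in> Xi 1" for x
  proof (rule nn_integral_rho_Xi_1_FTC[where A = 0 and B = x and b = 0
        and \<psi> = "\<lambda>u. u * (2 * f' u) + 2 * k * u" and \<Psi> = "\<lambda>u. 2 * (f u)\<^sup>2"])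
    show "?h \<in> borel_measurable I_borel"
      by measurable
    have "((\<lambda>u. 2 * (f u)\<^sup>2) has_real_derivative 4 * f u * f' u) (at u)" for u
      by (auto intro!: derivative_eq_intros DERIV_f)
    moreover have "4 * f u * f' u = u * (2 * f' u) + 2 * k * u" for u
      using f'_eq[of u] by (simp add: algebra_simps)
    ultimately show "((\<lambda>u. 2 * (f u)\<^sup>2) has_real_derivative u * (2 * f' u) + 2 * k * u) (at u)" for u by simp
    show "0 \<le> u * (2 * f' u) + 2 * k * u" if "u \<in> {0..x}" for u
      using f'_nonneg[of u] that k by simp
    show "?h (ereal u) = ennreal (u * (2 * f' u) + 2 * k * u) * indicator {0..x} u" if "0 < u" for u
      using that by simp
    show "(f x)\<^sup>2 - (1 / (1 + 1))\<^sup>2 = (2 * (f x)\<^sup>2 - 2 * (f 0)\<^sup>2) / 2 + 0 / 2"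
      unfolding f_0 by (simp add: power2_eq_square)
  qed (use x in \<open>simp_all add: Xi\<close>)
  show "0 \<le> 2 * f' y" if "y \<in> Xi 1" for y using that f'_nonneg[of y] by (simp add: Xi)
  show "1 / (1 + 1) \<le> f x" if x: "x \<in> Xi 1" for x
  proof -
    have "f 0 \<le> f x"
      by (rule DERIV_nonneg_imp_nondecreasing) (use x DERIV_f f'_nonneg in \<open>auto simp: Xi\<close>)
    then show ?thesis by (simp add: f_0)
  qed
qed (use k f_1 in auto)

end

lemma exists_nontrivial_solution_1:
  "\<exists>\<rho>\<in>M2_theta 1. \<rho> \<noteq> rho_bar 1 \<and> solves_bivariate_RDE \<rho>"
proof -
  obtain f k where sol: "0 < k" "\<And>y. (f has_real_derivative k * y / (2 * f y - y)) (at y)" "\<And>y. 0 < 2 * f y - y"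
    "\<And>y. k * y\<^sup>2 < f y * (2 * f y - y)" "f 0 = 1 / 2" "1 / 2 < f 1" "f 1 \<le> 1" "2 * k = f 1 * (2 * f 1 - 1)"
    by (rule exists_ode_solution) blast
  interpret ode_solution f k
    by unfold_locales (use sol in auto)
  have "\<rho> \<noteq> rho_bar 1" using \<rho>_neq_rho_bar sol(6) by simp
  then show ?thesis using \<rho>_solves by blast
qed

section \<open>The phase transition\<close>

theorem theorem14:
  fixes \<theta> :: real
  assumes "0 < \<theta>" and "\<theta> \<le> 1"
  shows
    "(continuous_on {0<..<1} g \<and> monotone_on {0<..<1} (<) (>) g
       \<and> g_changes_sign_at theta_star \<and> theta_star \<in> {1/2<..<1})
     \<and> (\<theta> \<le> theta_star \<longrightarrow>
          {\<rho> \<in> M2_theta \<theta>. solves_bivariate_RDE \<rho>} = {rho_bar \<theta>})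
     \<and> (theta_star < \<theta> \<longrightarrow>
          (\<exists>\<rho> \<in> M2_theta \<theta>. \<rho> \<noteq> rho_bar \<theta> \<and> solves_bivariate_RDE \<rho>))"
proof (intro conjI impI)
  show "continuous_on {0<..<1} g" by (rule continuous_on_g)
  show "monotone_on {0<..<1} (<) (>) g"
    using g_strict_antimono by (auto intro!: monotone_onI)
  show "g_changes_sign_at theta_star" "theta_star \<in> {1/2<..<1}"
    by (fact g_changes_sign_at_theta_star)+
  show "{\<rho> \<in> M2_theta \<theta>. solves_bivariate_RDE \<rho>} = {rho_bar \<theta>}" if le: "\<theta> \<le> theta_star"
  proof -
    have lt: "\<theta> < 1" using le g_changes_sign_at_theta_star(2) by simp
    have "0 \<le> g \<theta>"
      using le assms(1) g_changes_sign_at_theta_star(1,3)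
      by (cases "\<theta> = theta_star") (auto simp: g_changes_sign_at_def intro: less_imp_le)
    then have "\<rho> = rho_bar \<theta>" if "\<rho> \<in> M2_theta \<theta>" "solves_bivariate_RDE \<rho>" for \<rho>
      using I2_Xi_symmetric.RDE_solution_unique[OF I2_Xi_symmetric_if_M2_theta[OF that(1) assms] lt that] by simp
    then show ?thesis using rho_bar_solves[OF assms] by blast
  qed
  show "\<exists>\<rho>\<in>M2_theta \<theta>. \<rho> \<noteq> rho_bar \<theta> \<and> solves_bivariate_RDE \<rho>" if "theta_star < \<theta>"
  proof (cases "\<theta> < 1")
    case True
    then have "g \<theta> < 0" using that g_changes_sign_at_theta_star(1) by (auto simp: g_changes_sign_at_def)
    with True show ?thesis using assms(1) by (intro exists_nontrivial_solution_lt_1)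
  next
    case False
    then show ?thesis using exists_nontrivial_solution_1 assms(2) by simp
  qed
qed

end
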